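(* Let $R$ be a unital ring. There is a natural isomorphism of partially ordered abelian groups with order-unit $$\Phi: (\mathcal{G}(\mathrm{V}_{\mathrm{M}}(R)), \mathcal{G}(\mathrm{V}_{\mathrm{M}}(R))_+, [{}_RR]_{\mathrm{M}})\rightarrow (\mathcal{G}(\mathrm{W}_{\mathrm{M}}(R)), \mathcal{G}(\mathrm{W}_{\mathrm{M}}(R))_+, [1]_{\mathrm{M}})$$ such that $$\Phi([R^m/R^nA]_{\mathrm{M}})=m[1]_{\mathrm{M}}-[A]_{\mathrm{M}}$$ and $$\Phi^{-1}([A]_{\mathrm{M}})=m[{}_RR]_{\mathrm{M}}-[R^m/R^nA]_{\mathrm{M}}$$ for all $n,m$ and every $A\in M_{n,m}(R)$.
   Context: All unital rings are nonzero. $M(R)$ is the set of all rectangular matrices over $R$; elements of $R^n$ are row vectors, and for $A\in M_{n,m}(R)$, $R^nA=\{xA:x\in R^n\}\subseteq R^m$ is a left submodule. $\mathrm{diag}(A,B)$ is the block diagonal matrix. Matrix Malcolmson semigroup. For $A,B\in M(R)$ write $A\lesssim B$ if either $A=CBD$ for some $C,D\in M(R)$, or $B=\begin{bmatrix}C&E\\0&D\end{bmatrix}$ and $A=\begin{bmatrix}C&0\\0&D\end{bmatrix}$ for some $C,D,E\in M(R)$. Write $A\preceq_{\mathrm{M}}B$ if there is a finite chain $A=A_1\lesssim\dots\lesssim A_n=B$ in $M(R)$, and $A\sim_{\mathrm{M}}B$ if $A\preceq_{\mathrm{M}}B\preceq_{\mathrm{M}}A$. $\mathrm{W}_{\mathrm{M}}(R)=M(R)/\sim_{\mathrm{M}}$,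 with classes $\langle A\rangle_{\mathrm{M}}$, is an abelian monoid under $\langle A\rangle_{\mathrm{M}}+\langle B\rangle_{\mathrm{M}}=\langle\mathrm{diag}(A,B)\rangle_{\mathrm{M}}$, partially ordered by $\preceq_{\mathrm{M}}$, with order-unit $\langle1\rangle_{\mathrm{M}}$. Finitely presented module Malcolmson semigroup. For finitely presented left $R$-modules $\mathcal{M},\mathcal{N}$ write $\mathcal{M}\lesssim\mathcal{N}$ if one can write $\mathcal{N}=\mathcal{N}_1\oplus\mathcal{N}_2$ such that there is an exact sequence $\mathcal{N}_1\to\mathcal{M}\to\mathcal{N}_2\to0$. Write $\mathcal{M}\preceq_{\mathrm{M}}\mathcal{N}$ if there is a finite chain $\mathcal{M}=\mathcal{M}_1\lesssim\dots\lesssim\mathcal{M}_n=\mathcal{N}$ of finitely presented left $R$-modules, and $\mathcal{M}\sim_{\mathrm{M}}\mathcal{N}$ if $\mathcal{M}\preceq_{\mathrm{M}}\mathcal{N}\preceq_{\mathrm{M}}\mathcal{M}$. $\mathrm{V}_{\mathrm{M}}(R)$ is the set of $\sim_{\mathrm{M}}$-classes $\langle\mathcal{M}\rangle_{\mathrm{M}}$ of finitely presented left $R$-modules, an abelian monoid under $\langle\mathcal{M}\rangle_{\mathrm{M}}+\langle\mathcal{N}\rangle_{\mathrm{M}}=\langle\mathcal{M}\oplus\mathcal{N}\rangle_{\mathrm{M}}$, partially ordered by $\preceq_{\mathrm{M}}$, with order-unit $\langle{}_RR\rangle_{\mathrm{M}}$. Grothendieck groups. For a partially ordered abelian semigroup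 $(\mathrm{W},\preceq)$, $\mathcal{G}(\mathrm{W})$ is its Grothendieck group, $[a]$ is the image of $a\in\mathrm{W}$, and $\mathcal{G}(\mathrm{W})_+$ is the set of elements of the form $[a]-[b]$ with $a,b\in\mathrm{W}$ such that $b+c\preceq a+c$ for some $c\in\mathrm{W}$; this is the positive cone of a partial order on the group $\mathcal{G}(\mathrm{W})$ ($x\preceq y$ iff $y-x\in\mathcal{G}(\mathrm{W})_+$). $[A]_{\mathrm{M}}$ and $[\mathcal{M}]_{\mathrm{M}}$ denote the images of $\langle A\rangle_{\mathrm{M}}$ and $\langle\mathcal{M}\rangle_{\mathrm{M}}$ in $\mathcal{G}(\mathrm{W}_{\mathrm{M}}(R))$ and $\mathcal{G}(\mathrm{V}_{\mathrm{M}}(R))$. An isomorphism of partially ordered abelian groups with order-unit is a group isomorphism that maps the positive cone onto the positive cone and the order-unit to the order-unit. *)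

theory Defs
  imports "Jordan_Normal_Form.Matrix" "HOL-Algebra.AbelCoset"
begin

text \<open>
  The ring \<open>R\<close> is a type \<^typ>\<open>'a\<close> of class \<^class>\<open>ring_1\<close>: unital, nonzero, not necessarily
  commutative. Abelian semigroups and groups are \<^typ>\<open>'w monoid\<close> records, hence written
  multiplicatively: \<open>m[a] - [b]\<close> appears as \<open>[a] [^] m \<otimes> inv [b]\<close>.
\<close>

section \<open>Grothendieck groups of partially ordered abelian semigroups\<close>

definition groth_rel :: "('w, 'x) monoid_scheme \<Rightarrow> (('w \<times> 'w) \<times> ('w \<times> 'w)) set" where
  "groth_rel W = {((a, b), (c, d)) | a b c d.
     a \<in> carrier W \<and> b \<in> carrier W \<and> c \<in> carrier W \<and> d \<in> carrier W \<and>
     (\<exists>e \<in> carrier W. (a \<otimes>\<^bsub>W\<^esub> d) \<otimes>\<^bsub>W\<^esub> e = (c \<otimes>\<^bsub>W\<^esub> b) \<otimes>\<^bsub>W\<^esub> e)}"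

text \<open>The class of \<open>(a, b)\<close> is the formal difference \<open>[a] - [b]\<close>.\<close>

definition groth :: "('w, 'x) monoid_scheme \<Rightarrow> ('w \<times> 'w) set monoid" where
  "groth W = \<lparr>
     carrier = (carrier W \<times> carrier W) // groth_rel W,
     mult = (\<lambda>X Y. \<Union>(a, b)\<in>X. \<Union>(c, d)\<in>Y. groth_rel W `` {(a \<otimes>\<^bsub>W\<^esub> c, b \<otimes>\<^bsub>W\<^esub> d)}),
     one = (\<Union>a\<in>carrier W. groth_rel W `` {(a, a)})\<rparr>"

text \<open>The image of \<open>a\<close> is \<open>[a + a] - [a]\<close>, which does not need a neutral element in \<open>W\<close>.\<close>

definition groth_of :: "('w, 'x) monoid_scheme \<Rightarrow> 'w \<Rightarrow> ('w \<times> 'w) set" where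
  "groth_of W a = groth_rel W `` {(a \<otimes>\<^bsub>W\<^esub> a, a)}"

definition groth_pos ::
  "('w, 'x) monoid_scheme \<Rightarrow> ('w \<Rightarrow> 'w \<Rightarrow> bool) \<Rightarrow> ('w \<times> 'w) set set" where
  "groth_pos W leq = {groth_of W a \<otimes>\<^bsub>groth W\<^esub> inv\<^bsub>groth W\<^esub> (groth_of W b) | a b.
     a \<in> carrier W \<and> b \<in> carrier W \<and> (\<exists>c \<in> carrier W. leq (b \<otimes>\<^bsub>W\<^esub> c) (a \<otimes>\<^bsub>W\<^esub> c))}"

text \<open>
  \<open>P\<close> is the positive cone of a partial order on the abelian group \<open>G\<close>, and \<open>u\<close> is an order-unit:
  \<open>u \<ge> 0\<close> and every \<open>x\<close> satisfies \<open>x \<le> n u\<close> for some natural number \<open>n\<close>.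
\<close>

definition po_abelian_group_unit :: "('g, 'x) monoid_scheme \<Rightarrow> 'g set \<Rightarrow> 'g \<Rightarrow> bool" where
  "po_abelian_group_unit G P u \<longleftrightarrow>
     comm_group G \<and> P \<subseteq> carrier G \<and>
     \<one>\<^bsub>G\<^esub> \<in> P \<and> (\<forall>x\<in>P. \<forall>y\<in>P. x \<otimes>\<^bsub>G\<^esub> y \<in> P) \<and>
     (\<forall>x\<in>P. inv\<^bsub>G\<^esub> x \<in> P \<longrightarrow> x = \<one>\<^bsub>G\<^esub>) \<and>
     u \<in> P \<and> (\<forall>x\<in>carrier G. \<exists>n::nat. u [^]\<^bsub>G\<^esub> n \<otimes>\<^bsub>G\<^esub> inv\<^bsub>G\<^esub> x \<in> P)"

definition po_abelian_group_unit_iso ::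
  "('g, 'x) monoid_scheme \<Rightarrow> 'g set \<Rightarrow> 'g \<Rightarrow> ('h, 'y) monoid_scheme \<Rightarrow> 'h set \<Rightarrow> 'h \<Rightarrow>
   ('g \<Rightarrow> 'h) \<Rightarrow> bool" where
  "po_abelian_group_unit_iso G P u H Q v \<Phi> \<longleftrightarrow>
     po_abelian_group_unit G P u \<and> po_abelian_group_unit H Q v \<and>
     \<Phi> \<in> iso G H \<and> \<Phi> ` P = Q \<and> \<Phi> u = v"

section \<open>The matrix Malcolmson semigroup\<close>

text \<open>
  \<open>M(R)\<close> is the type of all matrices of all sizes, including those with no rows or no columns;
  each of these is equivalent to a \<open>1 \<times> 1\<close> zero matrix.
\<close>

definition diag_mat2 :: "'a::zero mat \<Rightarrow> 'a mat \<Rightarrow> 'a mat" where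
  "diag_mat2 A B =
     four_block_mat A (0\<^sub>m (dim_row A) (dim_col B)) (0\<^sub>m (dim_row B) (dim_col A)) B"

definition mat_below1 :: "'a::ring_1 mat \<Rightarrow> 'a mat \<Rightarrow> bool" where
  "mat_below1 A B \<longleftrightarrow>
     (\<exists>C D. dim_col C = dim_row B \<and> dim_row D = dim_col B \<and> A = C * B * D) \<or>
     (\<exists>C D E. dim_row E = dim_row C \<and> dim_col E = dim_col D \<and>
        B = four_block_mat C E (0\<^sub>m (dim_row D) (dim_col C)) D \<and> A = diag_mat2 C D)"

definition mat_below :: "'a::ring_1 mat \<Rightarrow> 'a mat \<Rightarrow> bool" where
  "mat_below = mat_below1\<^sup>*\<^sup>*"

definition WM_class :: "'a::ring_1 mat \<Rightarrow> 'a mat set" where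
  "WM_class A = {B. mat_below A B \<and> mat_below B A}"

definition WM :: "'a::ring_1 itself \<Rightarrow> 'a mat set monoid" where
  "WM _ = \<lparr>
     carrier = range WM_class,
     mult = (\<lambda>X Y. \<Union>A\<in>X. \<Union>B\<in>Y. WM_class (diag_mat2 A B)),
     one = WM_class (0\<^sub>m 0 0)\<rparr>"

definition WM_le :: "'a::ring_1 mat set \<Rightarrow> 'a mat set \<Rightarrow> bool" where
  "WM_le X Y \<longleftrightarrow> (\<exists>A\<in>X. \<exists>B\<in>Y. mat_below A B)"

section \<open>Left modules\<close>

text \<open>
  The library's modules are over commutative rings, so only its record type
  \<^typ>\<open>('a, 'm) module\<close> is reused; its fields \<open>mult\<close> and \<open>one\<close> play no role.
\<close>

locale left_module = abelian_group M for M :: "('a::ring_1, 'm, 'x) module_scheme" (structure) +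
  assumes smult_closed: "x \<in> carrier M \<Longrightarrow> a \<odot> x \<in> carrier M"
    and smult_l_distr: "x \<in> carrier M \<Longrightarrow> (a + b) \<odot> x = a \<odot> x \<oplus> b \<odot> x"
    and smult_r_distr: "x \<in> carrier M \<Longrightarrow> y \<in> carrier M \<Longrightarrow> a \<odot> (x \<oplus> y) = a \<odot> x \<oplus> a \<odot> y"
    and smult_assoc: "x \<in> carrier M \<Longrightarrow> (a * b) \<odot> x = a \<odot> (b \<odot> x)"
    and smult_one: "x \<in> carrier M \<Longrightarrow> 1 \<odot> x = x"

definition left_submodule :: "'m set \<Rightarrow> ('a::ring_1, 'm, 'x) module_scheme \<Rightarrow> bool" where
  "left_submodule H M \<longleftrightarrow> subgroup H (add_monoid M) \<and> (\<forall>a. \<forall>x\<in>H. a \<odot>\<^bsub>M\<^esub> x \<in> H)"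

definition lmod_hom ::
  "('a::ring_1, 'm, 'x) module_scheme \<Rightarrow> ('a, 'n, 'y) module_scheme \<Rightarrow> ('m \<Rightarrow> 'n) set" where
  "lmod_hom M N = {f \<in> hom (add_monoid M) (add_monoid N).
     \<forall>a. \<forall>x\<in>carrier M. f (a \<odot>\<^bsub>M\<^esub> x) = a \<odot>\<^bsub>N\<^esub> f x}"

definition lmod_isomorphic ::
  "('a::ring_1, 'm, 'x) module_scheme \<Rightarrow> ('a, 'n, 'y) module_scheme \<Rightarrow> bool" where
  "lmod_isomorphic M N \<longleftrightarrow> (\<exists>f \<in> lmod_hom M N. bij_betw f (carrier M) (carrier N))"

text \<open>Exactness of \<open>A \<rightarrow> M \<rightarrow> B \<rightarrow> 0\<close>.\<close>

definition right_exact ::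
  "('a::ring_1, 'k) module \<Rightarrow> ('k \<Rightarrow> 'm) \<Rightarrow> ('a, 'm) module \<Rightarrow> ('m \<Rightarrow> 'n) \<Rightarrow>
   ('a, 'n) module \<Rightarrow> bool" where
  "right_exact A f M g B \<longleftrightarrow> f \<in> lmod_hom A M \<and> g \<in> lmod_hom M B \<and>
     f ` carrier A = a_kernel M B g \<and> g ` carrier M = carrier B"

definition fin_presented :: "('a::ring_1, 'm) module \<Rightarrow> bool" where
  "fin_presented M \<longleftrightarrow> left_module M \<and>
     (\<exists>n m f g. right_exact (module_vec TYPE('a) n) f (module_vec TYPE('a) m) g M)"

definition lmod_sum :: "('a::ring_1, 'm) module \<Rightarrow> ('a, 'n) module \<Rightarrow> ('a, 'm \<times> 'n) module" where
  "lmod_sum M N = \<lparr>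
     carrier = carrier M \<times> carrier N,
     mult = undefined,
     one = undefined,
     zero = (\<zero>\<^bsub>M\<^esub>, \<zero>\<^bsub>N\<^esub>),
     add = (\<lambda>(x, y) (x', y'). (x \<oplus>\<^bsub>M\<^esub> x', y \<oplus>\<^bsub>N\<^esub> y')),
     smult = (\<lambda>a (x, y). (a \<odot>\<^bsub>M\<^esub> x, a \<odot>\<^bsub>N\<^esub> y))\<rparr>"

definition lmod_quot :: "('a::ring_1, 'm) module \<Rightarrow> 'm set \<Rightarrow> ('a, 'm set) module" where
  "lmod_quot M H = \<lparr>
     carrier = a_rcosets\<^bsub>M\<^esub> H,
     mult = undefined,
     one = undefined,
     zero = H,
     add = (<+>\<^bsub>M\<^esub>),
     smult = (\<lambda>a X. \<Union>x\<in>X. H +>\<^bsub>M\<^esub> (a \<odot>\<^bsub>M\<^esub> x))\<rparr>"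

definition regular_lmod :: "'a itself \<Rightarrow> ('a::ring_1, 'a) module" where
  "regular_lmod _ = \<lparr>
     carrier = UNIV, mult = undefined, one = undefined, zero = 0, add = (+), smult = (*)\<rparr>"

definition vec_mult_mat :: "'a::ring_1 vec \<Rightarrow> 'a mat \<Rightarrow> 'a vec" where
  "vec_mult_mat x A = vec (dim_col A) (\<lambda>j. x \<bullet> col A j)"

text \<open>\<open>R\<^sup>m / R\<^sup>n A\<close> for an \<open>n \<times> m\<close> matrix \<open>A\<close>, with elements of \<open>R\<^sup>n\<close> as row vectors.\<close>

definition coker :: "nat \<Rightarrow> nat \<Rightarrow> 'a::ring_1 mat \<Rightarrow> ('a, 'a vec set) module" where
  "coker n m A =
     lmod_quot (module_vec TYPE('a) m) ((\<lambda>x. vec_mult_mat x A) ` carrier_vec n)"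

section \<open>The finitely presented module Malcolmson semigroup\<close>

definition lmod_below1 :: "('a::ring_1, 'm) module \<Rightarrow> ('a, 'n) module \<Rightarrow> bool" where
  "lmod_below1 M N \<longleftrightarrow>
     (\<exists>N\<^sub>1 N\<^sub>2. left_submodule N\<^sub>1 N \<and> left_submodule N\<^sub>2 N \<and>
        N\<^sub>1 \<inter> N\<^sub>2 = {\<zero>\<^bsub>N\<^esub>} \<and> N\<^sub>1 <+>\<^bsub>N\<^esub> N\<^sub>2 = carrier N \<and>
        (\<exists>f g. right_exact (N\<lparr>carrier := N\<^sub>1\<rparr>) f M g (N\<lparr>carrier := N\<^sub>2\<rparr>)))"

text \<open>
  A set of equivalence classes needs all modules to have elements of one type. We take
  \<^typ>\<open>'a vec set\<close>: the quotients \<open>R\<^sup>m / R\<^sup>n A\<close> live there, and by \<open>fin_presented_copy\<close> below every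
  finitely presented module, with elements of any type, has an isomorphic copy there.
  \<open>VM_class M\<close> is the set of those modules that are equivalent to the copies of \<open>M\<close>.
\<close>

definition lmod_below :: "('a::ring_1, 'a vec set) module \<Rightarrow> ('a, 'a vec set) module \<Rightarrow> bool" where
  "lmod_below = (\<lambda>M N. fin_presented M \<and> fin_presented N \<and> lmod_below1 M N)\<^sup>*\<^sup>*"

definition VM_class :: "('a::ring_1, 'm) module \<Rightarrow> ('a, 'a vec set) module set" where
  "VM_class M = {N. fin_presented N \<and>
     (\<exists>M'. fin_presented M' \<and> lmod_isomorphic M M' \<and> lmod_below M' N \<and> lmod_below N M')}"

definition VM :: "'a::ring_1 itself \<Rightarrow> ('a, 'a vec set) module set monoid" where
  "VM _ = \<lparr>
     carrier = {VM_class M | M :: ('a, 'a vec set) module. fin_presented M},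
     mult = (\<lambda>X Y. \<Union>M\<in>X. \<Union>N\<in>Y. VM_class (lmod_sum M N)),
     one = VM_class (module_vec TYPE('a) 0)\<rparr>"

definition VM_le ::
  "('a::ring_1, 'a vec set) module set \<Rightarrow> ('a, 'a vec set) module set \<Rightarrow> bool" where
  "VM_le X Y \<longleftrightarrow> (\<exists>M\<in>X. \<exists>N\<in>Y. lmod_below M N)"

section \<open>The partially ordered groups \<open>G(V\<^sub>M(R))\<close> and \<open>G(W\<^sub>M(R))\<close>\<close>

abbreviation GV ::
  "'a::ring_1 itself \<Rightarrow>
   (('a, 'a vec set) module set \<times> ('a, 'a vec set) module set) set monoid" where
  "GV ty \<equiv> groth (VM ty)"

abbreviation GV_pos ::
  "'a::ring_1 itself \<Rightarrow>
   (('a, 'a vec set) module set \<times> ('a, 'a vec set) module set) set set" where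
  "GV_pos ty \<equiv> groth_pos (VM ty) VM_le"

abbreviation GV_of ::
  "('a::ring_1, 'm) module \<Rightarrow>
   (('a, 'a vec set) module set \<times> ('a, 'a vec set) module set) set" where
  "GV_of M \<equiv> groth_of (VM TYPE('a)) (VM_class M)"

abbreviation GW :: "'a::ring_1 itself \<Rightarrow> ('a mat set \<times> 'a mat set) set monoid" where
  "GW ty \<equiv> groth (WM ty)"

abbreviation GW_pos :: "'a::ring_1 itself \<Rightarrow> ('a mat set \<times> 'a mat set) set set" where
  "GW_pos ty \<equiv> groth_pos (WM ty) WM_le"

abbreviation GW_of :: "'a::ring_1 mat \<Rightarrow> ('a mat set \<times> 'a mat set) set" where
  "GW_of A \<equiv> groth_of (WM TYPE('a)) (WM_class A)"

section \<open>Finitely presented modules have copies in the chosen type\<close>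

lemma left_module_transport:
  fixes M :: "('a::ring_1, 'm) module" and h :: "'m \<Rightarrow> 'n"
  assumes M: "left_module M" and h: "inj_on h (carrier M)"
  obtains M' :: "('a, 'n) module"
  where "left_module M'" "carrier M' = h ` carrier M" "h \<in> lmod_hom M M'" "\<zero>\<^bsub>M'\<^esub> = h \<zero>\<^bsub>M\<^esub>"
proof -
  interpret M: left_module M by fact
  define k where "k = the_inv_into (carrier M) h"
  have k [simp]: "k (h x) = x" if "x \<in> carrier M" for x
    using h that by (simp add: k_def the_inv_into_f_f)
  define M' :: "('a, 'n) module" where "M' = \<lparr>
     carrier = h ` carrier M, mult = undefined, one = undefined, zero = h \<zero>\<^bsub>M\<^esub>,
     add = (\<lambda>x y. h (k x \<oplus>\<^bsub>M\<^esub> k y)), smult = (\<lambda>a x. h (a \<odot>\<^bsub>M\<^esub> k x))\<rparr>"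
  have "abelian_group M'"
  proof (rule abelian_groupI)
    fix x assume "x \<in> carrier M'"
    then obtain u where u: "u \<in> carrier M" "x = h u" by (auto simp: M'_def)
    then show "\<exists>y\<in>carrier M'. y \<oplus>\<^bsub>M'\<^esub> x = \<zero>\<^bsub>M'\<^esub>"
      by (intro bexI[of _ "h (\<ominus>\<^bsub>M\<^esub> u)"]) (auto simp: M'_def M.l_neg)
  qed (auto simp: M'_def M.a_assoc intro!: arg_cong[of _ _ h] M.a_comm)
  then have "left_module M'"
    by (intro left_module.intro left_module_axioms.intro)
      (auto simp: M'_def M.smult_closed M.smult_l_distr M.smult_r_distr M.smult_assoc M.smult_one)
  moreover have "h \<in> lmod_hom M M'"
    by (auto simp: lmod_hom_def hom_def M'_def)
  ultimately show ?thesis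
    by (intro that[of M']) (auto simp: M'_def)
qed

lemma fin_presented_copy:
  fixes M :: "('a::ring_1, 'm) module"
  assumes "fin_presented M"
  shows "\<exists>M' :: ('a, 'a vec set) module. fin_presented M' \<and> lmod_isomorphic M M'"
proof -
  obtain n m f g where lm: "left_module M"
    and ex: "right_exact (module_vec TYPE('a) n) f (module_vec TYPE('a) m) g M"
    using assms by (auto simp: fin_presented_def)
  interpret M: left_module M by fact
  define h where "h x = {v \<in> carrier (module_vec TYPE('a) m). g v = x}" for x
  have g: "g ` carrier (module_vec TYPE('a) m) = carrier M"
    using ex by (simp add: right_exact_def)
  have inj: "inj_on h (carrier M)"
  proof (rule inj_onI)
    fix x y assume xy: "x \<in> carrier M" "y \<in> carrier M" "h x = h y"
    from xy(1) g obtain v where v: "v \<in> carrier (module_vec TYPE('a) m)" "g v = x"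
      by (metis imageE)
    then have "v \<in> h x" by (simp add: h_def)
    then have "v \<in> h y" using xy(3) by simp
    then show "x = y" using v(2) by (simp add: h_def)
  qed
  obtain M' :: "('a, 'a vec set) module" where M': "left_module M'"
    "carrier M' = h ` carrier M" "h \<in> lmod_hom M M'" "\<zero>\<^bsub>M'\<^esub> = h \<zero>\<^bsub>M\<^esub>"
    using left_module_transport[OF lm inj] by metis
  have gM: "g v \<in> carrier M" if "v \<in> carrier (module_vec TYPE('a) m)" for v
    using g that by auto
  have hom: "h \<circ> g \<in> lmod_hom (module_vec TYPE('a) m) M'"
    using ex M'(3) by (auto simp: right_exact_def lmod_hom_def hom_def Pi_iff)
  have "a_kernel (module_vec TYPE('a) m) M' (h \<circ> g) = a_kernel (module_vec TYPE('a) m) M g"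
    using gM inj M.zero_closed by (auto simp: a_kernel_def kernel_def M'(4) inj_on_eq_iff)
  moreover have "(h \<circ> g) ` carrier (module_vec TYPE('a) m) = carrier M'"
    unfolding M'(2) g[symmetric] by (rule image_comp[symmetric])
  ultimately have "right_exact (module_vec TYPE('a) n) f (module_vec TYPE('a) m) (h \<circ> g) M'"
    using ex hom unfolding right_exact_def by presburger
  then have "fin_presented M'"
    using M'(1) by (auto simp: fin_presented_def)
  moreover have "lmod_isomorphic M M'"
    using M'(2,3) inj by (auto simp: lmod_isomorphic_def bij_betw_def)
  ultimately show ?thesis by blast
qed

end

theory Submission
  imports Defs
begin

text \<open>
  Both semigroups consist of classes of matrices, a matrix \<open>A\<close> with \<open>m\<close> columns standing for
  \<open>\<langle>A\<rangle>\<close> in \<open>W\<^sub>M(R)\<close> and for \<open>\<langle>coker A\<rangle>\<close> in \<open>V\<^sub>M(R)\<close>, with block diagonal sums as addition. The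
  isomorphism and its inverse are given by the same formula \<open>[A] \<mapsto> m u - [A]\<close>, so it suffices that
  each of the two preorders on matrices implies the reverse of the other one up to the correction by
  multiples of \<open>u\<close>. If \<open>N\<^sub>1 \<rightarrow> M \<rightarrow> N\<^sub>2 \<rightarrow> 0\<close> is exact, then a surjection from a module
  with a block triangular presentation, built from presentations of \<open>N\<^sub>1\<close> and \<open>N\<^sub>2\<close>, onto \<open>M\<close>
  translates into the matrix preorder. Conversely, both generators of the matrix preorder are
  realised by explicit exact sequences of cokernels.
\<close>


section \<open>Grothendieck groups\<close>

text \<open>The two preorders run in opposite directions because a bigger cokernel belongs to a
  smaller matrix: a surjection from the cokernel of \<open>K\<close> onto that of \<open>A\<close>
  yields a factorisation of \<open>K\<close> through \<open>A\<close>. This factorisation appears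
  only after adding identity blocks, as in Schanuel's lemma, and the blocks on the two sides have
  different sizes; that difference is the term \<open>m u\<close>.

  The number of columns is not an invariant of a class, so the map can be written down only on
  representatives. Well-definedness is therefore derived from monotonicity: an inequality between
  matrices gives one between the images, an equality gives two opposite ones, and antisymmetry
  finishes.

  The formula is an involution because each unit is invisible to the other monoid. Identity matrices
  are the multiples of the unit in \<open>WM\<close> and have zero cokernel; matrices without rows
  present the free modules in \<open>VM\<close> and are neutral in \<open>WM\<close>. So each unit
  goes to the other one, and applying the formula twice gives
  \<open>m u - (m u - [A])\<close>.\<close>

definition groth_diff :: "('w, 'x) monoid_scheme \<Rightarrow> 'w \<Rightarrow> 'w \<Rightarrow> ('w \<times> 'w) set" where
  "groth_diff W a b = groth_rel W `` {(a, b)}"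

context comm_monoid
begin

lemma groth_rel_equiv: "equiv (carrier G \<times> carrier G) (groth_rel G)"
proof (rule equivI)
  show "groth_rel G \<subseteq> (carrier G \<times> carrier G) \<times> (carrier G \<times> carrier G)"
    by (auto simp: groth_rel_def)
  show "refl_on (carrier G \<times> carrier G) (groth_rel G)"
    by (auto simp: refl_on_def groth_rel_def)
  show "sym (groth_rel G)"
    by (rule symI) (auto simp: groth_rel_def, metis)
  show "trans (groth_rel G)"
  proof (rule transI)
    fix p q r assume "(p, q) \<in> groth_rel G" "(q, r) \<in> groth_rel G"
    then obtain a b c d x y e f where
      pqr: "p = (a, b)" "q = (c, d)" "r = (x, y)"
      and car: "a \<in> carrier G" "b \<in> carrier G" "c \<in> carrier G" "d \<in> carrier G"
        "x \<in> carrier G" "y \<in> carrier G" "e \<in> carrier G" "f \<in> carrier G"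
      and eq: "a \<otimes> d \<otimes> e = c \<otimes> b \<otimes> e" "c \<otimes> y \<otimes> f = x \<otimes> d \<otimes> f"
      by (auto simp: groth_rel_def)
    have "a \<otimes> y \<otimes> (d \<otimes> e \<otimes> f) = (a \<otimes> d \<otimes> e) \<otimes> (y \<otimes> f)"
      using car by (simp add: m_ac)
    also have "\<dots> = (c \<otimes> y \<otimes> f) \<otimes> (b \<otimes> e)"
      using car by (simp add: eq(1)) (simp add: m_ac)
    also have "\<dots> = x \<otimes> b \<otimes> (d \<otimes> e \<otimes> f)"
      using car by (simp add: eq(2)) (simp add: m_ac)
    finally show "(p, r) \<in> groth_rel G"
      using car unfolding pqr groth_rel_def by blast
  qed
qed

lemma groth_diff_eq_iff:
  assumes "a \<in> carrier G" "b \<in> carrier G" "c \<in> carrier G" "d \<in> carrier G"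
  shows "groth_diff G a b = groth_diff G c d \<longleftrightarrow>
    (\<exists>e \<in> carrier G. a \<otimes> d \<otimes> e = c \<otimes> b \<otimes> e)"
proof -
  have "groth_diff G a b = groth_diff G c d \<longleftrightarrow> ((a, b), (c, d)) \<in> groth_rel G"
    unfolding groth_diff_def using assms
    by (intro eq_equiv_class_iff[OF groth_rel_equiv]) auto
  then show ?thesis using assms by (auto simp: groth_rel_def)
qed

lemma groth_diff_cong:
  assumes "a \<otimes> d = c \<otimes> b" "a \<in> carrier G" "b \<in> carrier G" "c \<in> carrier G" "d \<in> carrier G"
  shows "groth_diff G a b = groth_diff G c d"
  using assms by (subst groth_diff_eq_iff) (auto intro!: bexI[of _ \<one>])

lemma groth_carrier: "carrier (groth G) = {groth_diff G a b | a b. a \<in> carrier G \<and> b \<in> carrier G}"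
  by (auto simp: groth_def quotient_def groth_diff_def)

lemma groth_diff_closed [intro, simp]:
  "a \<in> carrier G \<Longrightarrow> b \<in> carrier G \<Longrightarrow> groth_diff G a b \<in> carrier (groth G)"
  by (auto simp: groth_carrier)

lemma groth_diff_mem_iff:
  assumes "a \<in> carrier G" "b \<in> carrier G"
  shows "(c, d) \<in> groth_diff G a b \<longleftrightarrow>
    c \<in> carrier G \<and> d \<in> carrier G \<and> (\<exists>e \<in> carrier G. a \<otimes> d \<otimes> e = c \<otimes> b \<otimes> e)"
  using assms by (auto simp: groth_diff_def groth_rel_def)

lemma groth_diff_mult:
  assumes "a \<in> carrier G" "b \<in> carrier G" "c \<in> carrier G" "d \<in> carrier G"
  shows "groth_diff G a b \<otimes>\<^bsub>groth G\<^esub> groth_diff G c d = groth_diff G (a \<otimes> c) (b \<otimes> d)"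
proof -
  \<comment> \<open>All choices of representatives lead to one class, so the double union in the
    definition of the product collapses to it.\<close>
  have *: "groth_diff G (a' \<otimes> c') (b' \<otimes> d') = groth_diff G (a \<otimes> c) (b \<otimes> d)"
    if mem: "(a', b') \<in> groth_diff G a b" "(c', d') \<in> groth_diff G c d" for a' b' c' d'
  proof -
    obtain e f where car: "a' \<in> carrier G" "b' \<in> carrier G" "c' \<in> carrier G" "d' \<in> carrier G"
        "e \<in> carrier G" "f \<in> carrier G"
      and eq: "a \<otimes> b' \<otimes> e = a' \<otimes> b \<otimes> e" "c \<otimes> d' \<otimes> f = c' \<otimes> d \<otimes> f"
      using mem unfolding groth_diff_mem_iff[OF assms(1,2)] groth_diff_mem_iff[OF assms(3,4)]
      by blast
    have "(a' \<otimes> c') \<otimes> (b \<otimes> d) \<otimes> (e \<otimes> f) = (a' \<otimes> b \<otimes> e) \<otimes> (c' \<otimes> d \<otimes> f)"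
      using car assms by (simp add: m_ac)
    also have "\<dots> = (a \<otimes> b' \<otimes> e) \<otimes> (c \<otimes> d' \<otimes> f)"
      by (simp only: eq)
    also have "\<dots> = (a \<otimes> c) \<otimes> (b' \<otimes> d') \<otimes> (e \<otimes> f)"
      using car assms by (simp add: m_ac)
    finally show ?thesis
      using car assms by (subst groth_diff_eq_iff) auto
  qed
  have mem: "(a, b) \<in> groth_diff G a b" "(c, d) \<in> groth_diff G c d"
    using assms by (auto simp: groth_diff_mem_iff)
  have "groth_diff G a b \<otimes>\<^bsub>groth G\<^esub> groth_diff G c d =
    (\<Union>p \<in> groth_diff G a b. \<Union>q \<in> groth_diff G c d.
      groth_diff G (fst p \<otimes> fst q) (snd p \<otimes> snd q))"
    by (simp add: groth_def groth_diff_def case_prod_unfold)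
  also have "\<dots> = (\<Union>p \<in> groth_diff G a b. \<Union>q \<in> groth_diff G c d. groth_diff G (a \<otimes> c) (b \<otimes> d))"
    using * by (intro SUP_cong refl) auto
  also have "\<dots> = groth_diff G (a \<otimes> c) (b \<otimes> d)"
    using mem by blast
  finally show ?thesis .
qed

lemma groth_one: "\<one>\<^bsub>groth G\<^esub> = groth_diff G \<one> \<one>"
proof -
  have "groth_diff G a a = groth_diff G \<one> \<one>" if "a \<in> carrier G" for a
    using that by (intro groth_diff_cong) auto
  then have "(\<Union>a\<in>carrier G. groth_diff G a a) = (\<Union>a\<in>carrier G. groth_diff G \<one> \<one>)"
    by (intro SUP_cong refl)
  also have "\<dots> = groth_diff G \<one> \<one>"
    using one_closed by blast
  finally have "(\<Union>a\<in>carrier G. groth_diff G a a) = groth_diff G \<one> \<one>" .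
  then show ?thesis by (simp add: groth_def groth_diff_def)
qed

lemma groth_comm_group: "comm_group (groth G)"
proof (rule comm_groupI)
  fix x assume "x \<in> carrier (groth G)"
  then obtain a b where x: "x = groth_diff G a b" and ab: "a \<in> carrier G" "b \<in> carrier G"
    by (auto simp: groth_carrier)
  have "groth_diff G b a \<otimes>\<^bsub>groth G\<^esub> x = \<one>\<^bsub>groth G\<^esub>"
    using ab by (simp add: x groth_diff_mult groth_one) (rule groth_diff_cong, auto simp: m_ac)
  then show "\<exists>y\<in>carrier (groth G). y \<otimes>\<^bsub>groth G\<^esub> x = \<one>\<^bsub>groth G\<^esub>"
    using ab by blast
next
  fix x y z
  assume "x \<in> carrier (groth G)" "y \<in> carrier (groth G)" "z \<in> carrier (groth G)"
  then show "x \<otimes>\<^bsub>groth G\<^esub> y \<otimes>\<^bsub>groth G\<^esub> z = x \<otimes>\<^bsub>groth G\<^esub> (y \<otimes>\<^bsub>groth G\<^esub> z)"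
    by (auto simp: groth_carrier groth_diff_mult m_assoc)
next
  fix x y assume "x \<in> carrier (groth G)" "y \<in> carrier (groth G)"
  then show "x \<otimes>\<^bsub>groth G\<^esub> y = y \<otimes>\<^bsub>groth G\<^esub> x"
    by (auto simp: groth_carrier groth_diff_mult m_comm)
next
  fix x y assume "x \<in> carrier (groth G)" "y \<in> carrier (groth G)"
  then obtain a b c d where "x = groth_diff G a b" "y = groth_diff G c d"
    "a \<in> carrier G" "b \<in> carrier G" "c \<in> carrier G" "d \<in> carrier G"
    by (auto simp: groth_carrier)
  then show "x \<otimes>\<^bsub>groth G\<^esub> y \<in> carrier (groth G)"
    by (simp add: groth_diff_mult)
qed (auto simp: groth_carrier groth_one groth_diff_mult)

lemma groth_inv:
  assumes "a \<in> carrier G" "b \<in> carrier G"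
  shows "inv\<^bsub>groth G\<^esub> groth_diff G a b = groth_diff G b a"
proof -
  interpret K: comm_group "groth G" by (rule groth_comm_group)
  have "groth_diff G b a \<otimes>\<^bsub>groth G\<^esub> groth_diff G a b = \<one>\<^bsub>groth G\<^esub>"
    using assms by (simp add: groth_diff_mult groth_one) (rule groth_diff_cong, auto simp: m_ac)
  then show ?thesis using assms by (intro K.inv_equality) auto
qed

text \<open>Trades the encoding of the image that works in any semigroup for the simpler one that a
  neutral element permits.\<close>

lemma groth_of_eq: "a \<in> carrier G \<Longrightarrow> groth_of G a = groth_diff G a \<one>"
  unfolding groth_of_def groth_diff_def[symmetric] by (intro groth_diff_cong) auto

lemma groth_of_pow: "a \<in> carrier G \<Longrightarrow> groth_of G a [^]\<^bsub>groth G\<^esub> (n::nat) = groth_diff G (a [^] n) \<one>"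
proof (induction n)
  case 0
  show ?case by (simp add: groth_one)
next
  case (Suc n)
  then show ?case by (simp add: groth_of_eq groth_diff_mult)
qed

lemma groth_of_diff:
  assumes "a \<in> carrier G" "b \<in> carrier G"
  shows "groth_of G a \<otimes>\<^bsub>groth G\<^esub> inv\<^bsub>groth G\<^esub> (groth_of G b) = groth_diff G a b"
  using assms by (simp add: groth_of_eq groth_inv groth_diff_mult)

lemma groth_pow_diff:
  assumes "a \<in> carrier G" "b \<in> carrier G"
  shows "groth_of G a [^]\<^bsub>groth G\<^esub> (n::nat) \<otimes>\<^bsub>groth G\<^esub> inv\<^bsub>groth G\<^esub> (groth_of G b) =
    groth_diff G (a [^] n) b"
  using assms unfolding groth_of_pow[OF assms(1)]
  by (simp add: groth_of_eq groth_inv groth_diff_mult)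

lemma groth_pos_eq:
  "groth_pos G leq = {groth_diff G a b | a b.
     a \<in> carrier G \<and> b \<in> carrier G \<and> (\<exists>c \<in> carrier G. leq (b \<otimes> c) (a \<otimes> c))}"
  unfolding groth_pos_def using groth_of_diff by (intro Collect_cong) metis

end

section \<open>Partially ordered commutative monoids and the order on their Grothendieck
  groups\<close>

locale po_comm_monoid = comm_monoid W for W (structure) +
  fixes leq :: "'w \<Rightarrow> 'w \<Rightarrow> bool"
  assumes leq_refl: "a \<in> carrier W \<Longrightarrow> leq a a"
    and leq_trans: "\<lbrakk>leq a b; leq b c; a \<in> carrier W; b \<in> carrier W; c \<in> carrier W\<rbrakk> \<Longrightarrow> leq a c"
    and leq_antisym: "\<lbrakk>leq a b; leq b a; a \<in> carrier W; b \<in> carrier W\<rbrakk> \<Longrightarrow> a = b"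
    and leq_mult_right: "\<lbrakk>leq a b; a \<in> carrier W; b \<in> carrier W; c \<in> carrier W\<rbrakk> \<Longrightarrow>
      leq (a \<otimes> c) (b \<otimes> c)"
    and one_leq: "a \<in> carrier W \<Longrightarrow> leq \<one> a"
begin

lemma leq_mult:
  assumes "leq a b" "leq c d" "a \<in> carrier W" "b \<in> carrier W" "c \<in> carrier W" "d \<in> carrier W"
  shows "leq (a \<otimes> c) (b \<otimes> d)"
proof -
  have "leq (a \<otimes> c) (b \<otimes> c)" using assms by (intro leq_mult_right)
  moreover have "leq (c \<otimes> b) (d \<otimes> b)" using assms by (intro leq_mult_right)
  ultimately show ?thesis using assms by (auto simp: m_comm intro: leq_trans)
qed

text \<open>The cone asks for one good pair of representatives. Adding \<open>b \<otimes> e\<close>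
  to the inequality for \<open>(a', b')\<close> and using
  \<open>a \<otimes> b' \<otimes> e = a' \<otimes> b \<otimes> e\<close> transfers it to the given
  pair, with the larger common summand \<open>b' \<otimes> c \<otimes> e\<close>.\<close>

lemma groth_pos_iff:
  assumes "a \<in> carrier W" "b \<in> carrier W"
  shows "groth_diff W a b \<in> groth_pos W leq \<longleftrightarrow> (\<exists>c \<in> carrier W. leq (b \<otimes> c) (a \<otimes> c))"
proof
  assume "groth_diff W a b \<in> groth_pos W leq"
  then obtain a' b' c where car: "a' \<in> carrier W" "b' \<in> carrier W" "c \<in> carrier W"
    and eq: "groth_diff W a b = groth_diff W a' b'" and le: "leq (b' \<otimes> c) (a' \<otimes> c)"
    by (auto simp: groth_pos_eq)
  obtain e where e: "e \<in> carrier W" "a \<otimes> b' \<otimes> e = a' \<otimes> b \<otimes> e"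
    using eq assms car by (auto simp: groth_diff_eq_iff)
  have "leq (b' \<otimes> c \<otimes> (b \<otimes> e)) (a' \<otimes> c \<otimes> (b \<otimes> e))"
    by (rule leq_mult_right[OF le]) (use assms car e in auto)
  moreover have "b' \<otimes> c \<otimes> (b \<otimes> e) = b \<otimes> (b' \<otimes> c \<otimes> e)"
    using assms car e by (simp add: m_ac)
  moreover have "a' \<otimes> c \<otimes> (b \<otimes> e) = (a' \<otimes> b \<otimes> e) \<otimes> c"
    using assms car e by (simp add: m_ac)
  moreover have "\<dots> = a \<otimes> (b' \<otimes> c \<otimes> e)"
    using assms car e by (simp add: e(2)[symmetric]) (simp add: m_ac)
  ultimately show "\<exists>c \<in> carrier W. leq (b \<otimes> c) (a \<otimes> c)"
    using car e by (intro bexI[of _ "b' \<otimes> c \<otimes> e"]) auto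
qed (use assms in \<open>auto simp: groth_pos_eq\<close>)

lemma groth_po_abelian_group_unit:
  assumes u: "u \<in> carrier W" and unit: "\<And>a. a \<in> carrier W \<Longrightarrow> \<exists>n::nat. leq a (u [^] n)"
  shows "po_abelian_group_unit (groth W) (groth_pos W leq) (groth_of W u)"
  unfolding po_abelian_group_unit_def
proof (intro conjI ballI impI)
  show "comm_group (groth W)" by (rule groth_comm_group)
  show "groth_pos W leq \<subseteq> carrier (groth W)" by (auto simp: groth_pos_eq)
  show "\<one>\<^bsub>groth W\<^esub> \<in> groth_pos W leq"
    by (auto simp: groth_one groth_pos_iff intro: leq_refl)
  show "groth_of W u \<in> groth_pos W leq"
    using u by (auto simp: groth_of_eq groth_pos_iff intro!: bexI[of _ \<one>] one_leq)
next
  fix x y assume "x \<in> groth_pos W leq" "y \<in> groth_pos W leq"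
  then obtain a b c a' b' c' where
    x: "x = groth_diff W a b" "a \<in> carrier W" "b \<in> carrier W" "c \<in> carrier W"
      "leq (b \<otimes> c) (a \<otimes> c)"
    and y: "y = groth_diff W a' b'" "a' \<in> carrier W" "b' \<in> carrier W" "c' \<in> carrier W"
      "leq (b' \<otimes> c') (a' \<otimes> c')"
    by (auto simp: groth_pos_eq)
  have "leq ((b \<otimes> c) \<otimes> (b' \<otimes> c')) ((a \<otimes> c) \<otimes> (a' \<otimes> c'))"
    by (rule leq_mult[OF x(5) y(5)]) (use x y in auto)
  then have "leq ((b \<otimes> b') \<otimes> (c \<otimes> c')) ((a \<otimes> a') \<otimes> (c \<otimes> c'))"
    using x y by (simp add: m_ac)
  then show "x \<otimes>\<^bsub>groth W\<^esub> y \<in> groth_pos W leq"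
    using x y by (auto simp: groth_diff_mult groth_pos_iff)
next
  fix x assume "x \<in> groth_pos W leq" and inv: "inv\<^bsub>groth W\<^esub> x \<in> groth_pos W leq"
  then obtain a b c where
    x: "x = groth_diff W a b" "a \<in> carrier W" "b \<in> carrier W" "c \<in> carrier W"
      "leq (b \<otimes> c) (a \<otimes> c)"
    by (auto simp: groth_pos_eq)
  from inv obtain d where d: "d \<in> carrier W" "leq (a \<otimes> d) (b \<otimes> d)"
    using x by (auto simp: groth_inv groth_pos_iff)
  \<comment> \<open>The two inequalities come with different summands \<open>c\<close> and
    \<open>d\<close>; with both added they become opposite inequalities between the same two
    elements.\<close>
  have "leq (b \<otimes> c \<otimes> d) (a \<otimes> c \<otimes> d)" "leq (a \<otimes> d \<otimes> c) (b \<otimes> d \<otimes> c)"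
    using x d by (auto intro!: leq_mult_right)
  then have "a \<otimes> c \<otimes> d = b \<otimes> c \<otimes> d"
    using x d by (intro leq_antisym) (auto simp: m_ac)
  then have "a \<otimes> \<one> \<otimes> (c \<otimes> d) = \<one> \<otimes> b \<otimes> (c \<otimes> d)"
    using x d by (simp add: m_assoc)
  then show "x = \<one>\<^bsub>groth W\<^esub>"
    unfolding x(1) groth_one using x d by (subst groth_diff_eq_iff) auto
next
  fix x assume "x \<in> carrier (groth W)"
  then obtain a b where x: "x = groth_diff W a b" "a \<in> carrier W" "b \<in> carrier W"
    by (auto simp: groth_carrier)
  \<comment> \<open>A bound for \<open>a\<close> alone suffices for the difference of
    \<open>a\<close> and \<open>b\<close>, since \<open>b\<close> lies above the neutral
    element.\<close>
  obtain n :: nat where n: "leq a (u [^] n)" using unit x by blast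
  have "leq (a \<otimes> \<one>) (u [^] n \<otimes> b)"
    using x u n by (intro leq_mult one_leq) auto
  then have "groth_of W u [^]\<^bsub>groth W\<^esub> n \<otimes>\<^bsub>groth W\<^esub> inv\<^bsub>groth W\<^esub> x \<in> groth_pos W leq"
    using x u by (auto simp: groth_of_pow groth_inv groth_diff_mult groth_pos_iff intro!: bexI[of _ \<one>])
  then show "\<exists>n::nat. groth_of W u [^]\<^bsub>groth W\<^esub> n \<otimes>\<^bsub>groth W\<^esub> inv\<^bsub>groth W\<^esub> x \<in> groth_pos W leq" ..
qed

end


section \<open>Monoids of classes of matrices\<close>

lemma diag_mat2_dim [simp]:
  "dim_row (diag_mat2 A B) = dim_row A + dim_row B"
  "dim_col (diag_mat2 A B) = dim_col A + dim_col B"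
  by (auto simp: diag_mat2_def)

lemma diag_mat2_assoc: "diag_mat2 A (diag_mat2 B C) = diag_mat2 (diag_mat2 A B) C"
  unfolding diag_mat2_def by (rule assoc_four_block_mat)

lemma diag_mat2_empty [simp]: "diag_mat2 (0\<^sub>m 0 0) A = A" "diag_mat2 A (0\<^sub>m 0 0) = A"
  by (rule eq_matI; auto simp: diag_mat2_def)+

text \<open>
  Both semigroups arise in this way: the elements are classes \<open>cls A\<close> of matrices, addition is
  induced by \<^const>\<open>diag_mat2\<close>, and \<open>U m\<close> is a matrix with \<open>m\<close> columns that represents the \<open>m\<close>-fold
  multiple of the order-unit.
\<close>

locale mat_class_monoid =
  fixes le :: "'a::ring_1 mat \<Rightarrow> 'a mat \<Rightarrow> bool" and U :: "nat \<Rightarrow> 'a mat"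
    and cls :: "'a mat \<Rightarrow> 'w" and W :: "'w monoid" (structure) and leq :: "'w \<Rightarrow> 'w \<Rightarrow> bool"
  assumes le_refl: "le A A"
    and le_trans: "le A B \<Longrightarrow> le B C \<Longrightarrow> le A C"
    and le_diag_right: "le A B \<Longrightarrow> le (diag_mat2 A C) (diag_mat2 B C)"
    and le_diag_comm: "le (diag_mat2 A B) (diag_mat2 B A)"
    and le_empty: "le (0\<^sub>m 0 0) A"
    and le_U: "le A (U (dim_col A))"
    and U_0: "U 0 = 0\<^sub>m 0 0"
    and U_Suc: "U (Suc m) = diag_mat2 (U m) (U 1)"
    and U_dim_col [simp]: "dim_col (U m) = m"
    and cls_eq_iff: "cls A = cls B \<longleftrightarrow> le A B \<and> le B A"
    and carrier_eq: "carrier W = range cls"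
    and mult_cls: "cls A \<otimes> cls B = cls (diag_mat2 A B)"
    and one_eq: "\<one> = cls (0\<^sub>m 0 0)"
    and leq_cls: "leq (cls A) (cls B) \<longleftrightarrow> le A B"
begin

lemma cls_closed [simp]: "cls A \<in> carrier W"
  by (simp add: carrier_eq)

sublocale po_comm_monoid W leq
proof
  fix x y z
  show "x \<in> carrier W \<Longrightarrow> y \<in> carrier W \<Longrightarrow> x \<otimes> y \<in> carrier W"
    by (auto simp: carrier_eq mult_cls)
  show "x \<in> carrier W \<Longrightarrow> y \<in> carrier W \<Longrightarrow> z \<in> carrier W \<Longrightarrow> x \<otimes> y \<otimes> z = x \<otimes> (y \<otimes> z)"
    by (auto simp: carrier_eq mult_cls diag_mat2_assoc)
  show "\<one> \<in> carrier W" by (simp add: one_eq)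
  show "x \<in> carrier W \<Longrightarrow> \<one> \<otimes> x = x"
    by (auto simp: carrier_eq mult_cls one_eq)
  show "x \<in> carrier W \<Longrightarrow> x \<otimes> \<one> = x"
    by (auto simp: carrier_eq mult_cls one_eq)
  show "x \<in> carrier W \<Longrightarrow> y \<in> carrier W \<Longrightarrow> x \<otimes> y = y \<otimes> x"
    using le_diag_comm by (auto simp: carrier_eq mult_cls cls_eq_iff)
  show "x \<in> carrier W \<Longrightarrow> leq x x"
    using le_refl by (auto simp: carrier_eq leq_cls)
  show "leq x y \<Longrightarrow> leq y z \<Longrightarrow> x \<in> carrier W \<Longrightarrow> y \<in> carrier W \<Longrightarrow> z \<in> carrier W \<Longrightarrow> leq x z"
    using le_trans by (auto simp: carrier_eq leq_cls)
  show "leq x y \<Longrightarrow> leq y x \<Longrightarrow> x \<in> carrier W \<Longrightarrow> y \<in> carrier W \<Longrightarrow> x = y"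
    by (auto simp: carrier_eq leq_cls cls_eq_iff)
  show "leq x y \<Longrightarrow> x \<in> carrier W \<Longrightarrow> y \<in> carrier W \<Longrightarrow> z \<in> carrier W \<Longrightarrow> leq (x \<otimes> z) (y \<otimes> z)"
    using le_diag_right by (auto simp: carrier_eq leq_cls mult_cls)
  show "x \<in> carrier W \<Longrightarrow> leq \<one> x"
    using le_empty by (auto simp: carrier_eq leq_cls one_eq)
qed

lemma cls_U: "cls (U m) = cls (U 1) [^] m"
proof (induction m)
  case (Suc m)
  then show ?case unfolding U_Suc[of m] mult_cls[symmetric] by simp
qed (simp add: U_0 one_eq)

lemma cls_U_add: "cls (U (m + n)) = cls (U m) \<otimes> cls (U n)"
  unfolding cls_U[of "m + n"] cls_U[of m] cls_U[of n] by (simp add: nat_pow_mult)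

lemma groth_po: "po_abelian_group_unit (groth W) (groth_pos W leq) (groth_of W (cls (U 1)))"
proof (rule groth_po_abelian_group_unit)
  fix a assume "a \<in> carrier W"
  then obtain A where "a = cls A" by (auto simp: carrier_eq)
  then show "\<exists>n::nat. leq a (cls (U 1) [^] n)"
    using le_U by (auto simp: leq_cls cls_U[symmetric] simp del: One_nat_def)
qed simp

lemma groth_cases:
  assumes "x \<in> carrier (groth W)"
  obtains A B where "x = groth_diff W (cls A) (cls B)"
  using assms by (auto simp: groth_carrier carrier_eq)

text \<open>
  \<open>dual A B\<close> says that \<open>A \<mapsto> (dim_col A) [U 1] - [A]\<close> does not decrease from \<open>A\<close> to \<open>B\<close>.
\<close>

definition dual :: "'a mat \<Rightarrow> 'a mat \<Rightarrow> bool" where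
  "dual A B \<longleftrightarrow> (\<exists>x \<in> carrier W.
     leq (cls B \<otimes> cls (U (dim_col A)) \<otimes> x) (cls A \<otimes> cls (U (dim_col B)) \<otimes> x))"

text \<open>A common summand that is a multiple of the unit is all that the two comparisons between
  the monoids produce directly; general summands arise from transitivity.\<close>

lemma dualI:
  assumes "le (diag_mat2 B (U (dim_col A + k))) (diag_mat2 A (U (dim_col B + k)))"
  shows "dual A B"
  unfolding dual_def
proof (rule bexI[of _ "cls (U k)"])
  show "leq (cls B \<otimes> cls (U (dim_col A)) \<otimes> cls (U k)) (cls A \<otimes> cls (U (dim_col B)) \<otimes> cls (U k))"
    using assms by (simp add: leq_cls[symmetric] mult_cls[symmetric] cls_U_add m_assoc)
qed simp

text \<open>Adding the two inequalities leaves \<open>cls B\<close> and \<open>?u B\<close> on both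
  sides. They cannot be cancelled in \<open>W\<close>, but they join the common summand, for which
  \<open>dual\<close> admits any element.\<close>

lemma dual_trans:
  assumes "dual A B" "dual B C"
  shows "dual A C"
proof -
  let ?u = "\<lambda>A. cls (U (dim_col A))"
  obtain x y where xy: "x \<in> carrier W" "y \<in> carrier W"
    and le: "leq (cls B \<otimes> ?u A \<otimes> x) (cls A \<otimes> ?u B \<otimes> x)" "leq (cls C \<otimes> ?u B \<otimes> y) (cls B \<otimes> ?u C \<otimes> y)"
    using assms by (auto simp: dual_def)
  have "leq ((cls B \<otimes> ?u A \<otimes> x) \<otimes> (cls C \<otimes> ?u B \<otimes> y)) ((cls A \<otimes> ?u B \<otimes> x) \<otimes> (cls B \<otimes> ?u C \<otimes> y))"
    by (rule leq_mult[OF le]) (use xy in auto)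
  then have "leq (cls C \<otimes> ?u A \<otimes> (cls B \<otimes> ?u B \<otimes> x \<otimes> y)) (cls A \<otimes> ?u C \<otimes> (cls B \<otimes> ?u B \<otimes> x \<otimes> y))"
    using xy by (simp add: m_ac)
  then show ?thesis
    unfolding dual_def using xy by (intro bexI[of _ "cls B \<otimes> ?u B \<otimes> x \<otimes> y"]) auto
qed

lemma dual_refl: "dual A A"
  by (rule dualI[of _ _ 0]) (simp add: le_refl)

end

text \<open>The map \<open>[A] \<mapsto> (dim_col A) [U 1] - [A]\<close> between the Grothendieck groups of two such monoids.\<close>

locale mat_class_dual =
  S: mat_class_monoid le1 U1 cls1 W1 leq1 + T: mat_class_monoid le2 U2 cls2 W2 leq2
  for le1 :: "'a::ring_1 mat \<Rightarrow> 'a mat \<Rightarrow> bool" and U1 and cls1 :: "'a mat \<Rightarrow> 'w"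
    and W1 :: "'w monoid" and leq1
    and le2 :: "'a mat \<Rightarrow> 'a mat \<Rightarrow> bool" and U2 and cls2 :: "'a mat \<Rightarrow> 'v"
    and W2 :: "'v monoid" and leq2 +
  assumes dual: "le1 A B \<Longrightarrow> T.dual A B"
    and cls_unit: "cls2 (U1 1) = \<one>\<^bsub>W2\<^esub>"
begin

text \<open>The image of a formal difference, namely the difference of
  \<open>(dim_col A) u - [A]\<close> and \<open>(dim_col B) u - [B]\<close>, with the positive and
  the negative terms collected.\<close>

definition dual_diff :: "'a mat \<Rightarrow> 'a mat \<Rightarrow> ('v \<times> 'v) set" where
  "dual_diff A B = groth_diff W2 (cls2 (U2 (dim_col A)) \<otimes>\<^bsub>W2\<^esub> cls2 B) (cls2 A \<otimes>\<^bsub>W2\<^esub> cls2 (U2 (dim_col B)))"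

text \<open>The value has to be read off from representing matrices; \<open>dual_diff_cong\<close>
  shows that the choice among them does not matter.\<close>

definition dual_map :: "('w \<times> 'w) set \<Rightarrow> ('v \<times> 'v) set" where
  "dual_map X = (SOME Y. \<exists>A B. X = groth_diff W1 (cls1 A) (cls1 B) \<and> Y = dual_diff A B)"

text \<open>In terms of differences: if \<open>A' - B'\<close> is at most \<open>A - B\<close>,
  witnessed by the summand \<open>E\<close>, then the same holds for the images. After
  \<open>dual\<close> has been applied to the two block sums, \<open>cls2 E\<close> and the unit
  multiple belonging to \<open>E\<close> stand on both sides and move into \<open>e\<close>.\<close>

lemma dual_diff_mono:
  assumes "le1 (diag_mat2 (diag_mat2 A' B) E) (diag_mat2 (diag_mat2 A B') E)"
  obtains e where "e \<in> carrier W2"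
    "leq2 (cls2 (U2 (dim_col A')) \<otimes>\<^bsub>W2\<^esub> cls2 B' \<otimes>\<^bsub>W2\<^esub> (cls2 A \<otimes>\<^bsub>W2\<^esub> cls2 (U2 (dim_col B))) \<otimes>\<^bsub>W2\<^esub> e)
      (cls2 (U2 (dim_col A)) \<otimes>\<^bsub>W2\<^esub> cls2 B \<otimes>\<^bsub>W2\<^esub> (cls2 A' \<otimes>\<^bsub>W2\<^esub> cls2 (U2 (dim_col B'))) \<otimes>\<^bsub>W2\<^esub> e)"
proof -
  obtain x where x: "x \<in> carrier W2"
    "leq2 (cls2 (diag_mat2 (diag_mat2 A B') E) \<otimes>\<^bsub>W2\<^esub>
        cls2 (U2 (dim_col (diag_mat2 (diag_mat2 A' B) E))) \<otimes>\<^bsub>W2\<^esub> x)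
      (cls2 (diag_mat2 (diag_mat2 A' B) E) \<otimes>\<^bsub>W2\<^esub>
        cls2 (U2 (dim_col (diag_mat2 (diag_mat2 A B') E))) \<otimes>\<^bsub>W2\<^esub> x)"
    using dual[OF assms] by (auto simp: T.dual_def)
  show ?thesis
    using x by (intro that[of "cls2 E \<otimes>\<^bsub>W2\<^esub> cls2 (U2 (dim_col E)) \<otimes>\<^bsub>W2\<^esub> x"])
      (auto simp: T.cls_U_add T.mult_cls[symmetric] T.m_ac)
qed

text \<open>Equality of differences means that two block sums lie below each other. Both
  inequalities are transported by \<open>dual_diff_mono\<close>, and once both summands
  \<open>e\<close> and \<open>f\<close> are added, antisymmetry of \<open>leq2\<close> turns them
  into an equation.\<close>

lemma dual_diff_cong:
  assumes "groth_diff W1 (cls1 A) (cls1 B) = groth_diff W1 (cls1 A') (cls1 B')"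
  shows "dual_diff A B = dual_diff A' B'"
proof -
  let ?l = "cls2 (U2 (dim_col A')) \<otimes>\<^bsub>W2\<^esub> cls2 B' \<otimes>\<^bsub>W2\<^esub> (cls2 A \<otimes>\<^bsub>W2\<^esub> cls2 (U2 (dim_col B)))"
  let ?r = "cls2 (U2 (dim_col A)) \<otimes>\<^bsub>W2\<^esub> cls2 B \<otimes>\<^bsub>W2\<^esub> (cls2 A' \<otimes>\<^bsub>W2\<^esub> cls2 (U2 (dim_col B')))"
  obtain E where eq: "cls1 (diag_mat2 (diag_mat2 A B') E) = cls1 (diag_mat2 (diag_mat2 A' B) E)"
    using assms by (auto simp: S.groth_diff_eq_iff S.carrier_eq S.mult_cls)
  obtain e where e: "e \<in> carrier W2" "leq2 (?l \<otimes>\<^bsub>W2\<^esub> e) (?r \<otimes>\<^bsub>W2\<^esub> e)"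
    using eq dual_diff_mono[of A' B E A B'] by (auto simp: S.cls_eq_iff)
  obtain f where f: "f \<in> carrier W2" "leq2 (?r \<otimes>\<^bsub>W2\<^esub> f) (?l \<otimes>\<^bsub>W2\<^esub> f)"
    using eq dual_diff_mono[of A B' E A' B] by (auto simp: S.cls_eq_iff)
  have "leq2 (?l \<otimes>\<^bsub>W2\<^esub> e \<otimes>\<^bsub>W2\<^esub> f) (?r \<otimes>\<^bsub>W2\<^esub> e \<otimes>\<^bsub>W2\<^esub> f)"
    by (rule T.leq_mult_right[OF e(2)]) (use e f in auto)
  moreover have "leq2 (?r \<otimes>\<^bsub>W2\<^esub> f \<otimes>\<^bsub>W2\<^esub> e) (?l \<otimes>\<^bsub>W2\<^esub> f \<otimes>\<^bsub>W2\<^esub> e)"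
    by (rule T.leq_mult_right[OF f(2)]) (use e f in auto)
  ultimately have "?r \<otimes>\<^bsub>W2\<^esub> (e \<otimes>\<^bsub>W2\<^esub> f) = ?l \<otimes>\<^bsub>W2\<^esub> (e \<otimes>\<^bsub>W2\<^esub> f)"
    using e f by (intro T.leq_antisym) (auto simp: T.m_ac)
  then show ?thesis
    unfolding dual_diff_def using e f
    by (subst T.groth_diff_eq_iff) (auto intro!: bexI[of _ "e \<otimes>\<^bsub>W2\<^esub> f"])
qed

lemma dual_map_diff: "dual_map (groth_diff W1 (cls1 A) (cls1 B)) = dual_diff A B"
  unfolding dual_map_def by (rule some_equality) (auto dest: dual_diff_cong)

lemma dual_map_of: "dual_map (groth_of W1 (cls1 A)) = groth_diff W2 (cls2 (U2 (dim_col A))) (cls2 A)"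
  by (simp add: S.groth_of_eq S.one_eq dual_map_diff dual_diff_def T.U_0 T.one_eq[symmetric])

lemma dual_map_hom: "dual_map \<in> hom (groth W1) (groth W2)"
proof (rule homI)
  fix x y assume "x \<in> carrier (groth W1)" "y \<in> carrier (groth W1)"
  then obtain A B C D where xy: "x = groth_diff W1 (cls1 A) (cls1 B)" "y = groth_diff W1 (cls1 C) (cls1 D)"
    by (metis S.groth_cases)
  show "dual_map (x \<otimes>\<^bsub>groth W1\<^esub> y) = dual_map x \<otimes>\<^bsub>groth W2\<^esub> dual_map y"
    by (simp add: xy S.groth_diff_mult S.mult_cls dual_map_diff dual_diff_def T.groth_diff_mult
        T.mult_cls[symmetric] T.cls_U_add T.m_ac)
next
  fix x assume "x \<in> carrier (groth W1)"
  then show "dual_map x \<in> carrier (groth W2)"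
    by (elim S.groth_cases) (simp add: dual_map_diff dual_diff_def)
qed

lemma dual_map_pos: "dual_map ` groth_pos W1 leq1 \<subseteq> groth_pos W2 leq2"
proof
  fix y assume "y \<in> dual_map ` groth_pos W1 leq1"
  then obtain A B E where y: "y = dual_diff A B" and le: "le1 (diag_mat2 B E) (diag_mat2 A E)"
    by (auto simp: S.groth_pos_eq S.carrier_eq S.mult_cls S.leq_cls dual_map_diff)
  \<comment> \<open>With empty matrices for \<open>A'\<close> and \<open>B'\<close>,
    \<open>dual_diff_mono\<close> compares the difference with zero.\<close>
  obtain e where "e \<in> carrier W2"
    "leq2 (cls2 A \<otimes>\<^bsub>W2\<^esub> cls2 (U2 (dim_col B)) \<otimes>\<^bsub>W2\<^esub> e) (cls2 (U2 (dim_col A)) \<otimes>\<^bsub>W2\<^esub> cls2 B \<otimes>\<^bsub>W2\<^esub> e)"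
    using dual_diff_mono[of "0\<^sub>m 0 0" B E A "0\<^sub>m 0 0"] le
    by (auto simp: T.U_0 T.one_eq[symmetric])
  then show "y \<in> groth_pos W2 leq2"
    by (auto simp: y dual_diff_def T.groth_pos_iff)
qed

text \<open>The matrix \<open>U1 1\<close> has one column and is neutral in \<open>W2\<close>, so
  its image is one unit minus zero.\<close>

lemma dual_map_unit: "dual_map (groth_of W1 (cls1 (U1 1))) = groth_of W2 (cls2 (U2 1))"
  by (simp add: dual_map_of cls_unit T.groth_of_eq del: One_nat_def)

end

section \<open>Two monoids of matrix classes that are dual to each other\<close>

locale mat_class_dual_pair =
  F: mat_class_dual le1 U1 cls1 W1 leq1 le2 U2 cls2 W2 leq2 +
  B: mat_class_dual le2 U2 cls2 W2 leq2 le1 U1 cls1 W1 leq1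
  for le1 :: "'a::ring_1 mat \<Rightarrow> 'a mat \<Rightarrow> bool" and U1 and cls1 :: "'a mat \<Rightarrow> 'w"
    and W1 :: "'w monoid" and leq1
    and le2 :: "'a mat \<Rightarrow> 'a mat \<Rightarrow> bool" and U2 and cls2 :: "'a mat \<Rightarrow> 'v"
    and W2 :: "'v monoid" and leq2
begin

lemma cls1_U2: "cls1 (U2 m) = \<one>\<^bsub>W1\<^esub>"
proof (induction m)
  case (Suc m)
  then show ?case unfolding F.T.U_Suc[of m] F.S.mult_cls[symmetric] B.cls_unit by simp
qed (simp add: F.T.U_0 F.S.one_eq)

text \<open>Applied twice, \<open>[A]\<close> becomes \<open>(m u1 - [U2 m]) - (m u1 - [A])\<close>,
  where \<open>m\<close> is the number of columns of \<open>A\<close>. The class of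
  \<open>U2 m\<close> in \<open>W1\<close> is neutral, and the two multiples of the unit
  cancel.\<close>

lemma dual_map_inverse:
  assumes "x \<in> carrier (groth W1)"
  shows "B.dual_map (F.dual_map x) = x"
proof -
  obtain A B where x: "x = groth_diff W1 (cls1 A) (cls1 B)"
    using assms by (rule F.S.groth_cases)
  have "B.dual_map (F.dual_map x) =
      B.dual_diff (diag_mat2 (U2 (dim_col A)) B) (diag_mat2 A (U2 (dim_col B)))"
    by (simp add: x F.dual_map_diff F.dual_diff_def F.T.mult_cls B.dual_map_diff)
  also have "\<dots> = x"
    unfolding B.dual_diff_def x
    by (rule F.S.groth_diff_cong)
      (simp_all add: F.S.mult_cls[symmetric] F.S.cls_U_add cls1_U2 F.S.m_ac)
  finally show ?thesis .
qed

end

lemma (in mat_class_dual_pair) dual_map_iso: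
  "po_abelian_group_unit_iso (groth W1) (groth_pos W1 leq1) (groth_of W1 (cls1 (U1 1)))
     (groth W2) (groth_pos W2 leq2) (groth_of W2 (cls2 (U2 1))) F.dual_map"
proof -
  \<comment> \<open>The locale is symmetric in the two monoids; \<open>R\<close> exchanges their
    roles, so that \<open>R.dual_map_inverse\<close> is the other composition.\<close>
  interpret R: mat_class_dual_pair le2 U2 cls2 W2 leq2 le1 U1 cls1 W1 leq1
    by unfold_locales
  have bij: "bij_betw F.dual_map (carrier (groth W1)) (carrier (groth W2))"
    using dual_map_inverse R.dual_map_inverse F.dual_map_hom B.dual_map_hom
    by (intro bij_betw_byWitness[where f' = B.dual_map]) (auto simp: hom_def)
  have "groth_pos W2 leq2 \<subseteq> F.dual_map ` groth_pos W1 leq1"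
  proof
    fix y assume y: "y \<in> groth_pos W2 leq2"
    then have "y \<in> carrier (groth W2)" by (auto simp: F.T.groth_pos_eq)
    then have "y = F.dual_map (B.dual_map y)" by (simp add: R.dual_map_inverse)
    then show "y \<in> F.dual_map ` groth_pos W1 leq1" using B.dual_map_pos y by blast
  qed
  then have "F.dual_map ` groth_pos W1 leq1 = groth_pos W2 leq2"
    using F.dual_map_pos by blast
  then show ?thesis
    unfolding po_abelian_group_unit_iso_def
    using F.S.groth_po F.T.groth_po F.dual_map_hom bij F.dual_map_unit by (auto simp: iso_def)
qed

lemma (in mat_class_dual_pair) inv_into_dual_map:
  "inv_into (carrier (groth W1)) F.dual_map (groth_of W2 (cls2 A)) =
    groth_diff W1 (cls1 (U1 (dim_col A))) (cls1 A)"
proof (rule inv_into_f_eq)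
  interpret R: mat_class_dual_pair le2 U2 cls2 W2 leq2 le1 U1 cls1 W1 leq1
    by unfold_locales
  show "inj_on F.dual_map (carrier (groth W1))"
    using dual_map_inverse by (metis inj_onI)
  show "groth_diff W1 (cls1 (U1 (dim_col A))) (cls1 A) \<in> carrier (groth W1)"
    by simp
  show "F.dual_map (groth_diff W1 (cls1 (U1 (dim_col A))) (cls1 A)) = groth_of W2 (cls2 A)"
    unfolding B.dual_map_of[symmetric]
    by (rule R.dual_map_inverse) (simp add: F.T.groth_of_eq)
qed


section \<open>The matrix Malcolmson semigroup\<close>

lemma diag_mat2_carrier [simp, intro]:
  "A \<in> carrier_mat n m \<Longrightarrow> B \<in> carrier_mat n' m' \<Longrightarrow> diag_mat2 A B \<in> carrier_mat (n + n') (m + m')"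
  by (auto simp: diag_mat2_def)

lemma diag_mat2_four_block:
  "A \<in> carrier_mat n m \<Longrightarrow> B \<in> carrier_mat n' m' \<Longrightarrow>
    diag_mat2 A B = four_block_mat A (0\<^sub>m n m') (0\<^sub>m n' m) B"
  by (auto simp: diag_mat2_def)

lemma diag_mat2_mult:
  fixes A :: "'a::ring_1 mat"
  assumes "A \<in> carrier_mat n m" "B \<in> carrier_mat n' m'" "C \<in> carrier_mat m k" "D \<in> carrier_mat m' k'"
  shows "diag_mat2 A B * diag_mat2 C D = diag_mat2 (A * C) (B * D)"
  using assms
  by (simp add: diag_mat2_four_block[OF assms(1,2)] diag_mat2_four_block[OF assms(3,4)]
      mult_four_block_mat[where ?nr1.0 = n and ?nr2.0 = n' and ?n1.0 = m and ?n2.0 = m'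
        and ?nc1.0 = k and ?nc2.0 = k'] diag_mat2_four_block[of _ n k _ n' k'])

lemma diag_mat2_one: "diag_mat2 (1\<^sub>m m) (1\<^sub>m n) = 1\<^sub>m (m + n)"
  by (simp add: diag_mat2_def)

lemma diag_mat2_zero: "diag_mat2 (0\<^sub>m n m) (0\<^sub>m n' m') = 0\<^sub>m (n + n') (m + m')"
  by (simp add: diag_mat2_def)

section \<open>The preorder generated by products and by splitting triangular matrices\<close>

lemma mat_below_refl: "mat_below A A"
  by (simp add: mat_below_def)

lemma mat_below_trans: "mat_below A B \<Longrightarrow> mat_below B C \<Longrightarrow> mat_below A C"
  unfolding mat_below_def by (rule rtranclp_trans)

lemma mat_below_mult:
  "dim_col C = dim_row B \<Longrightarrow> dim_row D = dim_col B \<Longrightarrow> mat_below (C * B * D) B"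
  unfolding mat_below_def mat_below1_def by blast

lemma mat_below_triangular:
  assumes "C \<in> carrier_mat n m" "D \<in> carrier_mat n' m'" "E \<in> carrier_mat n m'"
  shows "mat_below (diag_mat2 C D) (four_block_mat C E (0\<^sub>m n' m) D)"
  unfolding mat_below_def
proof (rule r_into_rtranclp, unfold mat_below1_def, intro disjI2 exI conjI)
  show "four_block_mat C E (0\<^sub>m n' m) D = four_block_mat C E (0\<^sub>m (dim_row D) (dim_col C)) D"
    using assms by auto
qed (use assms in auto)

lemma mat_below1_diag_right:
  assumes "mat_below1 A B"
  shows "mat_below (diag_mat2 A X) (diag_mat2 B X)"
  using assms unfolding mat_below1_def
proof (elim disjE exE conjE)
  fix C D
  assume d: "dim_col C = dim_row B" "dim_row D = dim_col B" and A: "A = C * B * D"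
  have "diag_mat2 A X = diag_mat2 C (1\<^sub>m (dim_row X)) * diag_mat2 B X * diag_mat2 D (1\<^sub>m (dim_col X))"
  proof -
    have "diag_mat2 C (1\<^sub>m (dim_row X)) * diag_mat2 B X = diag_mat2 (C * B) (1\<^sub>m (dim_row X) * X)"
      using d by (intro diag_mat2_mult) auto
    moreover have "diag_mat2 (C * B) X * diag_mat2 D (1\<^sub>m (dim_col X)) = diag_mat2 (C * B * D) (X * 1\<^sub>m (dim_col X))"
      using d by (intro diag_mat2_mult) auto
    ultimately show ?thesis by (simp add: A)
  qed
  then show ?thesis using d by (auto intro!: mat_below_mult)
next
  fix C D E
  assume d: "dim_row E = dim_row C" "dim_col E = dim_col D"
    and B: "B = four_block_mat C E (0\<^sub>m (dim_row D) (dim_col C)) D" and A: "A = diag_mat2 C D"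
  \<comment> \<open>\<open>E\<close> followed by zero columns: with this corner,
    \<open>diag_mat2 B X\<close> is again block triangular, its diagonal blocks being
    \<open>C\<close> and \<open>diag_mat2 D X\<close>.\<close>
  let ?F = "mat (dim_row C) (dim_col D + dim_col X) (\<lambda>(i, j). if j < dim_col D then E $$ (i, j) else 0)"
  have "diag_mat2 B X = four_block_mat C ?F (0\<^sub>m (dim_row D + dim_row X) (dim_col C)) (diag_mat2 D X)"
  proof (rule eq_matI)
    fix i j
    assume "i < dim_row (four_block_mat C ?F (0\<^sub>m (dim_row D + dim_row X) (dim_col C)) (diag_mat2 D X))"
      and "j < dim_col (four_block_mat C ?F (0\<^sub>m (dim_row D + dim_row X) (dim_col C)) (diag_mat2 D X))"
    then show "diag_mat2 B X $$ (i, j) =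
        four_block_mat C ?F (0\<^sub>m (dim_row D + dim_row X) (dim_col C)) (diag_mat2 D X) $$ (i, j)"
      using d by (cases "i < dim_row C"; cases "i < dim_row C + dim_row D";
          cases "j < dim_col C"; cases "j < dim_col C + dim_col D";
          simp add: B diag_mat2_def less_diff_conv2 not_less add.commute[of _ "dim_row C"]
            add.commute[of _ "dim_col C"])
  qed (simp_all add: B)
  then show ?thesis
    unfolding A diag_mat2_assoc[symmetric]
    using d by (auto intro!: mat_below_triangular)
qed

lemma mat_below_diag_right:
  assumes "mat_below A B"
  shows "mat_below (diag_mat2 A X) (diag_mat2 B X)"
  using assms unfolding mat_below_def
proof (induction rule: rtranclp_induct)
  case (step B C)
  then show ?case
    using mat_below1_diag_right[of B C X] mat_below_trans unfolding mat_below_def by blast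
qed simp

lemma mat_below_diag_comm: "mat_below (diag_mat2 A B) (diag_mat2 B (A :: 'a::ring_1 mat))"
proof -
  obtain n m n' m' where A: "A \<in> carrier_mat n m" and B: "B \<in> carrier_mat n' m'" by blast
  \<comment> \<open>The block permutation matrices that exchange the two summands, \<open>?P\<close>
    for the rows and \<open>?Q\<close> for the columns.\<close>
  let ?P = "four_block_mat (0\<^sub>m n n') (1\<^sub>m n) (1\<^sub>m n') (0\<^sub>m n' n) :: 'a mat"
  let ?Q = "four_block_mat (0\<^sub>m m' m) (1\<^sub>m m') (1\<^sub>m m) (0\<^sub>m m m') :: 'a mat"
  have "?P * diag_mat2 B A = four_block_mat (0\<^sub>m n m') A B (0\<^sub>m n' m)"
    using A B by (simp add: diag_mat2_four_block[OF B A] 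
        mult_four_block_mat[where ?nr1.0 = n and ?nr2.0 = n' and ?n1.0 = n' and ?n2.0 = n
          and ?nc1.0 = m' and ?nc2.0 = m])
  then have "?P * diag_mat2 B A * ?Q = diag_mat2 A B"
    using A B by (simp add: diag_mat2_four_block[OF A B] 
        mult_four_block_mat[where ?nr1.0 = n and ?nr2.0 = n' and ?n1.0 = m' and ?n2.0 = m
          and ?nc1.0 = m and ?nc2.0 = m'])
  moreover have "mat_below (?P * diag_mat2 B A * ?Q) (diag_mat2 B A)"
    using A B by (intro mat_below_mult) auto
  ultimately show ?thesis by simp
qed

text \<open>An empty matrix is the product of \<open>A\<close> with zero matrices of fitting sizes.
  Having no rows is enough, and this makes the presentation matrix of a free module neutral in
  \<open>WM\<close>.\<close>

lemma mat_below_zero: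
  assumes "0 \<in> {n, m}"
  shows "mat_below (0\<^sub>m n m) (A :: 'a::ring_1 mat)"
proof -
  have "0\<^sub>m n (dim_row A) * A * 0\<^sub>m (dim_col A) m = 0\<^sub>m n m"
    using assms by (intro eq_matI) auto
  moreover have "mat_below (0\<^sub>m n (dim_row A) * A * 0\<^sub>m (dim_col A) m) A"
    by (intro mat_below_mult) auto
  ultimately show ?thesis by simp
qed

lemma mat_below_one: "mat_below A (1\<^sub>m (dim_col A))"
  using mat_below_mult[of A "1\<^sub>m (dim_col A)" "1\<^sub>m (dim_col A)"] by simp

lemma WM_class_eq_iff: "WM_class A = WM_class B \<longleftrightarrow> mat_below A B \<and> mat_below B A"
  unfolding WM_class_def using mat_below_refl mat_below_trans by blast

lemma mat_below_diag:
  "mat_below A A' \<Longrightarrow> mat_below B B' \<Longrightarrow> mat_below (diag_mat2 A B) (diag_mat2 A' B')"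
  by (meson mat_below_diag_comm mat_below_diag_right mat_below_trans)

lemma WM_mat_class_monoid:
  "mat_class_monoid mat_below 1\<^sub>m WM_class (WM TYPE('a::ring_1)) WM_le"
proof
  fix A B C :: "'a mat"
  show "WM_class A \<otimes>\<^bsub>WM TYPE('a)\<^esub> WM_class B = WM_class (diag_mat2 A B)"
  proof -
    have "(\<Union>A'\<in>WM_class A. \<Union>B'\<in>WM_class B. WM_class (diag_mat2 A' B')) =
        (\<Union>A'\<in>WM_class A. \<Union>B'\<in>WM_class B. WM_class (diag_mat2 A B))"
      by (intro SUP_cong refl) (auto simp: WM_class_eq_iff, auto simp: WM_class_def intro: mat_below_diag)
    also have "\<dots> = WM_class (diag_mat2 A B)"
      using mat_below_refl by (auto simp: WM_class_def)
    finally show ?thesis by (simp add: WM_def)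
  qed
  show "WM_le (WM_class A) (WM_class B) \<longleftrightarrow> mat_below A B"
    unfolding WM_le_def WM_class_def using mat_below_refl mat_below_trans by blast
  show "mat_below A (1\<^sub>m (dim_col A))" by (rule mat_below_one)
  show "mat_below (0\<^sub>m 0 0) A" by (rule mat_below_zero) simp
  show "1\<^sub>m (Suc m) = diag_mat2 (1\<^sub>m m) (1\<^sub>m 1 :: 'a mat)" for m
    by (simp add: diag_mat2_one)
  show "1\<^sub>m 0 = (0\<^sub>m 0 0 :: 'a mat)" by auto
qed (auto simp: mat_below_refl mat_below_diag_right mat_below_diag_comm WM_class_eq_iff WM_def
    intro: mat_below_trans)

text \<open>
  The hypotheses say that \<open>T\<close> induces a surjective homomorphism from the module presented by \<open>K\<close>
  onto the one presented by \<open>A\<close>.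
\<close>

lemma mat_below_surj:
  fixes A :: "'a::ring_1 mat"
  assumes K: "K \<in> carrier_mat p q" and A: "A \<in> carrier_mat n m" and T: "T \<in> carrier_mat q m"
    and X: "X \<in> carrier_mat p n" and J: "J \<in> carrier_mat m q" and L: "L \<in> carrier_mat m n"
    and KT: "K * T = X * A" and JT: "J * T + L * A = 1\<^sub>m m"
  shows "mat_below (diag_mat2 K (1\<^sub>m m)) (diag_mat2 A (1\<^sub>m q))"
proof -
  define S where "S = 1\<^sub>m q - T * J"
  have S: "S \<in> carrier_mat q q" using T J by (auto simp: S_def)
  note c = K A T X J L S
  \<comment> \<open>\<open>?D\<close> is the invertible matrix from Schanuel's lemma; its inverse
    has the rows of blocks \<open>T, 1\<close> and \<open>1 - J * T, - J\<close>. By the two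
    hypotheses \<open>K * T = X * A\<close> and \<open>J * T + L * A = 1\<close>, the product of
    \<open>?C\<close> with \<open>diag_mat2 A 1\<close> is \<open>diag_mat2 K 1\<close> times this
    inverse. The four equations below are the blocks of the resulting identity.\<close>
  let ?C = "four_block_mat X K L (- J)" and ?D = "four_block_mat J (1\<^sub>m m) S (- T)"
  have 1: "X * A * J + K * S = K"
  proof -
    have "K * S = K - K * T * J"
      using c by (simp add: S_def mult_minus_distrib_mat[where nr = p and n = q and nc = q] assoc_mult_mat[where ?n\<^sub>1 = p and ?n\<^sub>2 = q])
    then show ?thesis
      unfolding KT[symmetric] using c by (intro eq_matI) auto
  qed
  have 2: "X * A + K * (- T) = 0\<^sub>m p m"
    unfolding KT[symmetric] using c by (intro eq_matI) auto
  have 3: "L * A * J + (- J) * S = 0\<^sub>m m q"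
  proof -
    have LA: "L * A = 1\<^sub>m m - J * T"
      using c unfolding JT[symmetric] by (intro eq_matI) auto
    have "L * A * J = J - J * T * J"
      unfolding LA using c by (simp add: minus_mult_distrib_mat[where nr = m and n = m and nc = q])
    moreover have "(- J) * S = - (J - J * T * J)"
      using c by (simp add: S_def mult_minus_distrib_mat[where nr = m and n = q and nc = q] assoc_mult_mat[where ?n\<^sub>1 = m and ?n\<^sub>2 = q])
        (intro eq_matI, auto)
    ultimately have "L * A * J + (- J) * S = (J - J * T * J) + - (J - J * T * J)"
      by simp
    then show ?thesis
      using c by (simp del: assoc_mult_mat) (intro eq_matI, auto)
  qed
  have 4: "L * A + (- J) * (- T) = 1\<^sub>m m"
    using c unfolding JT[symmetric] by (intro eq_matI) auto
  have "?C * diag_mat2 A (1\<^sub>m q) = four_block_mat (X * A) K (L * A) (- J)"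
    using c by (simp add: diag_mat2_four_block[OF A one_carrier_mat]
        mult_four_block_mat[where ?nr1.0 = p and ?nr2.0 = m and ?n1.0 = n and ?n2.0 = q
          and ?nc1.0 = m and ?nc2.0 = q])
  then have "?C * diag_mat2 A (1\<^sub>m q) * ?D =
      four_block_mat (X * A * J + K * S) (X * A + K * (- T)) (L * A * J + (- J) * S) (L * A + (- J) * (- T))"
    using c by (simp add: mult_four_block_mat[where ?n1.0 = m and ?n2.0 = q and ?nr1.0 = p and ?nr2.0 = m and ?nc1.0 = q and ?nc2.0 = m])
  also have "\<dots> = diag_mat2 K (1\<^sub>m m)"
    unfolding 1 2 3 4 by (rule diag_mat2_four_block[OF K one_carrier_mat, symmetric])
  finally show ?thesis
    using mat_below_mult[of ?C "diag_mat2 A (1\<^sub>m q)" ?D] c by simp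
qed


section \<open>Row vectors\<close>

lemma vec_mult_mat_carrier [simp, intro]: "A \<in> carrier_mat n m \<Longrightarrow> vec_mult_mat x A \<in> carrier_vec m"
  by (auto simp: vec_mult_mat_def)

lemma dim_vec_mult_mat [simp]: "dim_vec (vec_mult_mat x A) = dim_col A"
  by (simp add: vec_mult_mat_def)

lemma index_vec_mult_mat [simp]: "j < dim_col A \<Longrightarrow> vec_mult_mat x A $ j = x \<bullet> col A j"
  by (simp add: vec_mult_mat_def)

lemma vec_mult_mat_add:
  assumes "x \<in> carrier_vec n" "y \<in> carrier_vec n" "A \<in> carrier_mat n m"
  shows "vec_mult_mat (x + y) A = vec_mult_mat x A + vec_mult_mat y A"
  using assms by (intro eq_vecI) (auto simp: add_scalar_prod_distrib[where n = n])

lemma vec_mult_mat_smult: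
  assumes "x \<in> carrier_vec n" "A \<in> carrier_mat n m"
  shows "vec_mult_mat (a \<cdot>\<^sub>v x) A = a \<cdot>\<^sub>v vec_mult_mat x A"
  using assms by (intro eq_vecI) (auto simp: smult_scalar_prod_distrib[where n = n])

lemma row_mult_eq: "i < dim_row A \<Longrightarrow> row (A * B) i = vec_mult_mat (row A i) B"
  by (intro eq_vecI) auto

text \<open>Reading a row vector as a matrix with one row lets \<open>vec_mult_mat_mult\<close>
  follow from the associativity of matrix products.\<close>

lemma vec_mult_mat_eq_row: "x \<in> carrier_vec n \<Longrightarrow> vec_mult_mat x A = row (mat_of_rows n [x] * A) 0"
  by (subst row_mult_eq) auto

lemma vec_mult_mat_mult:
  assumes "x \<in> carrier_vec n" "A \<in> carrier_mat n m" "B \<in> carrier_mat m k"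
  shows "vec_mult_mat x (A * B) = vec_mult_mat (vec_mult_mat x A) B"
proof -
  have X: "mat_of_rows n [x] \<in> carrier_mat 1 n" by (simp add: mat_of_rows_def)
  have "vec_mult_mat x (A * B) = row (mat_of_rows n [x] * A * B) 0"
    unfolding vec_mult_mat_eq_row[OF assms(1)] assoc_mult_mat[OF X assms(2,3)] ..
  also have "\<dots> = vec_mult_mat (row (mat_of_rows n [x] * A) 0) B"
    by (rule row_mult_eq) simp
  finally show ?thesis unfolding vec_mult_mat_eq_row[OF assms(1), symmetric] .
qed

lemma vec_mult_mat_unit: "A \<in> carrier_mat n m \<Longrightarrow> i < n \<Longrightarrow> vec_mult_mat (unit_vec n i) A = row A i"
  by (intro eq_vecI) auto

lemma vec_mult_mat_one: "x \<in> carrier_vec n \<Longrightarrow> vec_mult_mat x (1\<^sub>m n) = x"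
  by (intro eq_vecI) auto

lemma vec_mult_mat_add_right:
  assumes "x \<in> carrier_vec n" "A \<in> carrier_mat n m" "B \<in> carrier_mat n m"
  shows "vec_mult_mat x (A + B) = vec_mult_mat x A + vec_mult_mat x B"
  using assms by (intro eq_vecI) (auto simp: scalar_prod_add_distrib[where n = n])

lemma vec_mult_mat_uminus_right:
  assumes "x \<in> carrier_vec n" "A \<in> carrier_mat n m"
  shows "vec_mult_mat x (- A) = - vec_mult_mat x (A :: 'a::ring_1 mat)"
  using assms by (intro eq_vecI) auto

lemma vec_mult_mat_zero_right: "x \<in> carrier_vec n \<Longrightarrow> vec_mult_mat x (0\<^sub>m n m) = 0\<^sub>v m"
  by (intro eq_vecI) auto

lemma vec_mult_mat_zero_left: "A \<in> carrier_mat n m \<Longrightarrow> vec_mult_mat (0\<^sub>v n) A = 0\<^sub>v m"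
  by (intro eq_vecI) auto

lemma mat_eq_iff_vec_mult_mat:
  assumes "A \<in> carrier_mat n m" "B \<in> carrier_mat n m"
    and "\<And>x. x \<in> carrier_vec n \<Longrightarrow> vec_mult_mat x A = vec_mult_mat x B"
  shows "A = B"
proof (rule eq_rowI)
  fix i assume "i < dim_row B"
  then show "row A i = row B i"
    using assms(3)[of "unit_vec n i"] assms(1,2) by (simp add: vec_mult_mat_unit)
qed (use assms in auto)

lemma vec_mult_mat_append:
  assumes "x \<in> carrier_vec n" "y \<in> carrier_vec n'"
    "A \<in> carrier_mat n m" "B \<in> carrier_mat n m'" "C \<in> carrier_mat n' m" "D \<in> carrier_mat n' m'"
  shows "vec_mult_mat (x @\<^sub>v y) (four_block_mat A B C D) =
    (vec_mult_mat x A + vec_mult_mat y C) @\<^sub>v (vec_mult_mat x B + vec_mult_mat y D)"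
proof (rule eq_vecI)
  fix j assume j: "j < dim_vec ((vec_mult_mat x A + vec_mult_mat y C) @\<^sub>v (vec_mult_mat x B + vec_mult_mat y D))"
  show "vec_mult_mat (x @\<^sub>v y) (four_block_mat A B C D) $ j =
    ((vec_mult_mat x A + vec_mult_mat y C) @\<^sub>v (vec_mult_mat x B + vec_mult_mat y D)) $ j"
  proof (cases "j < m")
    case True
    then show ?thesis
      using assms j by (simp add: col_four_block_mat(1)[OF assms(3-6)] scalar_prod_append[where ?n1.0 = n and ?n2.0 = n'])
  next
    case False
    then have "j - m < m'" using assms j by auto
    then show ?thesis
      using False assms j by (simp add: col_four_block_mat(2)[OF assms(3-6)] scalar_prod_append[where ?n1.0 = n and ?n2.0 = n'])
  qed
qed (use assms in auto)

lemma vec_mult_mat_append_rows: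
  fixes A :: "'a::ring_1 mat"
  assumes "x \<in> carrier_vec n" "y \<in> carrier_vec n'" "A \<in> carrier_mat n m" "B \<in> carrier_mat n' m"
  shows "vec_mult_mat (x @\<^sub>v y) (A @\<^sub>r B) = vec_mult_mat x A + vec_mult_mat y B"
proof -
  have "vec_mult_mat (x @\<^sub>v y) (A @\<^sub>r B) = (vec_mult_mat x A + vec_mult_mat y B) @\<^sub>v (0\<^sub>v 0 + 0\<^sub>v 0)"
    unfolding append_rows_def using assms
    by (subst vec_mult_mat_append[of _ n _ n' _ m _ 0]) (auto simp: vec_mult_mat_zero_right)
  also have "\<dots> = vec_mult_mat x A + vec_mult_mat y B"
    by (intro eq_vecI) auto
  finally show ?thesis .
qed

lemma vec_append_cases:
  assumes "x \<in> carrier_vec (n + m)"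
  obtains y z where "x = y @\<^sub>v z" "y \<in> carrier_vec n" "z \<in> carrier_vec m"
  using assms that[of "vec_first x n" "vec_last x m"] by simp

lemma vec_first_append: "y \<in> carrier_vec n \<Longrightarrow> vec_first (y @\<^sub>v z) n = y"
  by (intro eq_vecI) (auto simp: vec_first_def)

lemma vec_last_append: "z \<in> carrier_vec m \<Longrightarrow> vec_last (y @\<^sub>v z) m = z"
  by (intro eq_vecI) (auto simp: vec_last_def)

lemma append_vec_smult: "a \<cdot>\<^sub>v (y @\<^sub>v z) = (a \<cdot>\<^sub>v y) @\<^sub>v (a \<cdot>\<^sub>v z)"
  by (intro eq_vecI) auto

section \<open>Homomorphisms of left modules\<close>

lemma left_module_vec: "left_module (module_vec TYPE('a::ring_1) n)"
proof (intro left_module.intro left_module_axioms.intro abelian_groupI)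
  fix x assume "x \<in> carrier (module_vec TYPE('a) n)"
  then show "\<exists>y\<in>carrier (module_vec TYPE('a) n).
      y \<oplus>\<^bsub>module_vec TYPE('a) n\<^esub> x = \<zero>\<^bsub>module_vec TYPE('a) n\<^esub>"
    by (intro bexI[of _ "- x"]) (auto simp: module_vec_simps)
qed (auto simp: module_vec_simps algebra_simps smult_add_distrib_vec add_smult_distrib_vec
    smult_smult_assoc intro!: eq_vecI)

lemma lmod_homI:
  assumes "\<And>x. x \<in> carrier M \<Longrightarrow> f x \<in> carrier N"
    and "\<And>x y. x \<in> carrier M \<Longrightarrow> y \<in> carrier M \<Longrightarrow> f (x \<oplus>\<^bsub>M\<^esub> y) = f x \<oplus>\<^bsub>N\<^esub> f y"
    and "\<And>a x. x \<in> carrier M \<Longrightarrow> f (a \<odot>\<^bsub>M\<^esub> x) = a \<odot>\<^bsub>N\<^esub> f x"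
  shows "f \<in> lmod_hom M N"
  using assms by (auto simp: lmod_hom_def hom_def)

lemma lmod_hom_closed: "f \<in> lmod_hom M N \<Longrightarrow> x \<in> carrier M \<Longrightarrow> f x \<in> carrier N"
  by (auto simp: lmod_hom_def hom_def)

lemma lmod_hom_add:
  "f \<in> lmod_hom M N \<Longrightarrow> x \<in> carrier M \<Longrightarrow> y \<in> carrier M \<Longrightarrow> f (x \<oplus>\<^bsub>M\<^esub> y) = f x \<oplus>\<^bsub>N\<^esub> f y"
  by (auto simp: lmod_hom_def hom_def)

lemma lmod_hom_smult: "f \<in> lmod_hom M N \<Longrightarrow> x \<in> carrier M \<Longrightarrow> f (a \<odot>\<^bsub>M\<^esub> x) = a \<odot>\<^bsub>N\<^esub> f x"
  by (auto simp: lmod_hom_def)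

context left_module
begin

lemma smult_zero_left: "x \<in> carrier M \<Longrightarrow> 0 \<odot> x = \<zero>"
  by (metis add.r_cancel_one' add_0 smult_closed smult_l_distr)

lemma smult_zero_right: "a \<odot> \<zero> = \<zero>"
  by (metis mult_zero_right smult_assoc smult_zero_left zero_closed)

lemma smult_minus_one: "x \<in> carrier M \<Longrightarrow> (- 1) \<odot> x = \<ominus> x"
  by (metis add.left_inverse minus_equality smult_closed smult_l_distr smult_one smult_zero_left)

lemma left_submoduleI:
  assumes "H \<subseteq> carrier M" "\<zero> \<in> H" "\<And>x y. x \<in> H \<Longrightarrow> y \<in> H \<Longrightarrow> x \<oplus> y \<in> H"
    "\<And>a x. x \<in> H \<Longrightarrow> a \<odot> x \<in> H"
  shows "left_submodule H M"
proof -
  have "\<ominus> x \<in> H" if "x \<in> H" for x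
    using that assms(1) assms(4)[of x "- 1"] by (auto simp: smult_minus_one)
  then have "subgroup H (add_monoid M)"
    using assms by (intro add.subgroupI) (auto simp: a_inv_def[symmetric])
  then show ?thesis using assms(4) by (auto simp: left_submodule_def)
qed

end

lemma lmod_hom_zero:
  assumes "f \<in> lmod_hom M N" "left_module M" "left_module N"
  shows "f \<zero>\<^bsub>M\<^esub> = \<zero>\<^bsub>N\<^esub>"
proof -
  interpret M: left_module M by fact
  interpret N: left_module N by fact
  show ?thesis
    by (metis M.smult_zero_left M.zero_closed N.smult_zero_left assms(1) lmod_hom_closed lmod_hom_smult)
qed

lemma lmod_hom_uminus:
  assumes "f \<in> lmod_hom M N" "left_module M" "left_module N" "x \<in> carrier M"
  shows "f (\<ominus>\<^bsub>M\<^esub> x) = \<ominus>\<^bsub>N\<^esub> f x"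
proof -
  interpret M: left_module M by fact
  interpret N: left_module N by fact
  show ?thesis
    by (metis M.smult_minus_one N.smult_minus_one assms(1,4) lmod_hom_closed lmod_hom_smult)
qed

lemma lmod_hom_comp: "f \<in> lmod_hom M N \<Longrightarrow> g \<in> lmod_hom N K \<Longrightarrow> g \<circ> f \<in> lmod_hom M K"
  by (rule lmod_homI) (simp_all add: lmod_hom_closed lmod_hom_add lmod_hom_smult)

lemma lmod_hom_id: "id \<in> lmod_hom M M"
  by (auto simp: lmod_hom_def hom_def)

lemma vec_mult_mat_hom:
  "A \<in> carrier_mat n m \<Longrightarrow>
    (\<lambda>x. vec_mult_mat x A) \<in> lmod_hom (module_vec TYPE('a::ring_1) n) (module_vec TYPE('a) m)"
  by (intro lmod_homI) (auto simp: module_vec_simps vec_mult_mat_add vec_mult_mat_smult)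

lemma vec_append_homs:
  "(\<lambda>v. vec_first v m) \<in> lmod_hom (module_vec TYPE('a::ring_1) (m + n)) (module_vec TYPE('a) m)"
  "(\<lambda>y. 0\<^sub>v m @\<^sub>v y) \<in> lmod_hom (module_vec TYPE('a) n) (module_vec TYPE('a) (m + n))"
  by (rule lmod_homI; auto simp: module_vec_simps vec_first_def intro!: eq_vecI)+

section \<open>Homomorphisms out of free modules and out of quotients\<close>

lemma lmod_hom_vec_ext:
  fixes N :: "('a::ring_1, 'm) module"
  assumes N: "left_module N"
    and \<phi>: "\<phi> \<in> lmod_hom (module_vec TYPE('a) q) N" and \<psi>: "\<psi> \<in> lmod_hom (module_vec TYPE('a) q) N"
    and eq: "\<And>i. i < q \<Longrightarrow> \<phi> (unit_vec q i) = \<psi> (unit_vec q i)"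
    and x: "x \<in> carrier_vec q"
  shows "\<phi> x = \<psi> x"
proof -
  \<comment> \<open>\<open>x\<close> cut off after its first \<open>k\<close> coordinates. One step
    of the induction adds a multiple of one unit vector, which avoids finite sums in
    \<open>N\<close>.\<close>
  define t where "t k = vec q (\<lambda>i. if i < k then x $ i else 0)" for k
  have t: "t k \<in> carrier_vec q" for k by (simp add: t_def)
  have "\<phi> (t k) = \<psi> (t k)" if "k \<le> q" for k
    using that
  proof (induction k)
    case 0
    have "t 0 = 0\<^sub>v q" by (auto simp: t_def)
    then show ?case
      using lmod_hom_zero[OF \<phi> left_module_vec N] lmod_hom_zero[OF \<psi> left_module_vec N]
      by (simp add: module_vec_simps)
  next
    case (Suc k)
    have "t (Suc k) = t k + x $ k \<cdot>\<^sub>v unit_vec q k"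
      using Suc.prems by (intro eq_vecI) (auto simp: t_def less_Suc_eq)
    then show ?case
      using Suc eq[of k] lmod_hom_add[OF \<phi>, of "t k" "x $ k \<cdot>\<^sub>v unit_vec q k"]
        lmod_hom_add[OF \<psi>, of "t k" "x $ k \<cdot>\<^sub>v unit_vec q k"]
        lmod_hom_smult[OF \<phi>, of "unit_vec q k" "x $ k"] lmod_hom_smult[OF \<psi>, of "unit_vec q k" "x $ k"] t
      by (simp add: module_vec_simps)
  qed
  moreover have "t q = x" using x by (auto simp: t_def)
  ultimately show ?thesis by force
qed

text \<open>Projectivity of free modules in matrix form: the rows of \<open>T\<close> are preimages
  of the images of the unit vectors. Surjectivity of \<open>h\<close> is replaced by an inclusion of
  images because \<open>h\<close> is sometimes a map of relations, multiplication by a presentation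
  matrix, and then \<open>T\<close> expresses vectors through its rows.\<close>

lemma lmod_hom_lift:
  fixes N :: "('a::ring_1, 'm) module"
  assumes N: "left_module N" and h: "h \<in> lmod_hom (module_vec TYPE('a) m) N"
    and \<phi>: "\<phi> \<in> lmod_hom (module_vec TYPE('a) q) N"
    and ex: "\<And>x. x \<in> carrier_vec q \<Longrightarrow> \<phi> x \<in> h ` carrier_vec m"
  obtains T where "T \<in> carrier_mat q m" "\<And>x. x \<in> carrier_vec q \<Longrightarrow> h (vec_mult_mat x T) = \<phi> x"
proof -
  have "\<forall>i<q. \<exists>y. y \<in> carrier_vec m \<and> h y = \<phi> (unit_vec q i)"
    using ex by (metis imageE unit_vec_carrier)
  then obtain t where t: "\<And>i. i < q \<Longrightarrow> t i \<in> carrier_vec m \<and> h (t i) = \<phi> (unit_vec q i)"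
    by metis
  define T where "T = mat q m (\<lambda>(i, j). t i $ j)"
  have T: "T \<in> carrier_mat q m" by (simp add: T_def)
  have row: "row T i = t i" if "i < q" for i
    using t[OF that] that by (intro eq_vecI) (auto simp: T_def)
  have "h (vec_mult_mat x T) = \<phi> x" if "x \<in> carrier_vec q" for x
    using lmod_hom_vec_ext[OF N lmod_hom_comp[OF vec_mult_mat_hom[OF T] h] \<phi> _ that] t T
    by (simp add: vec_mult_mat_unit row)
  then show ?thesis using T that by blast
qed

lemma lmod_hom_eq_on_diff:
  assumes "h \<in> lmod_hom P N" "left_module P" "left_module N" "x \<in> carrier P" "y \<in> carrier P"
  shows "h x = h y \<longleftrightarrow> h (x \<ominus>\<^bsub>P\<^esub> y) = \<zero>\<^bsub>N\<^esub>"
proof -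
  interpret P: left_module P by fact
  interpret N: left_module N by fact
  have "h (x \<ominus>\<^bsub>P\<^esub> y) = h x \<ominus>\<^bsub>N\<^esub> h y"
    using assms by (simp add: P.minus_eq N.minus_eq lmod_hom_add lmod_hom_uminus)
  moreover have "h x \<in> carrier N" "h y \<in> carrier N"
    using assms(4,5) lmod_hom_closed[OF assms(1)] by simp_all
  ultimately show ?thesis
    using N.minus_equality[of "h x" "\<ominus>\<^bsub>N\<^esub> h y"] by (auto simp: N.minus_eq N.r_neg)
qed

text \<open>The universal property of a quotient: \<open>k\<close> is \<open>h\<close> after a
  set-theoretic section \<open>s\<close> of \<open>\<pi>\<close>, and the condition on kernels makes
  its values independent of the section.\<close>

lemma lmod_hom_factor:
  assumes P: "left_module P" and M: "left_module M" and N: "left_module N"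
    and \<pi>: "\<pi> \<in> lmod_hom P M" and surj: "\<pi> ` carrier P = carrier M" and h: "h \<in> lmod_hom P N"
    and ker: "\<And>x. x \<in> carrier P \<Longrightarrow> \<pi> x = \<zero>\<^bsub>M\<^esub> \<Longrightarrow> h x = \<zero>\<^bsub>N\<^esub>"
  obtains k where "k \<in> lmod_hom M N" "\<And>x. x \<in> carrier P \<Longrightarrow> k (\<pi> x) = h x"
proof -
  interpret P: left_module P by fact
  interpret M: left_module M by fact
  define s where "s z = (SOME x. x \<in> carrier P \<and> \<pi> x = z)" for z
  have s: "s z \<in> carrier P \<and> \<pi> (s z) = z" if "z \<in> carrier M" for z
  proof -
    have "\<exists>x. x \<in> carrier P \<and> \<pi> x = z" using that unfolding surj[symmetric] by blast
    then show ?thesis unfolding s_def by (rule someI_ex)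
  qed
  have k: "h (s (\<pi> x)) = h x" if x: "x \<in> carrier P" for x
  proof -
    have c: "\<pi> x \<in> carrier M" using x surj by blast
    show ?thesis
      using s[OF c] x ker P.minus_closed
        lmod_hom_eq_on_diff[OF h P N, of "s (\<pi> x)" x] lmod_hom_eq_on_diff[OF \<pi> P M, of "s (\<pi> x)" x]
      by blast
  qed
  have "h \<circ> s \<in> lmod_hom M N"
  proof (rule lmod_homI)
    fix x assume x: "x \<in> carrier M"
    then show "(h \<circ> s) x \<in> carrier N" using s lmod_hom_closed[OF h] by auto
    fix a
    show "(h \<circ> s) (a \<odot>\<^bsub>M\<^esub> x) = a \<odot>\<^bsub>N\<^esub> (h \<circ> s) x"
      using s[OF x] k[of "a \<odot>\<^bsub>P\<^esub> s x"] lmod_hom_smult[OF h, of "s x" a]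
        lmod_hom_smult[OF \<pi>, of "s x" a] P.smult_closed by auto
  next
    fix x y assume x: "x \<in> carrier M" and y: "y \<in> carrier M"
    show "(h \<circ> s) (x \<oplus>\<^bsub>M\<^esub> y) = (h \<circ> s) x \<oplus>\<^bsub>N\<^esub> (h \<circ> s) y"
      using s[OF x] s[OF y] k[of "s x \<oplus>\<^bsub>P\<^esub> s y"] lmod_hom_add[OF h, of "s x" "s y"]
        lmod_hom_add[OF \<pi>, of "s x" "s y"] by auto
  qed
  then show ?thesis using k by (intro that[of "h \<circ> s"]) auto
qed

lemma lmod_iso_inv:
  assumes "f \<in> lmod_hom M N" "bij_betw f (carrier M) (carrier N)" "left_module M"
  shows "inv_into (carrier M) f \<in> lmod_hom N M"
    "bij_betw (inv_into (carrier M) f) (carrier N) (carrier M)"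
proof -
  interpret M: left_module M by fact
  let ?g = "inv_into (carrier M) f"
  have inj: "inj_on f (carrier M)" and f: "f ` carrier M = carrier N"
    using assms by (auto simp: bij_betw_def)
  note inv = inv_into_f_f[OF inj]
  show "?g \<in> lmod_hom N M"
  proof (rule lmod_homI)
    fix x assume "x \<in> carrier N"
    then obtain u where u: "u \<in> carrier M" "x = f u" using f by blast
    then show "?g x \<in> carrier M" by (simp add: inv)
    show "?g (a \<odot>\<^bsub>N\<^esub> x) = a \<odot>\<^bsub>M\<^esub> ?g x" for a
      using u lmod_hom_smult[OF assms(1) u(1), symmetric] by (simp add: inv M.smult_closed)
  next
    fix x y assume "x \<in> carrier N" "y \<in> carrier N"
    then obtain u v where u: "u \<in> carrier M" "x = f u" "v \<in> carrier M" "y = f v" using f by blast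
    then show "?g (x \<oplus>\<^bsub>N\<^esub> y) = ?g x \<oplus>\<^bsub>M\<^esub> ?g y"
      using lmod_hom_add[OF assms(1) u(1,3), symmetric] by (simp add: inv)
  qed
  show "bij_betw ?g (carrier N) (carrier M)"
    using assms(2) by (rule bij_betw_inv_into)
qed

section \<open>Direct sums, quotients, submodules and right exact sequences\<close>

lemma left_module_sum:
  assumes "left_module M" "left_module N"
  shows "left_module (lmod_sum M N)"
proof -
  interpret M: left_module M by fact
  interpret N: left_module N by fact
  show ?thesis
  proof (intro left_module.intro left_module_axioms.intro abelian_groupI)
    fix x assume "x \<in> carrier (lmod_sum M N)"
    then show "\<exists>y\<in>carrier (lmod_sum M N). y \<oplus>\<^bsub>lmod_sum M N\<^esub> x = \<zero>\<^bsub>lmod_sum M N\<^esub>"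
      by (intro bexI[of _ "(\<ominus>\<^bsub>M\<^esub> fst x, \<ominus>\<^bsub>N\<^esub> snd x)"]) (auto simp: lmod_sum_def M.l_neg N.l_neg)
  qed (auto simp: lmod_sum_def M.a_assoc N.a_assoc M.a_comm N.a_comm M.a_lcomm N.a_lcomm
      M.smult_closed M.smult_l_distr M.smult_r_distr M.smult_assoc M.smult_one
      N.smult_closed N.smult_l_distr N.smult_r_distr N.smult_assoc N.smult_one)
qed

lemma lmod_sum_homs:
  assumes "left_module M" "left_module N"
  shows "fst \<in> lmod_hom (lmod_sum M N) M" "snd \<in> lmod_hom (lmod_sum M N) N"
    and "(\<lambda>x. (x, \<zero>\<^bsub>N\<^esub>)) \<in> lmod_hom M (lmod_sum M N)"
    and "(\<lambda>y. (\<zero>\<^bsub>M\<^esub>, y)) \<in> lmod_hom N (lmod_sum M N)"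
proof -
  interpret M: left_module M by fact
  interpret N: left_module N by fact
  show "fst \<in> lmod_hom (lmod_sum M N) M" "snd \<in> lmod_hom (lmod_sum M N) N"
    "(\<lambda>x. (x, \<zero>\<^bsub>N\<^esub>)) \<in> lmod_hom M (lmod_sum M N)"
    "(\<lambda>y. (\<zero>\<^bsub>M\<^esub>, y)) \<in> lmod_hom N (lmod_sum M N)"
    by (rule lmod_homI; auto simp: lmod_sum_def M.smult_zero_right N.smult_zero_right)+
qed

lemma lmod_quot_props:
  assumes M: "left_module M" and H: "left_submodule H M"
  shows "left_module (lmod_quot M H)"
    and "(\<lambda>x. H +>\<^bsub>M\<^esub> x) \<in> lmod_hom M (lmod_quot M H)"
    and "(\<lambda>x. H +>\<^bsub>M\<^esub> x) ` carrier M = carrier (lmod_quot M H)"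
    and "x \<in> carrier M \<Longrightarrow> H +>\<^bsub>M\<^esub> x = \<zero>\<^bsub>lmod_quot M H\<^esub> \<longleftrightarrow> x \<in> H"
proof -
  interpret M: left_module M by fact
  have sub: "subgroup H (add_monoid M)" and smultH: "\<And>a x. x \<in> H \<Longrightarrow> a \<odot>\<^bsub>M\<^esub> x \<in> H"
    using H by (auto simp: left_submodule_def)
  interpret H: abelian_subgroup H M
    using sub by (intro abelian_subgroupI3 additive_subgroupI M.abelian_group_axioms)
  let ?Q = "lmod_quot M H" and ?c = "\<lambda>x. H +>\<^bsub>M\<^esub> x"
  have carrier: "carrier ?Q = ?c ` carrier M"
    by (auto simp: lmod_quot_def A_RCOSETS_def')
  have add: "?c x \<oplus>\<^bsub>?Q\<^esub> ?c y = ?c (x \<oplus>\<^bsub>M\<^esub> y)" if "x \<in> carrier M" "y \<in> carrier M" for x y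
    using that by (simp add: lmod_quot_def H.a_rcos_sum)
  have zero: "\<zero>\<^bsub>?Q\<^esub> = ?c \<zero>\<^bsub>M\<^esub>"
    by (simp add: lmod_quot_def H.a_subset)
  have smult: "a \<odot>\<^bsub>?Q\<^esub> ?c x = ?c (a \<odot>\<^bsub>M\<^esub> x)" if x: "x \<in> carrier M" for a x
  proof -
    \<comment> \<open>The quotient multiplies a coset by a scalar through a union over the elements
      of the coset; each of them contributes the same coset.\<close>
    have "?c (a \<odot>\<^bsub>M\<^esub> y) = ?c (a \<odot>\<^bsub>M\<^esub> x)" if "y \<in> ?c x" for y
    proof -
      obtain h where h: "h \<in> H" "y = h \<oplus>\<^bsub>M\<^esub> x"
        using \<open>y \<in> ?c x\<close> by (auto simp: a_r_coset_def')
      have hM: "h \<in> carrier M" using h H.a_subset by blast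
      have "?c (a \<odot>\<^bsub>M\<^esub> y) = ?c (a \<odot>\<^bsub>M\<^esub> h) <+>\<^bsub>M\<^esub> ?c (a \<odot>\<^bsub>M\<^esub> x)"
        using h(2) hM x by (simp add: M.smult_r_distr M.smult_closed H.a_rcos_sum)
      also have "\<dots> = ?c \<zero>\<^bsub>M\<^esub> <+>\<^bsub>M\<^esub> ?c (a \<odot>\<^bsub>M\<^esub> x)"
        using M.a_coset_join2[OF _ sub smultH[OF h(1)]] hM by (simp add: M.smult_closed H.a_subset)
      also have "\<dots> = ?c (a \<odot>\<^bsub>M\<^esub> x)"
        using x by (simp only: H.a_rcos_sum M.zero_closed M.smult_closed M.l_zero)
      finally show ?thesis .
    qed
    then have "(\<Union>y\<in>?c x. ?c (a \<odot>\<^bsub>M\<^esub> y)) = (\<Union>y\<in>?c x. ?c (a \<odot>\<^bsub>M\<^esub> x))"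
      by (intro SUP_cong refl)
    also have "\<dots> = ?c (a \<odot>\<^bsub>M\<^esub> x)"
      using H.a_rcos_self[OF x] by blast
    finally show ?thesis by (simp add: lmod_quot_def)
  qed
  show "left_module ?Q"
  proof (intro left_module.intro left_module_axioms.intro abelian_groupI)
    fix X assume "X \<in> carrier ?Q"
    then obtain x where "x \<in> carrier M" "X = ?c x" by (auto simp: carrier)
    then show "\<exists>Y\<in>carrier ?Q. Y \<oplus>\<^bsub>?Q\<^esub> X = \<zero>\<^bsub>?Q\<^esub>"
      by (intro bexI[of _ "?c (\<ominus>\<^bsub>M\<^esub> x)"]) (simp_all add: carrier add zero M.l_neg)
  qed (auto simp: carrier add zero smult M.a_assoc M.a_comm M.a_lcomm
      M.smult_closed M.smult_l_distr M.smult_r_distr M.smult_assoc M.smult_one)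
  show "?c \<in> lmod_hom M ?Q"
    by (rule lmod_homI) (auto simp: carrier add smult)
  show "?c ` carrier M = carrier ?Q" by (simp add: carrier)
  show "x \<in> carrier M \<Longrightarrow> ?c x = \<zero>\<^bsub>?Q\<^esub> \<longleftrightarrow> x \<in> H"
    using M.a_coset_join1[OF _ _ sub] M.a_coset_join2[OF _ sub] by (auto simp: lmod_quot_def)
qed


lemma left_submodule_image:
  assumes "f \<in> lmod_hom P M" "left_module P" "left_module M"
  shows "left_submodule (f ` carrier P) M"
proof -
  interpret P: left_module P by fact
  interpret M: left_module M by fact
  show ?thesis
  proof (rule M.left_submoduleI)
    show "f ` carrier P \<subseteq> carrier M" using lmod_hom_closed[OF assms(1)] by blast
    show "\<zero>\<^bsub>M\<^esub> \<in> f ` carrier P"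
      using lmod_hom_zero[OF assms] by (metis P.zero_closed imageI)
  next
    fix x y assume "x \<in> f ` carrier P" "y \<in> f ` carrier P"
    then show "x \<oplus>\<^bsub>M\<^esub> y \<in> f ` carrier P"
      by (auto simp: lmod_hom_add[OF assms(1), symmetric])
  next
    fix a x assume "x \<in> f ` carrier P"
    then show "a \<odot>\<^bsub>M\<^esub> x \<in> f ` carrier P"
      by (auto simp: lmod_hom_smult[OF assms(1), symmetric] P.smult_closed)
  qed
qed

lemma left_module_submodule:
  assumes "left_module N" "left_submodule S N"
  shows "left_module (N\<lparr>carrier := S\<rparr>)"
proof -
  interpret N: left_module N by fact
  have S: "subgroup S (add_monoid N)" "\<And>a x. x \<in> S \<Longrightarrow> a \<odot>\<^bsub>N\<^esub> x \<in> S"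
    using assms(2) by (auto simp: left_submodule_def)
  interpret S: additive_subgroup S N using S(1) by (rule additive_subgroupI)
  have sub: "x \<in> carrier N" if "x \<in> S" for x using that S.a_subset by blast
  show ?thesis
  proof (intro left_module.intro left_module_axioms.intro abelian_groupI)
    fix x assume "x \<in> carrier (N\<lparr>carrier := S\<rparr>)"
    then have "x \<in> S" by simp
    then show "\<exists>y\<in>carrier (N\<lparr>carrier := S\<rparr>). y \<oplus>\<^bsub>N\<lparr>carrier := S\<rparr>\<^esub> x = \<zero>\<^bsub>N\<lparr>carrier := S\<rparr>\<^esub>"
      using S(2)[of x "- 1"]
      by (intro bexI[of _ "(- 1) \<odot>\<^bsub>N\<^esub> x"]) (simp_all add: sub N.smult_minus_one N.l_neg)
  qed (auto simp: sub S(2) N.a_assoc N.a_comm N.a_lcomm N.smult_l_distr N.smult_r_distr N.smult_assoc N.smult_one)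
qed

lemma right_exact_iff:
  "right_exact A f M g B \<longleftrightarrow> f \<in> lmod_hom A M \<and> g \<in> lmod_hom M B \<and> g ` carrier M = carrier B \<and>
     (\<forall>x\<in>carrier M. g x = \<zero>\<^bsub>B\<^esub> \<longleftrightarrow> x \<in> f ` carrier A)"
proof -
  have "f ` carrier A = a_kernel M B g \<longleftrightarrow> (\<forall>x\<in>carrier M. g x = \<zero>\<^bsub>B\<^esub> \<longleftrightarrow> x \<in> f ` carrier A)"
    if "f \<in> lmod_hom A M"
    using lmod_hom_closed[OF that] by (auto simp: a_kernel_def kernel_def)
  then show ?thesis by (auto simp: right_exact_def)
qed

text \<open>The new summand is attached to \<open>N2\<close> only and mapped identically. This is
  the source of the compatibility of the module preorder with addition.\<close>

lemma right_exact_sum_right: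
  assumes "right_exact N1 f M g N2" "left_module N1" "left_module M" "left_module N2" "left_module K"
  shows "right_exact N1 (\<lambda>x. (f x, \<zero>\<^bsub>K\<^esub>)) (lmod_sum M K) (\<lambda>z. (g (fst z), snd z)) (lmod_sum N2 K)"
proof -
  interpret K: left_module K by fact
  have f: "f \<in> lmod_hom N1 M" and g: "g \<in> lmod_hom M N2" and surj: "g ` carrier M = carrier N2"
    and ker: "\<forall>x\<in>carrier M. g x = \<zero>\<^bsub>N2\<^esub> \<longleftrightarrow> x \<in> f ` carrier N1"
    using assms(1) by (auto simp: right_exact_iff)
  have "(\<lambda>x. (f x, \<zero>\<^bsub>K\<^esub>)) \<in> lmod_hom N1 (lmod_sum M K)"
    using f by (intro lmod_homI) (auto simp: lmod_sum_def K.smult_zero_right lmod_hom_closed lmod_hom_add lmod_hom_smult)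
  moreover have "(\<lambda>z. (g (fst z), snd z)) \<in> lmod_hom (lmod_sum M K) (lmod_sum N2 K)"
    using g by (intro lmod_homI) (auto simp: lmod_sum_def lmod_hom_closed lmod_hom_add lmod_hom_smult)
  moreover have "(\<lambda>z. (g (fst z), snd z)) ` (carrier M \<times> carrier K) = carrier N2 \<times> carrier K"
    unfolding surj[symmetric] by force
  moreover have "\<forall>z\<in>carrier M \<times> carrier K.
      (g (fst z), snd z) = (\<zero>\<^bsub>N2\<^esub>, \<zero>\<^bsub>K\<^esub>) \<longleftrightarrow> z \<in> (\<lambda>x. (f x, \<zero>\<^bsub>K\<^esub>)) ` carrier N1"
    using ker by auto
  ultimately show ?thesis
    by (simp add: right_exact_iff lmod_sum_def)
qed

section \<open>Presentations by matrices\<close>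

text \<open>The generating map \<open>\<pi>\<close> is part of the data, so that elements of
  \<open>M\<close> lift to row vectors and homomorphisms become matrices.\<close>

definition presents :: "'a::ring_1 mat \<Rightarrow> ('a vec \<Rightarrow> 'm) \<Rightarrow> ('a, 'm) module \<Rightarrow> bool" where
  "presents A \<pi> M \<longleftrightarrow> left_module M \<and>
     right_exact (module_vec TYPE('a) (dim_row A)) (\<lambda>x. vec_mult_mat x A)
       (module_vec TYPE('a) (dim_col A)) \<pi> M"

lemma presents_iff:
  assumes "A \<in> carrier_mat n m"
  shows "presents (A :: 'a::ring_1 mat) \<pi> M \<longleftrightarrow> left_module M \<and> \<pi> \<in> lmod_hom (module_vec TYPE('a) m) M \<and>
    \<pi> ` carrier_vec m = carrier M \<and>
    (\<forall>x\<in>carrier_vec m. \<pi> x = \<zero>\<^bsub>M\<^esub> \<longleftrightarrow> x \<in> (\<lambda>y. vec_mult_mat y A) ` carrier_vec n)"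
  using assms vec_mult_mat_hom[OF assms]
  by (auto simp: presents_def right_exact_iff module_vec_simps)

lemma presentsD:
  assumes "presents A \<pi> M"
  shows "left_module M" "\<pi> \<in> lmod_hom (module_vec TYPE('a::ring_1) (dim_col A)) M"
    "\<pi> ` carrier_vec (dim_col A) = carrier M"
    "x \<in> carrier_vec (dim_col A) \<Longrightarrow>
      \<pi> x = \<zero>\<^bsub>M\<^esub> \<longleftrightarrow> x \<in> (\<lambda>y. vec_mult_mat y A) ` carrier_vec (dim_row A)"
  using assms presents_iff[of A "dim_row A" "dim_col A" \<pi> M] by auto

lemma presents_row:
  assumes "presents A \<pi> M" "A \<in> carrier_mat n m" "y \<in> carrier_vec n"
  shows "\<pi> (vec_mult_mat y A) = \<zero>\<^bsub>M\<^esub>"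
  using assms by (auto simp: presents_iff)

lemma vec_diff_eq_iff:
  fixes x :: "'a::ring_1 vec"
  assumes "x \<in> carrier_vec m" "z \<in> carrier_vec m" "w \<in> carrier_vec m"
  shows "x - z = w \<longleftrightarrow> x = w + z"
  using assms by (auto simp: vec_eq_iff diff_eq_eq)

lemma presents_eq_iff:
  fixes A :: "'a::ring_1 mat"
  assumes A: "presents A \<pi> M" "A \<in> carrier_mat n m" and x: "x \<in> carrier_vec m" and z: "z \<in> carrier_vec m"
  shows "\<pi> x = \<pi> z \<longleftrightarrow> (\<exists>y\<in>carrier_vec n. x = vec_mult_mat y A + z)"
proof -
  interpret M: left_module M using A by (rule_tac presentsD(1))
  have \<pi>: "\<pi> \<in> lmod_hom (module_vec TYPE('a) m) M" using A by (simp add: presents_iff)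
  have xz: "x - z \<in> carrier_vec m" using x z by simp
  have eq: "\<pi> x = \<pi> (x - z) \<oplus>\<^bsub>M\<^esub> \<pi> z"
  proof -
    have "x = x - z + z" using x z by (intro eq_vecI) auto
    then show ?thesis
      using lmod_hom_add[OF \<pi>, of "x - z" z] x z by (simp add: module_vec_simps )
  qed
  have car: "\<pi> v \<in> carrier M" if "v \<in> carrier_vec m" for v
    using lmod_hom_closed[OF \<pi>, of v] that by (simp add: module_vec_simps)
  have "\<pi> x = \<pi> z \<longleftrightarrow> \<pi> (x - z) = \<zero>\<^bsub>M\<^esub>"
    using eq car[OF x] car[OF z] car[OF xz]
    by (metis M.add.r_cancel_one)
  also have "\<dots> \<longleftrightarrow> (\<exists>y\<in>carrier_vec n. x - z = vec_mult_mat y A)"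
    using A xz by (auto simp: presents_iff)
  also have "\<dots> \<longleftrightarrow> (\<exists>y\<in>carrier_vec n. x = vec_mult_mat y A + z)"
  proof (rule bex_cong[OF refl])
    fix y :: "'a vec" assume "y \<in> carrier_vec n"
    then have "vec_mult_mat y A \<in> carrier_vec m" using A by auto
    then show "x - z = vec_mult_mat y A \<longleftrightarrow> x = vec_mult_mat y A + z"
      using x z by (intro vec_diff_eq_iff)
  qed
  finally show ?thesis .
qed

text \<open>Both generating maps have the row module of \<open>A\<close> as kernel. The element
  types of \<open>M\<close> and \<open>N\<close> are independent, so a presentation can carry a
  module over to another type.\<close>

lemma presents_factor_iso:
  assumes A: "presents A \<pi> M" and B: "presents A \<rho> N"
  obtains k where "k \<in> lmod_hom M N" "bij_betw k (carrier M) (carrier N)"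
proof -
  obtain n m where c: "A \<in> carrier_mat n m" by blast
  note A' = A[unfolded presents_iff[OF c]] and B' = B[unfolded presents_iff[OF c]]
  obtain k where k: "k \<in> lmod_hom M N" "\<And>x. x \<in> carrier_vec m \<Longrightarrow> k (\<pi> x) = \<rho> x"
  proof (rule lmod_hom_factor[OF left_module_vec, of M N \<pi> m \<rho>])
    show "\<And>x. x \<in> carrier (module_vec TYPE('a) m) \<Longrightarrow> \<pi> x = \<zero>\<^bsub>M\<^esub> \<Longrightarrow> \<rho> x = \<zero>\<^bsub>N\<^esub>"
      using A' B' by (simp add: module_vec_simps)
  qed (use A' B' that in \<open>auto simp: module_vec_simps\<close>)
  have "inj_on k (carrier M)"
  proof (rule inj_onI)
    fix u v assume "u \<in> carrier M" "v \<in> carrier M" and eq: "k u = k v"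
    then obtain x y where "x \<in> carrier_vec m" "y \<in> carrier_vec m" "u = \<pi> x" "v = \<pi> y"
      using A' by (metis imageE)
    then show "u = v"
      using eq by (simp add: k(2) presents_eq_iff[OF A c] presents_eq_iff[OF B c])
  qed
  moreover have "k ` carrier M = carrier N"
  proof -
    have "k ` \<pi> ` carrier_vec m = \<rho> ` carrier_vec m"
      unfolding image_image using k(2) by (intro image_cong refl)
    then show ?thesis using A' B' by simp
  qed
  ultimately show ?thesis using k(1) that by (simp add: bij_betw_def)
qed

lemma presents_isomorphic:
  assumes "presents A \<pi> M" "presents A \<rho> N"
  shows "lmod_isomorphic M N"
  using presents_factor_iso[OF assms] unfolding lmod_isomorphic_def by blast

lemma presents_transport:
  assumes A: "presents A \<pi> M" and k: "k \<in> lmod_hom M N" "bij_betw k (carrier M) (carrier N)"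
    and N: "left_module N"
  shows "presents A (k \<circ> \<pi>) N"
proof -
  obtain n m where c: "A \<in> carrier_mat n m" by blast
  note A' = A[unfolded presents_iff[OF c]]
  interpret M: left_module M using A' by blast
  have "k (\<pi> x) = \<zero>\<^bsub>N\<^esub> \<longleftrightarrow> \<pi> x = \<zero>\<^bsub>M\<^esub>" if "x \<in> carrier_vec m" for x
  proof -
    have "\<pi> x \<in> carrier M" using A' that by blast
    then show ?thesis
      using lmod_hom_zero[OF k(1) M.left_module_axioms N] k(2) M.zero_closed
      by (metis bij_betw_imp_inj_on inj_on_eq_iff)
  qed
  moreover have "(k \<circ> \<pi>) ` carrier_vec m = carrier N"
    using A' k(2) by (simp only: image_comp[symmetric]) (simp add: bij_betw_def)
  moreover have "k \<circ> \<pi> \<in> lmod_hom (module_vec TYPE('a) m) N"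
    using A' k by (auto intro: lmod_hom_comp)
  ultimately show ?thesis using A' N by (simp add: presents_iff[OF c])
qed

lemma presents_cong:
  assumes "presents A \<pi> M" "lmod_isomorphic M N" "left_module N"
  shows "\<exists>\<rho>. presents A \<rho> N"
  using assms presents_transport unfolding lmod_isomorphic_def by blast

lemma fin_presented_iff: "fin_presented (M :: ('a::ring_1, 'm) module) \<longleftrightarrow> (\<exists>A \<pi>. presents A \<pi> M)"
proof
  assume "fin_presented M"
  then obtain n m f g where M: "left_module M"
    and ex: "right_exact (module_vec TYPE('a) n) f (module_vec TYPE('a) m) g M"
    by (auto simp: fin_presented_def)
  then have f: "f \<in> lmod_hom (module_vec TYPE('a) n) (module_vec TYPE('a) m)"
    by (simp add: right_exact_def)
  \<comment> \<open>Lifting \<open>f\<close> along the identity writes it as multiplication by a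
    matrix.\<close>
  obtain A where A: "A \<in> carrier_mat n m" "\<And>x. x \<in> carrier_vec n \<Longrightarrow> id (vec_mult_mat x A) = f x"
    using lmod_hom_lift[OF left_module_vec lmod_hom_id f] lmod_hom_closed[OF f]
    by (auto simp: module_vec_simps)
  have "(\<lambda>y. vec_mult_mat y A) ` carrier_vec n = f ` carrier_vec n"
    using A(2) by (intro image_cong) auto
  then have "presents A g M"
    using M ex by (simp add: presents_iff[OF A(1)] right_exact_iff module_vec_simps)
  then show "\<exists>A \<pi>. presents A \<pi> M" by blast
qed (auto simp: fin_presented_def presents_def)

lemma presents_fin_presented: "presents A \<pi> M \<Longrightarrow> fin_presented M"
  unfolding fin_presented_iff by blast

lemma presents_coker:
  assumes A: "A \<in> carrier_mat n m"
  shows "\<exists>\<pi>. presents A \<pi> (coker n m A)"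
proof -
  let ?H = "(\<lambda>x. vec_mult_mat x A) ` carrier_vec n"
  have "left_submodule ?H (module_vec TYPE('a) m)"
    using left_submodule_image[OF vec_mult_mat_hom[OF A] left_module_vec left_module_vec]
    by (simp add: module_vec_simps)
  note q = lmod_quot_props[OF left_module_vec this]
  show ?thesis
    unfolding presents_iff[OF A] coker_def
    using q by (intro exI[of _ "\<lambda>x. ?H +>\<^bsub>module_vec TYPE('a) m\<^esub> x"]) (simp add: module_vec_simps)
qed

section \<open>Presentations of cokernels, free modules and direct sums\<close>

abbreviation cokernel :: "'a::ring_1 mat \<Rightarrow> ('a, 'a vec set) module" where
  "cokernel A \<equiv> coker (dim_row A) (dim_col A) A"

lemma presents_cokernel: "\<exists>\<pi>. presents A \<pi> (cokernel A)"
  by (rule presents_coker) simp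

lemma presents_vec: "presents (0\<^sub>m 0 m) id (module_vec TYPE('a::ring_1) m)"
proof -
  have "(\<lambda>y. vec_mult_mat y (0\<^sub>m 0 m :: 'a mat)) ` carrier_vec 0 = {0\<^sub>v m}"
    using vec_mult_mat_zero_right[of _ 0 m] by force
  then show ?thesis
    by (simp add: presents_iff[of _ 0 m] left_module_vec lmod_hom_id module_vec_simps)
qed

lemma presents_regular: "presents (0\<^sub>m 0 1) (\<lambda>x. x $ 0) (regular_lmod TYPE('a::ring_1))"
proof -
  have "left_module (regular_lmod TYPE('a))"
  proof (intro left_module.intro left_module_axioms.intro abelian_groupI)
    fix x :: 'a
    show "\<exists>y\<in>carrier (regular_lmod TYPE('a)). y \<oplus>\<^bsub>regular_lmod TYPE('a)\<^esub> x = \<zero>\<^bsub>regular_lmod TYPE('a)\<^esub>"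
      by (intro bexI[of _ "- x"]) (auto simp: regular_lmod_def)
  qed (auto simp: regular_lmod_def algebra_simps)
  moreover have "(\<lambda>x. x $ 0) \<in> lmod_hom (module_vec TYPE('a) 1) (regular_lmod TYPE('a))"
    by (rule lmod_homI) (auto simp: module_vec_simps regular_lmod_def)
  moreover have "bij_betw (\<lambda>x. x $ 0) (carrier (module_vec TYPE('a) 1)) (carrier (regular_lmod TYPE('a)))"
    by (rule bij_betw_byWitness[where f' = "\<lambda>a. vec 1 (\<lambda>_. a)"])
      (auto simp: module_vec_simps regular_lmod_def intro!: eq_vecI)
  ultimately show ?thesis
    using presents_transport[OF presents_vec[of 1], of "\<lambda>x. x $ 0" "regular_lmod TYPE('a)"]
    by (simp add: comp_def)
qed

lemma presents_sum:
  fixes A B :: "'a::ring_1 mat"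
  assumes A: "presents A \<pi> M" and B: "presents B \<rho> N"
  shows "presents (diag_mat2 A B) (\<lambda>x. (\<pi> (vec_first x (dim_col A)), \<rho> (vec_last x (dim_col B)))) (lmod_sum M N)"
proof -
  obtain n m where cA: "A \<in> carrier_mat n m" by blast
  obtain n' m' where cB: "B \<in> carrier_mat n' m'" by blast
  note A' = A[unfolded presents_iff[OF cA]] and B' = B[unfolded presents_iff[OF cB]]
  have d: "dim_col A = m" "dim_col B = m'" using cA cB by auto
  let ?p = "\<lambda>x. (\<pi> (vec_first x m), \<rho> (vec_last x m'))"
  have p: "?p (y @\<^sub>v z) = (\<pi> y, \<rho> z)" if "y \<in> carrier_vec m" "z \<in> carrier_vec m'" for y z
    using that by (simp add: vec_first_append vec_last_append)
  have closed: "\<pi> y \<in> carrier M" if "y \<in> carrier_vec m" for y using A' that by blast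
  have closed': "\<rho> z \<in> carrier N" if "z \<in> carrier_vec m'" for z using B' that by blast
  have "?p \<in> lmod_hom (module_vec TYPE('a) (m + m')) (lmod_sum M N)"
  proof (rule lmod_homI)
    fix x assume "x \<in> carrier (module_vec TYPE('a) (m + m'))"
    then obtain y z where x: "x = y @\<^sub>v z" "y \<in> carrier_vec m" "z \<in> carrier_vec m'"
      by (auto simp: module_vec_simps elim: vec_append_cases)
    then show "?p x \<in> carrier (lmod_sum M N)"
      by (simp add: p lmod_sum_def closed closed')
    show "?p (a \<odot>\<^bsub>module_vec TYPE('a) (m + m')\<^esub> x) = a \<odot>\<^bsub>lmod_sum M N\<^esub> ?p x" for a
      using x lmod_hom_smult[of \<pi> "module_vec TYPE('a) m" M y a] lmod_hom_smult[of \<rho> "module_vec TYPE('a) m'" N z a] A' B'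
      by (simp add: module_vec_simps append_vec_smult p lmod_sum_def del: vec_first_last_append)
  next
    fix x x' assume "x \<in> carrier (module_vec TYPE('a) (m + m'))" "x' \<in> carrier (module_vec TYPE('a) (m + m'))"
    then obtain y z y' z' where x: "x = y @\<^sub>v z" "y \<in> carrier_vec m" "z \<in> carrier_vec m'"
      "x' = y' @\<^sub>v z'" "y' \<in> carrier_vec m" "z' \<in> carrier_vec m'"
      by (auto simp: module_vec_simps elim!: vec_append_cases)
    then show "?p (x \<oplus>\<^bsub>module_vec TYPE('a) (m + m')\<^esub> x') = ?p x \<oplus>\<^bsub>lmod_sum M N\<^esub> ?p x'"
      using lmod_hom_add[of \<pi> "module_vec TYPE('a) m" M y y'] lmod_hom_add[of \<rho> "module_vec TYPE('a) m'" N z z'] A' B'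
      by (simp add: module_vec_simps append_vec_add p lmod_sum_def)
  qed
  moreover have "?p ` carrier_vec (m + m') = carrier (lmod_sum M N)"
  proof (intro equalityI subsetI)
    fix w assume "w \<in> carrier (lmod_sum M N)"
    then have "fst w \<in> \<pi> ` carrier_vec m" "snd w \<in> \<rho> ` carrier_vec m'"
      using A' B' by (auto simp: lmod_sum_def)
    then obtain y z where yz: "y \<in> carrier_vec m" "z \<in> carrier_vec m'" "w = (\<pi> y, \<rho> z)"
      by (metis imageE prod.collapse)
    then show "w \<in> ?p ` carrier_vec (m + m')"
      by (intro image_eqI[of _ _ "y @\<^sub>v z"]) (simp_all add: p)
  qed (auto simp: lmod_sum_def closed closed')
  moreover have "?p x = \<zero>\<^bsub>lmod_sum M N\<^esub> \<longleftrightarrow> x \<in> (\<lambda>y. vec_mult_mat y (diag_mat2 A B)) ` carrier_vec (n + n')"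
    if x_in: "x \<in> carrier_vec (m + m')" for x
  proof -
    obtain y z where x: "x = y @\<^sub>v z" "y \<in> carrier_vec m" "z \<in> carrier_vec m'"
      using x_in by (rule vec_append_cases)
    have *: "vec_mult_mat (u @\<^sub>v v) (diag_mat2 A B) = vec_mult_mat u A @\<^sub>v vec_mult_mat v B"
      if "u \<in> carrier_vec n" "v \<in> carrier_vec n'" for u v
      using that cA cB
      by (simp add: diag_mat2_four_block[OF cA cB] vec_mult_mat_append[of _ n _ n' _ m _ m'] vec_mult_mat_zero_right
          vec_mult_mat_carrier[THEN right_zero_vec] vec_mult_mat_carrier[THEN left_zero_vec])
    have "?p x = \<zero>\<^bsub>lmod_sum M N\<^esub> \<longleftrightarrow> (\<exists>u\<in>carrier_vec n. \<exists>v\<in>carrier_vec n'. y = vec_mult_mat u A \<and> z = vec_mult_mat v B)"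
      using A' B' x by (auto simp: p lmod_sum_def)
    also have "\<dots> \<longleftrightarrow> (\<exists>u\<in>carrier_vec n. \<exists>v\<in>carrier_vec n'. x = vec_mult_mat (u @\<^sub>v v) (diag_mat2 A B))"
    proof (intro bex_cong refl)
      fix u v :: "'a vec" assume uv: "u \<in> carrier_vec n" "v \<in> carrier_vec n'"
      show "y = vec_mult_mat u A \<and> z = vec_mult_mat v B \<longleftrightarrow> x = vec_mult_mat (u @\<^sub>v v) (diag_mat2 A B)"
        unfolding *[OF uv] x(1) using append_vec_eq[of y m "vec_mult_mat u A"] x cA by auto
    qed
    also have "\<dots> \<longleftrightarrow> x \<in> (\<lambda>y. vec_mult_mat y (diag_mat2 A B)) ` carrier_vec (n + n')"
      by (auto intro!: imageI elim!: vec_append_cases)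
    finally show ?thesis .
  qed
  ultimately show ?thesis
    unfolding presents_iff[OF diag_mat2_carrier[OF cA cB]] d
    using A' B' by (simp add: left_module_sum)
qed


lemma carrier_vec_0: "carrier_vec 0 = {0\<^sub>v 0}"
  by auto

section \<open>The finitely presented module Malcolmson semigroup\<close>

text \<open>\<open>lmod_below1\<close> demands an internal decomposition. It is given by the images
  of the two summands under \<open>j\<close>; the exact sequence is adapted by inverting the
  embedding of \<open>N1\<close> and by applying the embedding of \<open>N2\<close>.\<close>

lemma lmod_below1_iso:
  fixes N1 :: "('a::ring_1, 'k) module" and N2 :: "('a, 'l) module" and N :: "('a, 'n) module"
  assumes ex: "right_exact N1 f M g N2" and N12: "left_module N1" "left_module N2" and N: "left_module N"
    and j: "j \<in> lmod_hom (lmod_sum N1 N2) N" "bij_betw j (carrier (lmod_sum N1 N2)) (carrier N)"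
  shows "lmod_below1 M N"
proof -
  interpret N1: left_module N1 by fact
  interpret N2: left_module N2 by fact
  interpret N: left_module N by fact
  have f: "f \<in> lmod_hom N1 M" and g: "g \<in> lmod_hom M N2" and surj: "g ` carrier M = carrier N2"
    and ker: "\<forall>x\<in>carrier M. g x = \<zero>\<^bsub>N2\<^esub> \<longleftrightarrow> x \<in> f ` carrier N1"
    using ex by (auto simp: right_exact_iff)
  have sum_carrier: "carrier (lmod_sum N1 N2) = carrier N1 \<times> carrier N2" by (simp add: lmod_sum_def)
  have inj: "j (x, y) = j (x', y') \<longleftrightarrow> x = x' \<and> y = y'"
    if "x \<in> carrier N1" "y \<in> carrier N2" "x' \<in> carrier N1" "y' \<in> carrier N2" for x y x' y'
    using j(2) that inj_on_eq_iff[of j "carrier N1 \<times> carrier N2" "(x, y)" "(x', y')"]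
    by (auto simp: bij_betw_def sum_carrier)
  define i1 where "i1 x = j (x, \<zero>\<^bsub>N2\<^esub>)" for x
  define i2 where "i2 y = j (\<zero>\<^bsub>N1\<^esub>, y)" for y
  have i1: "i1 \<in> lmod_hom N1 N"
    using lmod_hom_comp[OF lmod_sum_homs(3)[OF N12] j(1)] by (simp add: i1_def[abs_def] comp_def)
  have i2: "i2 \<in> lmod_hom N2 N"
    using lmod_hom_comp[OF lmod_sum_homs(4)[OF N12] j(1)] by (simp add: i2_def[abs_def] comp_def)
  let ?S1 = "i1 ` carrier N1" and ?S2 = "i2 ` carrier N2"
  have sub: "left_submodule ?S1 N" "left_submodule ?S2 N"
    using left_submodule_image i1 i2 N12 N by blast+
  have zero: "j (\<zero>\<^bsub>N1\<^esub>, \<zero>\<^bsub>N2\<^esub>) = \<zero>\<^bsub>N\<^esub>"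
    using lmod_hom_zero[OF j(1) left_module_sum[OF N12] N] by (simp add: lmod_sum_def)
  have "?S1 \<inter> ?S2 = {\<zero>\<^bsub>N\<^esub>}"
  proof (intro equalityI subsetI)
    fix z assume "z \<in> ?S1 \<inter> ?S2"
    then obtain x y where "x \<in> carrier N1" "y \<in> carrier N2" "z = j (x, \<zero>\<^bsub>N2\<^esub>)" "z = j (\<zero>\<^bsub>N1\<^esub>, y)"
      by (auto simp: i1_def i2_def)
    then show "z \<in> {\<zero>\<^bsub>N\<^esub>}" using inj zero by auto
  next
    fix z assume "z \<in> {\<zero>\<^bsub>N\<^esub>}"
    then show "z \<in> ?S1 \<inter> ?S2"
      using zero by (auto simp: i1_def i2_def intro!: image_eqI[of _ _ "\<zero>\<^bsub>N1\<^esub>"] image_eqI[of _ _ "\<zero>\<^bsub>N2\<^esub>"])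
  qed
  moreover have "?S1 <+>\<^bsub>N\<^esub> ?S2 = carrier N"
  proof -
    have split: "i1 x \<oplus>\<^bsub>N\<^esub> i2 y = j (x, y)" if "x \<in> carrier N1" "y \<in> carrier N2" for x y
      using that lmod_hom_add[OF j(1), of "(x, \<zero>\<^bsub>N2\<^esub>)" "(\<zero>\<^bsub>N1\<^esub>, y)"]
      by (simp add: i1_def i2_def lmod_sum_def)
    have "?S1 <+>\<^bsub>N\<^esub> ?S2 = (\<lambda>z. i1 (fst z) \<oplus>\<^bsub>N\<^esub> i2 (snd z)) ` (carrier N1 \<times> carrier N2)"
      unfolding set_add_def' by force
    also have "\<dots> = j ` (carrier N1 \<times> carrier N2)"
      using split by (intro image_cong) auto
    finally show ?thesis using j(2) by (simp add: bij_betw_def sum_carrier)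
  qed
  moreover have "right_exact (N\<lparr>carrier := ?S1\<rparr>) (f \<circ> inv_into (carrier N1) i1) M (i2 \<circ> g) (N\<lparr>carrier := ?S2\<rparr>)"
  proof -
    have inj1: "inj_on i1 (carrier N1)"
      by (rule inj_onI) (simp add: i1_def inj)
    have "i1 \<in> lmod_hom N1 (N\<lparr>carrier := ?S1\<rparr>)"
      using i1 by (auto simp: lmod_hom_def hom_def)
    moreover have bij: "bij_betw i1 (carrier N1) (carrier (N\<lparr>carrier := ?S1\<rparr>))"
      using inj1 by (simp add: bij_betw_def)
    ultimately have inv: "inv_into (carrier N1) i1 \<in> lmod_hom (N\<lparr>carrier := ?S1\<rparr>) N1"
      "bij_betw (inv_into (carrier N1) i1) (carrier (N\<lparr>carrier := ?S1\<rparr>)) (carrier N1)"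
      using lmod_iso_inv N12(1) by blast+
    have img: "(f \<circ> inv_into (carrier N1) i1) ` ?S1 = f ` carrier N1"
      unfolding image_comp[symmetric] using inv(2) by (simp add: bij_betw_def)
    have i2': "i2 \<in> lmod_hom N2 (N\<lparr>carrier := ?S2\<rparr>)"
      using i2 by (auto simp: lmod_hom_def hom_def)
    have "(i2 \<circ> g) ` carrier M = ?S2"
      unfolding image_comp[symmetric] surj ..
    moreover have "(i2 \<circ> g) x = \<zero>\<^bsub>N\<^esub> \<longleftrightarrow> g x = \<zero>\<^bsub>N2\<^esub>" if "x \<in> carrier M" for x
      using lmod_hom_closed[OF g that] inj by (simp add: i2_def zero[symmetric])
    ultimately show ?thesis
      unfolding right_exact_iff using lmod_hom_comp[OF inv(1) f] lmod_hom_comp[OF g i2'] ker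
      by (simp add: img[unfolded o_def])
  qed
  ultimately show ?thesis
    unfolding lmod_below1_def using sub by blast
qed

lemma right_exact_iso:
  assumes "right_exact N1 f M g N2" "k \<in> lmod_hom M M'" "bij_betw k (carrier M) (carrier M')"
    "left_module M"
  shows "right_exact N1 (k \<circ> f) M' (g \<circ> inv_into (carrier M) k) N2"
proof -
  have f: "f \<in> lmod_hom N1 M" and g: "g \<in> lmod_hom M N2" and surj: "g ` carrier M = carrier N2"
    and ker: "\<forall>x\<in>carrier M. g x = \<zero>\<^bsub>N2\<^esub> \<longleftrightarrow> x \<in> f ` carrier N1"
    using assms by (auto simp: right_exact_iff)
  note inv = lmod_iso_inv[OF assms(2-4)]
  let ?i = "inv_into (carrier M) k"
  have i: "?i x \<in> carrier M" "k (?i x) = x" if "x \<in> carrier M'" for x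
    using that assms(3) inv(2) by (auto simp: bij_betw_def f_inv_into_f)
  have ik: "?i (k x) = x" if "x \<in> carrier M" for x
    using that assms(3) by (simp add: bij_betw_def inv_into_f_f)
  have "(g \<circ> ?i) ` carrier M' = carrier N2"
    unfolding image_comp[symmetric] using inv(2) surj by (simp add: bij_betw_def)
  moreover have "(g \<circ> ?i) x = \<zero>\<^bsub>N2\<^esub> \<longleftrightarrow> x \<in> (k \<circ> f) ` carrier N1" if x: "x \<in> carrier M'" for x
  proof -
    have "(g \<circ> ?i) x = \<zero>\<^bsub>N2\<^esub> \<longleftrightarrow> ?i x \<in> f ` carrier N1" using ker i[OF x] by simp
    also have "\<dots> \<longleftrightarrow> x \<in> (k \<circ> f) ` carrier N1"
      using i[OF x] ik lmod_hom_closed[OF f] by (auto simp: image_iff)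
    finally show ?thesis .
  qed
  ultimately show ?thesis
    unfolding right_exact_iff using lmod_hom_comp[OF f assms(2)] lmod_hom_comp[OF inv(1) g] by blast
qed

text \<open>The exact sequence may live in modules of any element types: matching presentation
  matrices carry it over to \<open>M'\<close> and \<open>N'\<close>.\<close>

lemma lmod_below1I:
  assumes M: "presents A \<pi> M" "presents A \<pi>' M'" and N: "presents D \<sigma> (lmod_sum N1 N2)" "presents D \<sigma>' N'"
    and ex: "right_exact N1 f M g N2" and N12: "left_module N1" "left_module N2"
  shows "lmod_below1 M' N'"
proof -
  obtain k where k: "k \<in> lmod_hom M M'" "bij_betw k (carrier M) (carrier M')"
    using presents_factor_iso[OF M] .
  obtain j where j: "j \<in> lmod_hom (lmod_sum N1 N2) N'" "bij_betw j (carrier (lmod_sum N1 N2)) (carrier N')"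
    using presents_factor_iso[OF N] .
  show ?thesis
    using lmod_below1_iso[OF right_exact_iso[OF ex k] N12 _ j] presentsD(1)[OF M(1)] presentsD(1)[OF N(2)] by blast
qed

text \<open>The kernel of \<open>p\<close> is generated by \<open>q\<close> elements. Their lifts
  \<open>P\<close> along \<open>\<rho>\<close> are appended to the relations \<open>B\<close>, while
  the generators remain the same.\<close>

lemma presents_quotient:
  fixes B :: "'a::ring_1 mat"
  assumes B: "presents B \<rho> N" and K: "left_module K" and p: "p \<in> lmod_hom N K" "p ` carrier N = carrier K"
    and e: "e \<in> lmod_hom (module_vec TYPE('a) q) N"
    and ker: "\<And>z. z \<in> carrier N \<Longrightarrow> p z = \<zero>\<^bsub>K\<^esub> \<longleftrightarrow> z \<in> e ` carrier_vec q"
  shows "\<exists>C. presents C (p \<circ> \<rho>) K"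
proof -
  obtain n m where c: "B \<in> carrier_mat n m" by blast
  note B' = B[unfolded presents_iff[OF c]]
  have rN: "\<rho> x \<in> carrier N" if "x \<in> carrier_vec m" for x using B' that by blast
  obtain P where P: "P \<in> carrier_mat q m" "\<And>x. x \<in> carrier_vec q \<Longrightarrow> \<rho> (vec_mult_mat x P) = e x"
    using lmod_hom_lift[of N \<rho> m e q] B' e lmod_hom_closed[OF e] by (auto simp: module_vec_simps)
  define C where "C = B @\<^sub>r P"
  have C: "C \<in> carrier_mat (n + q) m" using c P by (simp add: C_def)
  have mult: "vec_mult_mat (y @\<^sub>v z) C = vec_mult_mat y B + vec_mult_mat z P"
    if "y \<in> carrier_vec n" "z \<in> carrier_vec q" for y z
    unfolding C_def by (rule vec_mult_mat_append_rows[OF that c P(1)])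
  have "(p \<circ> \<rho>) x = \<zero>\<^bsub>K\<^esub> \<longleftrightarrow> x \<in> (\<lambda>y. vec_mult_mat y C) ` carrier_vec (n + q)" if x: "x \<in> carrier_vec m" for x
  proof -
    have "(p \<circ> \<rho>) x = \<zero>\<^bsub>K\<^esub> \<longleftrightarrow> (\<exists>z\<in>carrier_vec q. \<rho> x = \<rho> (vec_mult_mat z P))"
      using ker[OF rN[OF x]] P(2) by auto
    also have "\<dots> \<longleftrightarrow> (\<exists>z\<in>carrier_vec q. \<exists>y\<in>carrier_vec n. x = vec_mult_mat y B + vec_mult_mat z P)"
      using presents_eq_iff[OF B c x] P(1) by auto
    also have "\<dots> \<longleftrightarrow> x \<in> (\<lambda>y. vec_mult_mat y C) ` carrier_vec (n + q)"
    proof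
      assume "\<exists>z\<in>carrier_vec q. \<exists>y\<in>carrier_vec n. x = vec_mult_mat y B + vec_mult_mat z P"
      then obtain y z where "z \<in> carrier_vec q" "y \<in> carrier_vec n" "x = vec_mult_mat y B + vec_mult_mat z P"
        by blast
      then show "x \<in> (\<lambda>y. vec_mult_mat y C) ` carrier_vec (n + q)"
        by (intro image_eqI[of _ _ "y @\<^sub>v z"]) (simp_all add: mult)
    next
      assume "x \<in> (\<lambda>y. vec_mult_mat y C) ` carrier_vec (n + q)"
      then obtain w where "w \<in> carrier_vec (n + q)" "x = vec_mult_mat w C" by blast
      then show "\<exists>z\<in>carrier_vec q. \<exists>y\<in>carrier_vec n. x = vec_mult_mat y B + vec_mult_mat z P"
        by (elim vec_append_cases) (auto simp: mult)
    qed
    finally show ?thesis .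
  qed
  moreover have "(p \<circ> \<rho>) ` carrier_vec m = carrier K"
    unfolding image_comp[symmetric] using B' p(2) by simp
  moreover have "p \<circ> \<rho> \<in> lmod_hom (module_vec TYPE('a) m) K"
    using B' p(1) by (auto intro: lmod_hom_comp)
  ultimately show ?thesis
    using K by (intro exI[of _ C]) (simp add: presents_iff[OF C])
qed

text \<open>A direct summand is the quotient by the other summand, and the latter is finitely
  generated, being a quotient of the whole sum.\<close>

lemma presents_sumD:
  fixes B :: "'a::ring_1 mat"
  assumes B: "presents B \<sigma> (lmod_sum N1 N2)" and N12: "left_module N1" "left_module N2"
  shows "\<exists>C \<pi>. presents C \<pi> N1" "\<exists>C \<pi>. presents C \<pi> N2"
proof -
  interpret N1: left_module N1 by fact
  interpret N2: left_module N2 by fact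
  let ?m = "dim_col B"
  have \<sigma>: "\<sigma> \<in> lmod_hom (module_vec TYPE('a) ?m) (lmod_sum N1 N2)"
    and surj: "\<sigma> ` carrier_vec ?m = carrier N1 \<times> carrier N2"
    using presentsD[OF B] by (simp_all add: lmod_sum_def)
  note fst = lmod_sum_homs(1)[OF N12] and snd = lmod_sum_homs(2)[OF N12]
    and in1 = lmod_sum_homs(3)[OF N12] and in2 = lmod_sum_homs(4)[OF N12]
  have fst_img: "fst ` (carrier N1 \<times> carrier N2) = carrier N1" and snd_img: "snd ` (carrier N1 \<times> carrier N2) = carrier N2"
    by force+
  have "((\<lambda>y. (\<zero>\<^bsub>N1\<^esub>, y)) \<circ> (snd \<circ> \<sigma>)) ` carrier_vec ?m = (\<lambda>y. (\<zero>\<^bsub>N1\<^esub>, y)) ` carrier N2"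
    unfolding image_comp[symmetric] surj snd_img ..
  then have "\<exists>C. presents C (fst \<circ> \<sigma>) N1"
    using fst_img
    by (intro presents_quotient[OF B N12(1) fst _ lmod_hom_comp[OF lmod_hom_comp[OF \<sigma> snd] in2]])
      (auto simp: lmod_sum_def)
  then show "\<exists>C \<pi>. presents C \<pi> N1" by blast
  have "((\<lambda>x. (x, \<zero>\<^bsub>N2\<^esub>)) \<circ> (fst \<circ> \<sigma>)) ` carrier_vec ?m = (\<lambda>x. (x, \<zero>\<^bsub>N2\<^esub>)) ` carrier N1"
    unfolding image_comp[symmetric] surj fst_img ..
  then have "\<exists>C. presents C (snd \<circ> \<sigma>) N2"
    using snd_img
    by (intro presents_quotient[OF B N12(2) snd _ lmod_hom_comp[OF lmod_hom_comp[OF \<sigma> fst] in1]])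
      (auto simp: lmod_sum_def)
  then show "\<exists>C \<pi>. presents C \<pi> N2" by blast
qed

text \<open>The converse of \<open>lmod_below1_iso\<close>. Addition maps the external sum of the
  two submodules isomorphically onto \<open>N\<close>, because they span \<open>N\<close> and meet
  in zero; hence \<open>B\<close> presents the external sum, and \<open>presents_sumD\<close>
  presents its summands.\<close>

lemma lmod_below1E:
  fixes N :: "('a::ring_1, 'n) module"
  assumes below: "lmod_below1 M N" and B: "presents B \<rho> N"
  obtains N1 N2 :: "('a, 'n) module" and f g C1 C2 \<pi>1 \<pi>2 \<sigma> where
    "right_exact N1 f M g N2" "presents C1 \<pi>1 N1" "presents C2 \<pi>2 N2" "presents B \<sigma> (lmod_sum N1 N2)"
proof -
  interpret N: left_module N using presentsD(1)[OF B] .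
  obtain S1 S2 f g where S: "left_submodule S1 N" "left_submodule S2 N" "S1 \<inter> S2 = {\<zero>\<^bsub>N\<^esub>}"
      "S1 <+>\<^bsub>N\<^esub> S2 = carrier N"
    and ex: "right_exact (N\<lparr>carrier := S1\<rparr>) f M g (N\<lparr>carrier := S2\<rparr>)"
    using below unfolding lmod_below1_def by blast
  let ?N1 = "N\<lparr>carrier := S1\<rparr>" and ?N2 = "N\<lparr>carrier := S2\<rparr>"
  have lm: "left_module ?N1" "left_module ?N2"
    using left_module_submodule[OF N.left_module_axioms] S by blast+
  interpret S1: additive_subgroup S1 N using S by (auto simp: left_submodule_def intro: additive_subgroupI)
  interpret S2: additive_subgroup S2 N using S by (auto simp: left_submodule_def intro: additive_subgroupI)
  have sub: "x \<in> carrier N" if "x \<in> S1 \<or> x \<in> S2" for x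
    using that S1.a_subset S2.a_subset by blast
  define j where "j z = fst z \<oplus>\<^bsub>N\<^esub> snd z" for z
  have j: "j \<in> lmod_hom (lmod_sum ?N1 ?N2) N"
    by (rule lmod_homI) (auto simp: j_def lmod_sum_def sub N.smult_r_distr N.a_ac)
  have img: "j ` (S1 \<times> S2) = carrier N"
  proof -
    have "S1 <+>\<^bsub>N\<^esub> S2 = (\<Union>x\<in>S1. \<Union>y\<in>S2. {j (x, y)})"
      by (simp add: set_add_def' j_def)
    also have "\<dots> = j ` (S1 \<times> S2)" by auto
    finally show ?thesis using S(4) by simp
  qed
  have "inj_on j (S1 \<times> S2)"
  proof (rule inj_onI, clarify)
    fix x y x' y' assume c: "x \<in> S1" "y \<in> S2" "x' \<in> S1" "y' \<in> S2" and "j (x, y) = j (x', y')"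
    then have eq: "x \<oplus>\<^bsub>N\<^esub> y = x' \<oplus>\<^bsub>N\<^esub> y'" by (simp add: j_def)
    have car: "x \<in> carrier N" "y \<in> carrier N" "x' \<in> carrier N" "y' \<in> carrier N" using c sub by blast+
    have "x \<oplus>\<^bsub>N\<^esub> \<ominus>\<^bsub>N\<^esub> x' = (x \<oplus>\<^bsub>N\<^esub> y) \<oplus>\<^bsub>N\<^esub> (\<ominus>\<^bsub>N\<^esub> y \<oplus>\<^bsub>N\<^esub> \<ominus>\<^bsub>N\<^esub> x')"
      using car by (simp add: N.a_assoc N.r_neg1 N.r_neg2)
    also have "\<dots> = y' \<oplus>\<^bsub>N\<^esub> \<ominus>\<^bsub>N\<^esub> y"
    proof -
      have "(x' \<oplus>\<^bsub>N\<^esub> y') \<oplus>\<^bsub>N\<^esub> (\<ominus>\<^bsub>N\<^esub> y \<oplus>\<^bsub>N\<^esub> \<ominus>\<^bsub>N\<^esub> x') = (x' \<oplus>\<^bsub>N\<^esub> \<ominus>\<^bsub>N\<^esub> x') \<oplus>\<^bsub>N\<^esub> (y' \<oplus>\<^bsub>N\<^esub> \<ominus>\<^bsub>N\<^esub> y)"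
        using car by (simp add: N.a_ac)
      then show ?thesis unfolding eq using car by (simp add: N.r_neg)
    qed
    finally have diff: "x \<oplus>\<^bsub>N\<^esub> \<ominus>\<^bsub>N\<^esub> x' = y' \<oplus>\<^bsub>N\<^esub> \<ominus>\<^bsub>N\<^esub> y" .
    moreover have "x \<oplus>\<^bsub>N\<^esub> \<ominus>\<^bsub>N\<^esub> x' \<in> S1" "y' \<oplus>\<^bsub>N\<^esub> \<ominus>\<^bsub>N\<^esub> y \<in> S2" using c by auto
    ultimately have "x \<oplus>\<^bsub>N\<^esub> \<ominus>\<^bsub>N\<^esub> x' = \<zero>\<^bsub>N\<^esub>" "y' \<oplus>\<^bsub>N\<^esub> \<ominus>\<^bsub>N\<^esub> y = \<zero>\<^bsub>N\<^esub>" using S(3) by auto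
    then show "x = x' \<and> y = y'"
      using N.minus_equality[of x "\<ominus>\<^bsub>N\<^esub> x'"] N.minus_equality[of y' "\<ominus>\<^bsub>N\<^esub> y"] car by auto
  qed
  then have bij: "bij_betw j (carrier (lmod_sum ?N1 ?N2)) (carrier N)"
    using img by (simp add: bij_betw_def lmod_sum_def)
  note sum = left_module_sum[OF lm]
  obtain \<sigma> where \<sigma>: "presents B \<sigma> (lmod_sum ?N1 ?N2)"
    using presents_transport[OF B lmod_iso_inv[OF j bij sum] sum] by blast
  then show ?thesis
    using presents_sumD[OF \<sigma> lm] ex that by blast
qed

section \<open>The preorder of finitely presented modules as a preorder on matrices\<close>

definition coker_below :: "'a::ring_1 mat \<Rightarrow> 'a mat \<Rightarrow> bool" where
  "coker_below A B \<longleftrightarrow> lmod_below (cokernel A) (cokernel B)"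

lemma lmod_below_trans: "lmod_below M N \<Longrightarrow> lmod_below N K \<Longrightarrow> lmod_below M K"
  unfolding lmod_below_def by (rule rtranclp_trans)

lemma coker_below_trans: "coker_below A B \<Longrightarrow> coker_below B C \<Longrightarrow> coker_below A C"
  unfolding coker_below_def by (rule lmod_below_trans)

lemma coker_below_refl: "coker_below A A"
  by (simp add: coker_below_def lmod_below_def)

lemma lmod_belowI:
  fixes M' N' :: "('a::ring_1, 'a vec set) module"
  assumes M: "presents A \<pi> M" "presents A \<pi>' M'" and N: "presents C1 \<pi>1 N1" "presents C2 \<pi>2 N2" "presents (diag_mat2 C1 C2) \<sigma> N'"
    and ex: "right_exact N1 f M g N2"
  shows "lmod_below M' N'"
proof -
  have "lmod_below1 M' N'"
    by (rule lmod_below1I[OF M presents_sum[OF N(1,2)] N(3) ex presentsD(1)[OF N(1)] presentsD(1)[OF N(2)]])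
  then show ?thesis
    unfolding lmod_below_def using M(2) N(3) presents_fin_presented by blast
qed

lemma coker_belowI:
  assumes "presents A \<pi> M" "presents C1 \<pi>1 N1" "presents C2 \<pi>2 N2" "right_exact N1 f M g N2"
  shows "coker_below A (diag_mat2 C1 C2)"
  unfolding coker_below_def
  using lmod_belowI[OF assms(1) _ assms(2,3) _ assms(4)] presents_cokernel by blast

lemma right_exact_surj:
  assumes "left_module M" "g \<in> lmod_hom N M" "g ` carrier N = carrier M"
  shows "right_exact N g M (\<lambda>_. 0\<^sub>v 0) (module_vec TYPE('a::ring_1) 0)"
proof -
  interpret M: left_module M by fact
  have "(\<lambda>_. 0\<^sub>v 0) \<in> lmod_hom M (module_vec TYPE('a) 0)"
    by (rule lmod_homI) (auto simp: module_vec_simps)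
  then show ?thesis
    using assms M.zero_closed by (auto simp: right_exact_iff module_vec_simps carrier_vec_0)
qed

lemma lmod_hom_const_zero:
  assumes "left_module M"
  shows "(\<lambda>_. \<zero>\<^bsub>M\<^esub>) \<in> lmod_hom Z M"
proof -
  interpret M: left_module M by fact
  show ?thesis by (intro lmod_homI) (auto simp: M.smult_zero_right)
qed

lemma right_exact_id:
  assumes "left_module M" "left_module Z" "carrier Z = {\<zero>\<^bsub>Z\<^esub>}"
  shows "right_exact Z (\<lambda>_. \<zero>\<^bsub>M\<^esub>) M id M"
  using assms lmod_hom_const_zero[OF assms(1)] by (auto simp: right_exact_iff lmod_hom_id)

text \<open>Quotients lie below: for the decomposition of \<open>N\<close> into itself and zero, the
  required sequence is \<open>N \<rightarrow> M \<rightarrow> 0 \<rightarrow> 0\<close>.\<close>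

lemma coker_below_surj:
  assumes "presents A \<pi> M" "presents B \<rho> N" "g \<in> lmod_hom N M" "g ` carrier N = carrier M"
  shows "coker_below A B"
  using coker_belowI[OF assms(1,2) presents_vec[of 0] right_exact_surj[OF presentsD(1)[OF assms(1)] assms(3,4)]]
  by simp

lemma coker_below_iso: "presents A \<pi> M \<Longrightarrow> presents B \<rho> M \<Longrightarrow> coker_below A B"
  by (rule coker_below_surj[OF _ _ lmod_hom_id]) auto

lemma lmod_below_iso:
  fixes M M' :: "('a::ring_1, 'a vec set) module"
  assumes "presents A \<pi> M" "presents A \<rho> M'"
  shows "lmod_below M M'"
proof -
  have "right_exact (module_vec TYPE('a) 0) (\<lambda>_. \<zero>\<^bsub>M\<^esub>) M id M"
    using presentsD(1)[OF assms(1)] by (intro right_exact_id left_module_vec) (auto simp: module_vec_simps)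
  then show ?thesis
    using lmod_belowI[OF assms(1,1) presents_vec[of 0] assms(1)] assms(2) by simp
qed

lemma coker_below_iff:
  assumes "presents A \<pi> M" "presents B \<rho> N"
  shows "coker_below A B \<longleftrightarrow> lmod_below M N"
  unfolding coker_below_def
  using presents_cokernel[of A] presents_cokernel[of B] lmod_below_iso lmod_below_trans assms by metis

text \<open>Chains run through modules, whereas \<open>Q\<close> speaks of matrices. Each
  intermediate module is given some presentation, and for the steps to fit together the claim is
  proved for every presentation of the last module.\<close>

lemma coker_below_induct:
  fixes A B :: "'a::ring_1 mat"
  assumes below: "coker_below A B"
    and step: "\<And>A B C1 C2 \<pi> \<pi>1 \<pi>2 \<sigma> f g
      (M :: ('a, 'a vec set) module) (N1 :: ('a, 'a vec set) module) (N2 :: ('a, 'a vec set) module).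
      presents A \<pi> M \<Longrightarrow> presents C1 \<pi>1 N1 \<Longrightarrow> presents C2 \<pi>2 N2 \<Longrightarrow> presents B \<sigma> (lmod_sum N1 N2) \<Longrightarrow>
      right_exact N1 f M g N2 \<Longrightarrow> Q A B"
    and trans: "\<And>A B C. Q A B \<Longrightarrow> Q B C \<Longrightarrow> Q A C"
  shows "Q A B"
proof -
  have "\<forall>B \<rho>. presents B \<rho> N \<longrightarrow> Q A B" if "lmod_below M N" "presents A \<pi> M" for M N A \<pi>
    using that(1) unfolding lmod_below_def
  proof (induction rule: rtranclp_induct)
    case base
    show ?case
    proof (intro allI impI)
      fix B \<rho> assume B: "presents B \<rho> M"
      \<comment> \<open>A chain of length zero still has to connect two presentations of one module.
        It is treated as a step with first summand zero, and the zero module is taken to be the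
        cokernel of the empty matrix, which has the required element type.\<close>
      obtain \<zeta> where Z: "presents (0\<^sub>m 0 0) \<zeta> (cokernel (0\<^sub>m 0 0 :: 'a mat))"
        using presents_cokernel by blast
      have "carrier (cokernel (0\<^sub>m 0 0 :: 'a mat)) = \<zeta> ` {0\<^sub>v 0}"
        using presentsD(3)[OF Z] by (simp only: carrier_vec_0 index_zero_mat)
      then have "carrier (cokernel (0\<^sub>m 0 0 :: 'a mat)) = {\<zero>\<^bsub>cokernel (0\<^sub>m 0 0 :: 'a mat)\<^esub>}"
        using abelian_group.axioms(1)[OF left_module.axioms(1)[OF presentsD(1)[OF Z]]]
        by (metis abelian_monoid.zero_closed image_empty image_insert singletonD)
      then have "right_exact (cokernel (0\<^sub>m 0 0)) (\<lambda>_. \<zero>\<^bsub>M\<^esub>) M id M"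
        using presentsD(1) Z B by (intro right_exact_id) blast+
      moreover have "\<exists>\<sigma>. presents B \<sigma> (lmod_sum (cokernel (0\<^sub>m 0 0)) M)"
        using presents_sum[OF Z B] by auto
      ultimately show "Q A B" using step[OF that(2) Z B] by blast
    qed
  next
    case (step N K)
    show ?case
    proof (intro allI impI)
      fix B \<rho> assume B: "presents B \<rho> K"
      obtain A' \<pi>' where A': "presents A' \<pi>' N"
        using step.hyps(2) by (auto simp: fin_presented_iff)
      have "Q A' B"
      proof (rule lmod_below1E[OF _ B])
        show "lmod_below1 N K" using step.hyps by blast
      qed (rule assms(2)[OF A'])
      then show "Q A B" using step.IH A' trans by blast
    qed
  qed
  then show ?thesis
    using below presents_cokernel unfolding coker_below_def by metis
qed

lemma coker_below_diag_right:
  assumes "coker_below A B"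
  shows "coker_below (diag_mat2 A X) (diag_mat2 B X)"
proof -
  obtain \<kappa> where K: "presents X \<kappa> (cokernel X)" using presents_cokernel by blast
  note lmK = presentsD(1)[OF K]
  show ?thesis
  proof (rule coker_below_induct[OF assms])
    fix A B C1 C2 \<pi> \<pi>1 \<pi>2 \<sigma> f g and M N1 N2 :: "('a, 'a vec set) module"
    assume M: "presents A \<pi> M" and N: "presents C1 \<pi>1 N1" "presents C2 \<pi>2 N2" "presents B \<sigma> (lmod_sum N1 N2)"
      and ex: "right_exact N1 f M g N2"
    note ex' = right_exact_sum_right[OF ex presentsD(1)[OF N(1)] presentsD(1)[OF M] presentsD(1)[OF N(2)] lmK]
    have "coker_below (diag_mat2 A X) (diag_mat2 C1 (diag_mat2 C2 X))"
      by (rule coker_belowI[OF presents_sum[OF M K] N(1) presents_sum[OF N(2) K] ex'])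
    moreover have "coker_below (diag_mat2 (diag_mat2 C1 C2) X) (diag_mat2 B X)"
      by (rule coker_below_iso[OF presents_sum[OF presents_sum[OF N(1,2)] K] presents_sum[OF N(3) K]])
    ultimately show "coker_below (diag_mat2 A X) (diag_mat2 B X)"
      using coker_below_trans by (simp add: diag_mat2_assoc)
  qed (rule coker_below_trans)
qed

lemma coker_below_diag_comm: "coker_below (diag_mat2 A B) (diag_mat2 B A)"
proof -
  obtain \<pi> where A: "presents A \<pi> (cokernel A)" using presents_cokernel by blast
  obtain \<rho> where B: "presents B \<rho> (cokernel B)" using presents_cokernel by blast
  let ?k = "\<lambda>z. (snd z, fst z)"
  have "?k \<in> lmod_hom (lmod_sum (cokernel B) (cokernel A)) (lmod_sum (cokernel A) (cokernel B))"
    by (rule lmod_homI) (auto simp: lmod_sum_def)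
  moreover have "?k ` carrier (lmod_sum (cokernel B) (cokernel A)) = carrier (lmod_sum (cokernel A) (cokernel B))"
    by (force simp: lmod_sum_def)
  ultimately show ?thesis
    by (rule coker_below_surj[OF presents_sum[OF A B] presents_sum[OF B A]])
qed

lemma coker_below_empty: "coker_below (0\<^sub>m 0 0) A"
proof -
  obtain \<pi> where A: "presents A \<pi> (cokernel A)" using presents_cokernel by blast
  interpret left_module "cokernel A" using presentsD(1)[OF A] .
  show ?thesis
    by (rule coker_below_surj[OF presents_vec A, of "\<lambda>_. 0\<^sub>v 0"])
      (use zero_closed in \<open>auto intro!: lmod_homI simp: module_vec_simps carrier_vec_0\<close>)
qed

text \<open>A cokernel is a quotient of the free module on the columns, and that module is presented
  by the matrix without rows.\<close>

lemma coker_below_zero: "coker_below A (0\<^sub>m 0 (dim_col A))"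
proof -
  obtain \<pi> where A: "presents A \<pi> (cokernel A)" using presents_cokernel by blast
  show ?thesis
    using presentsD[OF A] by (intro coker_below_surj[OF A presents_vec, of \<pi>]) (auto simp: module_vec_simps)
qed

text \<open>An isomorphic copy of \<open>M\<close> is presented by the same matrix, so presentation
  matrices decide membership. The element type of \<open>M\<close> is left open, as is needed for
  direct sums and for the ring itself.\<close>

lemma VM_class_iff:
  assumes M: "presents A \<pi> M" and N: "presents B \<rho> N"
  shows "N \<in> VM_class M \<longleftrightarrow> coker_below A B \<and> coker_below B A"
proof
  assume "N \<in> VM_class M"
  then obtain M' where M': "fin_presented M'" "lmod_isomorphic M M'" "lmod_below M' N" "lmod_below N M'"
    by (auto simp: VM_class_def)
  then obtain \<pi>' where "presents A \<pi>' M'"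
    using presents_cong[OF M] by (auto simp: fin_presented_def)
  then show "coker_below A B \<and> coker_below B A"
    using M' N by (simp add: coker_below_iff)
next
  assume *: "coker_below A B \<and> coker_below B A"
  obtain \<pi>' where \<pi>': "presents A \<pi>' (cokernel A)" using presents_cokernel by blast
  then have "lmod_below (cokernel A) N" "lmod_below N (cokernel A)"
    using * N by (simp_all add: coker_below_iff[symmetric])
  then show "N \<in> VM_class M"
    unfolding VM_class_def using presents_fin_presented[OF N] presents_fin_presented[OF \<pi>'] presents_isomorphic[OF M \<pi>'] by blast
qed

lemma VM_class_eq_iff:
  assumes M: "presents A \<pi> M" and N: "presents B \<rho> N"
  shows "VM_class M = VM_class N \<longleftrightarrow> coker_below A B \<and> coker_below B A"
proof
  obtain \<pi>' where A: "presents A \<pi>' (cokernel A)" using presents_cokernel by blast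
  assume "VM_class M = VM_class N"
  then show "coker_below A B \<and> coker_below B A"
    using VM_class_iff[OF M A] VM_class_iff[OF N A] coker_below_refl by blast
next
  assume *: "coker_below A B \<and> coker_below B A"
  have "K \<in> VM_class M \<longleftrightarrow> K \<in> VM_class N" if K: "fin_presented K" for K :: "('a, 'a vec set) module"
  proof -
    obtain C \<kappa> where "presents C \<kappa> K" using K by (auto simp: fin_presented_iff)
    then show ?thesis
      using * VM_class_iff[OF M] VM_class_iff[OF N] coker_below_trans by blast
  qed
  moreover have "fin_presented K" if "K \<in> VM_class M \<or> K \<in> VM_class N" for K
    using that by (auto simp: VM_class_def)
  ultimately show "VM_class M = VM_class N" by blast
qed

lemma coker_below_diag:
  "coker_below A A' \<Longrightarrow> coker_below B B' \<Longrightarrow> coker_below (diag_mat2 A B) (diag_mat2 A' B')"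
  by (meson coker_below_diag_comm coker_below_diag_right coker_below_trans)

lemma VM_class_cokernel: "presents A \<pi> M \<Longrightarrow> VM_class M = VM_class (cokernel A)"
  using presents_cokernel[of A] VM_class_eq_iff coker_below_refl by blast

lemma VM_mat_class_monoid:
  "mat_class_monoid coker_below (0\<^sub>m 0) (\<lambda>A. VM_class (cokernel A)) (VM TYPE('a::ring_1)) VM_le"
proof
  fix A B C :: "'a mat"
  obtain \<pi> where A: "presents A \<pi> (cokernel A)" using presents_cokernel by blast
  obtain \<rho> where B: "presents B \<rho> (cokernel B)" using presents_cokernel by blast
  have mem: "cokernel A \<in> VM_class (cokernel A)" "cokernel B \<in> VM_class (cokernel B)"
    using VM_class_iff[OF A A] VM_class_iff[OF B B] coker_below_refl by blast+
  show eq: "VM_class (cokernel A) = VM_class (cokernel B) \<longleftrightarrow> coker_below A B \<and> coker_below B A"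
    by (rule VM_class_eq_iff[OF A B])
  show "VM_class (cokernel A) \<otimes>\<^bsub>VM TYPE('a)\<^esub> VM_class (cokernel B) = VM_class (cokernel (diag_mat2 A B))"
  proof -
    \<comment> \<open>The sum consists of pairs and so is not in the fixed element type; its class
      is nevertheless determined by the presentation \<open>diag_mat2 A' B'\<close>.\<close>
    have "VM_class (lmod_sum M N) = VM_class (cokernel (diag_mat2 A B))"
      if M: "M \<in> VM_class (cokernel A)" and N: "N \<in> VM_class (cokernel B)" for M N :: "('a, 'a vec set) module"
    proof -
      obtain A' \<pi>' B' \<rho>' where A': "presents A' \<pi>' M" and B': "presents B' \<rho>' N"
        using M N by (auto simp: VM_class_def fin_presented_iff)
      have "coker_below A A'" "coker_below A' A" "coker_below B B'" "coker_below B' B"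
        using M N VM_class_iff[OF A A'] VM_class_iff[OF B B'] by blast+
      then show ?thesis
        using presents_cokernel[of "diag_mat2 A B"] VM_class_eq_iff[OF presents_sum[OF A' B']] coker_below_diag by blast
    qed
    then have "(\<Union>M\<in>VM_class (cokernel A). \<Union>N\<in>VM_class (cokernel B). VM_class (lmod_sum M N)) =
        (\<Union>M\<in>VM_class (cokernel A). \<Union>N\<in>VM_class (cokernel B). VM_class (cokernel (diag_mat2 A B)))"
      by (intro SUP_cong refl)
    also have "\<dots> = VM_class (cokernel (diag_mat2 A B))"
      using mem by blast
    finally show ?thesis by (simp add: VM_def)
  qed
  show "VM_le (VM_class (cokernel A)) (VM_class (cokernel B)) \<longleftrightarrow> coker_below A B"
  proof
    assume "VM_le (VM_class (cokernel A)) (VM_class (cokernel B))"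
    then obtain M N where MN: "M \<in> VM_class (cokernel A)" "N \<in> VM_class (cokernel B)" "lmod_below M N"
      by (auto simp: VM_le_def)
    then obtain A' \<pi>' B' \<rho>' where A': "presents A' \<pi>' M" and B': "presents B' \<rho>' N"
      by (auto simp: VM_class_def fin_presented_iff)
    then show "coker_below A B"
      using MN VM_class_iff[OF A A'] VM_class_iff[OF B B'] coker_below_iff[OF A' B'] coker_below_trans by blast
  next
    assume "coker_below A B"
    then show "VM_le (VM_class (cokernel A)) (VM_class (cokernel B))"
      using mem unfolding VM_le_def coker_below_def by blast
  qed
  show "coker_below A (0\<^sub>m 0 (dim_col A))" by (rule coker_below_zero)
  show "coker_below (0\<^sub>m 0 0) A" by (rule coker_below_empty)
  show "0\<^sub>m 0 (Suc m) = diag_mat2 (0\<^sub>m 0 m) (0\<^sub>m 0 1 :: 'a mat)" for m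
    by (simp add: diag_mat2_zero)
  show "carrier (VM TYPE('a)) = range (\<lambda>A. VM_class (cokernel (A :: 'a mat)))"
  proof (intro equalityI subsetI)
    fix X assume "X \<in> carrier (VM TYPE('a))"
    then obtain M :: "('a, 'a vec set) module" and A \<pi> where "X = VM_class M" "presents A \<pi> M"
      by (auto simp: VM_def fin_presented_iff)
    then show "X \<in> range (\<lambda>A. VM_class (cokernel (A :: 'a mat)))"
      using VM_class_cokernel by blast
  next
    fix X assume "X \<in> range (\<lambda>A. VM_class (cokernel (A :: 'a mat)))"
    then show "X \<in> carrier (VM TYPE('a))"
      using presents_cokernel presents_fin_presented by (auto simp: VM_def) blast
  qed
  show "\<one>\<^bsub>VM TYPE('a)\<^esub> = VM_class (cokernel (0\<^sub>m 0 0 :: 'a mat))"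
    using VM_class_cokernel[OF presents_vec[where 'a = 'a and m = 0]] by (simp add: VM_def)
qed (auto simp: coker_below_refl coker_below_diag_right coker_below_diag_comm
    intro: coker_below_trans)


section \<open>From modules to matrices\<close>

text \<open>Lifting supplies the matrices for \<open>mat_below_surj\<close>: \<open>T\<close> lifts
  \<open>h\<close> along \<open>\<pi>\<close>, and \<open>J\<close> lifts \<open>\<pi>\<close> along
  \<open>h\<close>. The rows of \<open>K * T\<close> and of \<open>1 - J * T\<close> are then killed
  by \<open>\<pi>\<close>, hence are combinations of the rows of \<open>A\<close>, with coefficients
  \<open>X\<close> and \<open>L\<close>.\<close>

lemma mat_below_surj_hom:
  fixes A K :: "'a::ring_1 mat"
  assumes A: "presents A \<pi> M" and K: "K \<in> carrier_mat p q"
    and h: "h \<in> lmod_hom (module_vec TYPE('a) q) M" "h ` carrier_vec q = carrier M"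
    and ker: "\<And>x. x \<in> carrier_vec p \<Longrightarrow> h (vec_mult_mat x K) = \<zero>\<^bsub>M\<^esub>"
  shows "mat_below (diag_mat2 K (1\<^sub>m (dim_col A))) (diag_mat2 A (1\<^sub>m q))"
proof -
  obtain n m where c: "A \<in> carrier_mat n m" by blast
  note A' = A[unfolded presents_iff[OF c]]
  have M: "left_module M" and \<pi>: "\<pi> \<in> lmod_hom (module_vec TYPE('a) m) M" and surj: "\<pi> ` carrier_vec m = carrier M"
    using A' by blast+
  have mult_hom: "(\<lambda>x. vec_mult_mat x B) \<in> lmod_hom (module_vec TYPE('a) n') (module_vec TYPE('a) m')"
    if "B \<in> carrier_mat n' m'" for B :: "'a mat" and n' m'
    using that by (rule vec_mult_mat_hom)
  obtain T where T: "T \<in> carrier_mat q m" "\<And>x. x \<in> carrier_vec q \<Longrightarrow> \<pi> (vec_mult_mat x T) = h x"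
    using lmod_hom_lift[OF M \<pi> h(1)] surj h(2) by blast
  obtain J where J: "J \<in> carrier_mat m q" "\<And>x. x \<in> carrier_vec m \<Longrightarrow> h (vec_mult_mat x J) = \<pi> x"
    using lmod_hom_lift[OF M h(1) \<pi>] surj h(2) by blast
  obtain X where X: "X \<in> carrier_mat p n" "\<And>x. x \<in> carrier_vec p \<Longrightarrow> vec_mult_mat (vec_mult_mat x X) A = vec_mult_mat x (K * T)"
  proof (rule lmod_hom_lift[OF left_module_vec mult_hom[OF c] mult_hom[OF mult_carrier_mat[OF K T(1)]]])
    fix x :: "'a vec" assume x: "x \<in> carrier_vec p"
    have "\<pi> (vec_mult_mat x (K * T)) = \<zero>\<^bsub>M\<^esub>"
      using x K T ker by (simp add: vec_mult_mat_mult[of _ p _ q _ m])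
    then show "vec_mult_mat x (K * T) \<in> (\<lambda>x. vec_mult_mat x A) ` carrier_vec n"
      using A' vec_mult_mat_carrier[OF mult_carrier_mat[OF K T(1)], of x] by blast
  qed (rule that)
  define E where "E = 1\<^sub>m m - J * T"
  have E: "E \<in> carrier_mat m m" unfolding E_def by (rule minus_carrier_mat[OF mult_carrier_mat[OF J(1) T(1)]])
  have EJT: "J * T + E = 1\<^sub>m m" using J T unfolding E_def by (intro eq_matI) auto
  obtain L where L: "L \<in> carrier_mat m n" "\<And>x. x \<in> carrier_vec m \<Longrightarrow> vec_mult_mat (vec_mult_mat x L) A = vec_mult_mat x E"
  proof (rule lmod_hom_lift[OF left_module_vec mult_hom[OF c] mult_hom[OF E]])
    fix x :: "'a vec" assume x: "x \<in> carrier_vec m"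
    have JT: "J * T \<in> carrier_mat m m" using J T by simp
    have xJT: "vec_mult_mat x (J * T) \<in> carrier_vec m" using JT by blast
    have "\<pi> x = \<pi> (vec_mult_mat x (J * T))"
      using x J T by (simp add: vec_mult_mat_mult[of _ m _ q _ m] vec_mult_mat_carrier[of J m q])
    then obtain y where y: "y \<in> carrier_vec n" "x = vec_mult_mat y A + vec_mult_mat x (J * T)"
      using presents_eq_iff[OF A c x xJT] by blast
    have "x = vec_mult_mat x E + vec_mult_mat x (J * T)"
      using x E JT vec_mult_mat_add_right[OF x JT E] EJT
      by (simp add: vec_mult_mat_one comm_add_vec[of "vec_mult_mat x E" m])
    then have "vec_mult_mat x E = vec_mult_mat y A"
      using y x xJT c E vec_diff_eq_iff[of x m "vec_mult_mat x (J * T)"] by (metis vec_mult_mat_carrier)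
    then show "vec_mult_mat x E \<in> (\<lambda>x. vec_mult_mat x A) ` carrier_vec n" using y by blast
  qed (rule that)
  have "K * T = X * A"
    using K T X c by (intro mat_eq_iff_vec_mult_mat[of _ p m]) (auto simp: vec_mult_mat_mult[of _ p X n A m])
  moreover have "L * A = E"
    using c E L by (intro mat_eq_iff_vec_mult_mat[of _ m m]) (auto simp: vec_mult_mat_mult[of _ m L n A m])
  ultimately show ?thesis
    using mat_below_surj[OF K c T(1) X(1) J(1) L(1)] EJT c by simp
qed

text \<open>
  \<open>M\<close> is generated by the images of the generators of \<open>N1\<close> together with lifts of the generators of
  \<open>N2\<close>. The relations of \<open>N1\<close> remain valid, and those of \<open>N2\<close> hold up to the image of \<open>N1\<close>, which is
  where \<open>E\<close> comes from.
\<close>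

lemma right_exact_presentation:
  fixes A C1 C2 :: "'a::ring_1 mat"
  assumes A: "presents A \<pi> M" and C1: "presents C1 \<pi>1 N1" "C1 \<in> carrier_mat n1 m1"
    and C2: "presents C2 \<pi>2 N2" "C2 \<in> carrier_mat n2 m2" and ex: "right_exact N1 f M g N2"
  obtains E where "E \<in> carrier_mat n2 m1"
    "mat_below (diag_mat2 (four_block_mat C2 E (0\<^sub>m n1 m2) C1) (1\<^sub>m (dim_col A))) (diag_mat2 A (1\<^sub>m (m2 + m1)))"
proof -
  obtain n m where c: "A \<in> carrier_mat n m" by blast
  note A' = A[unfolded presents_iff[OF c]]
    and C1' = C1(1)[unfolded presents_iff[OF C1(2)]] and C2' = C2(1)[unfolded presents_iff[OF C2(2)]]
  have M: "left_module M" and \<pi>: "\<pi> \<in> lmod_hom (module_vec TYPE('a) m) M" and surj: "\<pi> ` carrier_vec m = carrier M"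
    using A' by blast+
  have N1: "left_module N1" and \<pi>1: "\<pi>1 \<in> lmod_hom (module_vec TYPE('a) m1) N1" and surj1: "\<pi>1 ` carrier_vec m1 = carrier N1"
    using C1' by blast+
  have N2: "left_module N2" and \<pi>2: "\<pi>2 \<in> lmod_hom (module_vec TYPE('a) m2) N2" and surj2: "\<pi>2 ` carrier_vec m2 = carrier N2"
    using C2' by blast+
  interpret M: left_module M by fact
  have f: "f \<in> lmod_hom N1 M" and g: "g \<in> lmod_hom M N2" and gsurj: "g ` carrier M = carrier N2"
    and ker: "\<And>x. x \<in> carrier M \<Longrightarrow> g x = \<zero>\<^bsub>N2\<^esub> \<longleftrightarrow> x \<in> f ` carrier N1"
    using ex by (auto simp: right_exact_iff)
  define h1 where "h1 = f \<circ> \<pi>1"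
  have h1: "h1 \<in> lmod_hom (module_vec TYPE('a) m1) M" unfolding h1_def by (rule lmod_hom_comp[OF \<pi>1 f])
  have h1_img: "h1 ` carrier_vec m1 = f ` carrier N1" unfolding h1_def image_comp[symmetric] surj1 ..
  have h1_row: "h1 (vec_mult_mat w C1) = \<zero>\<^bsub>M\<^esub>" if "w \<in> carrier_vec n1" for w
    using presents_row[OF C1 that] lmod_hom_zero[OF f N1 M] by (simp add: h1_def)
  \<comment> \<open>Since \<open>g \<circ> \<pi>\<close> is onto, the generators of
    \<open>N2\<close> lift to \<open>M\<close>; \<open>S\<close> writes the lifts in the generators
    belonging to \<open>A\<close>.\<close>
  obtain S where S: "S \<in> carrier_mat m2 m" "\<And>y. y \<in> carrier_vec m2 \<Longrightarrow> (g \<circ> \<pi>) (vec_mult_mat y S) = \<pi>2 y"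
  proof (rule lmod_hom_lift[OF N2 lmod_hom_comp[OF \<pi> g] \<pi>2])
    fix y :: "'a vec" assume "y \<in> carrier_vec m2"
    then show "\<pi>2 y \<in> (g \<circ> \<pi>) ` carrier_vec m"
      unfolding image_comp[symmetric] surj gsurj surj2[symmetric] by blast
  qed (rule that)
  define h2 where "h2 = \<pi> \<circ> (\<lambda>y. vec_mult_mat y S)"
  have h2: "h2 \<in> lmod_hom (module_vec TYPE('a) m2) M"
    unfolding h2_def by (rule lmod_hom_comp[OF vec_mult_mat_hom[OF S(1)] \<pi>])
  have gh2: "g (h2 y) = \<pi>2 y" if "y \<in> carrier_vec m2" for y
    using S(2)[OF that] by (simp add: h2_def)
  have h1c: "h1 x \<in> carrier M" if "x \<in> carrier_vec m1" for x
    using lmod_hom_closed[OF h1, of x] that by (simp add: module_vec_simps)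
  have h2c: "h2 x \<in> carrier M" if "x \<in> carrier_vec m2" for x
    using lmod_hom_closed[OF h2, of x] that by (simp add: module_vec_simps)
  obtain F where F: "F \<in> carrier_mat m1 m" "\<And>x. x \<in> carrier_vec m1 \<Longrightarrow> \<pi> (vec_mult_mat x F) = h1 x"
    using lmod_hom_lift[OF M \<pi> h1] surj h1c by blast
  \<comment> \<open>A relation of \<open>N2\<close>, evaluated at the lifted generators, is killed
    by \<open>g\<close> and so by exactness comes from \<open>N1\<close>. \<open>D\<close> records
    from which element; \<open>- D\<close> becomes the corner \<open>E\<close>.\<close>
  obtain D where D: "D \<in> carrier_mat n2 m1"
    "\<And>z. z \<in> carrier_vec n2 \<Longrightarrow> h1 (vec_mult_mat z D) = (h2 \<circ> (\<lambda>z. vec_mult_mat z C2)) z"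
  proof (rule lmod_hom_lift[OF M h1 lmod_hom_comp[OF vec_mult_mat_hom[OF C2(2)] h2]])
    fix z :: "'a vec" assume z: "z \<in> carrier_vec n2"
    have zC: "vec_mult_mat z C2 \<in> carrier_vec m2" using C2(2) by blast
    have "g (h2 (vec_mult_mat z C2)) = \<zero>\<^bsub>N2\<^esub>"
      unfolding gh2[OF zC] using presents_row[OF C2 z] .
    then show "(h2 \<circ> (\<lambda>z. vec_mult_mat z C2)) z \<in> h1 ` carrier_vec m1"
      using ker[OF h2c[OF zC]] by (simp add: h1_img)
  qed (rule that)
  define K where "K = four_block_mat C2 (- D) (0\<^sub>m n1 m2) C1"
  have K: "K \<in> carrier_mat (n2 + n1) (m2 + m1)" using C1(2) C2(2) by (simp add: K_def)
  \<comment> \<open>The lifts of the generators of \<open>N2\<close> come first, followed by the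
    images of those of \<open>N1\<close>, in the order of the block columns of
    \<open>K\<close>.\<close>
  define h where "h = \<pi> \<circ> (\<lambda>v. vec_mult_mat v (S @\<^sub>r F))"
  have h: "h \<in> lmod_hom (module_vec TYPE('a) (m2 + m1)) M"
    unfolding h_def by (rule lmod_hom_comp[OF vec_mult_mat_hom[OF carrier_append_rows[OF S(1) F(1)]] \<pi>])
  have h_append: "h (y @\<^sub>v x) = h2 y \<oplus>\<^bsub>M\<^esub> h1 x" if "y \<in> carrier_vec m2" "x \<in> carrier_vec m1" for y x
  proof -
    have "vec_mult_mat y S \<in> carrier_vec m" "vec_mult_mat x F \<in> carrier_vec m" using S(1) F(1) by blast+
    then show ?thesis
      using lmod_hom_add[OF \<pi>, of "vec_mult_mat y S" "vec_mult_mat x F"] that F(2)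
      by (simp add: h_def h2_def vec_mult_mat_append_rows[OF that S(1) F(1)] module_vec_simps)
  qed
  have "h ` carrier_vec (m2 + m1) = carrier M"
  proof (intro equalityI subsetI)
    fix u assume u: "u \<in> carrier M"
    then obtain y where y: "y \<in> carrier_vec m2" "g u = \<pi>2 y"
      using gsurj surj2 by (metis image_iff)
    then have "g (u \<ominus>\<^bsub>M\<^esub> h2 y) = \<zero>\<^bsub>N2\<^esub>"
      using lmod_hom_eq_on_diff[OF g M N2 u h2c[OF y(1)]] gh2 by simp
    then have "u \<ominus>\<^bsub>M\<^esub> h2 y \<in> h1 ` carrier_vec m1"
      using ker u h2c[OF y(1)] by (simp add: h1_img)
    then obtain x where x: "x \<in> carrier_vec m1" "u \<ominus>\<^bsub>M\<^esub> h2 y = h1 x" by blast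
    have "h2 y \<oplus>\<^bsub>M\<^esub> (u \<ominus>\<^bsub>M\<^esub> h2 y) = u"
      using u h2c[OF y(1)] by (simp add: M.minus_eq M.a_lcomm M.r_neg)
    then have "u = h (y @\<^sub>v x)" using x y by (simp add: h_append)
    then show "u \<in> h ` carrier_vec (m2 + m1)" using x y by auto
  next
    fix u assume "u \<in> h ` carrier_vec (m2 + m1)"
    then show "u \<in> carrier M" using lmod_hom_closed[OF h] by (auto simp: module_vec_simps)
  qed
  moreover have "h (vec_mult_mat v K) = \<zero>\<^bsub>M\<^esub>" if v_in: "v \<in> carrier_vec (n2 + n1)" for v
  proof -
    obtain z w where v: "v = z @\<^sub>v w" "z \<in> carrier_vec n2" "w \<in> carrier_vec n1"
      using v_in by (rule vec_append_cases)
    have c': "vec_mult_mat z C2 \<in> carrier_vec m2" "vec_mult_mat z D \<in> carrier_vec m1" "vec_mult_mat w C1 \<in> carrier_vec m1"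
      using C1(2) C2(2) D(1) by blast+
    have "vec_mult_mat v K = vec_mult_mat z C2 @\<^sub>v (vec_mult_mat z (- D) + vec_mult_mat w C1)"
      unfolding v(1) K_def using v(2,3) C1(2) C2(2) D(1) c'
      by (subst vec_mult_mat_append[of _ n2 _ n1 _ m2 _ m1]) (auto simp: vec_mult_mat_zero_right)
    also have "vec_mult_mat z (- D) = (- 1) \<cdot>\<^sub>v vec_mult_mat z D"
      using v D by (intro eq_vecI) auto
    finally have "h (vec_mult_mat v K) = h2 (vec_mult_mat z C2) \<oplus>\<^bsub>M\<^esub> h1 ((- 1) \<cdot>\<^sub>v vec_mult_mat z D + vec_mult_mat w C1)"
      using c' by (simp add: h_append)
    also have "h1 ((- 1) \<cdot>\<^sub>v vec_mult_mat z D + vec_mult_mat w C1) = (- 1) \<odot>\<^bsub>M\<^esub> h1 (vec_mult_mat z D) \<oplus>\<^bsub>M\<^esub> h1 (vec_mult_mat w C1)"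
      using lmod_hom_add[OF h1, of "(- 1) \<cdot>\<^sub>v vec_mult_mat z D" "vec_mult_mat w C1"]
        lmod_hom_smult[OF h1, of "vec_mult_mat z D" "- 1"] c' by (simp add: module_vec_simps)
    also have "\<dots> = \<ominus>\<^bsub>M\<^esub> h2 (vec_mult_mat z C2)"
      using h1_row[OF v(3)] D(2)[OF v(2)] h2c[OF c'(1)] by (simp add: M.smult_minus_one)
    finally show ?thesis using h2c[OF c'(1)] by (simp add: M.r_neg)
  qed
  ultimately have "mat_below (diag_mat2 K (1\<^sub>m (dim_col A))) (diag_mat2 A (1\<^sub>m (m2 + m1)))"
    by (intro mat_below_surj_hom[OF A K h])
  then show ?thesis using D(1) unfolding K_def by (intro that[of "- D"]) auto
qed

interpretation W: mat_class_monoid mat_below "1\<^sub>m" WM_class "WM TYPE('a::ring_1)" WM_le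
  by (rule WM_mat_class_monoid)

interpretation V: mat_class_monoid coker_below "0\<^sub>m 0" "\<lambda>A. VM_class (cokernel A)" "VM TYPE('a::ring_1)" VM_le
  by (rule VM_mat_class_monoid)

text \<open>Up to identity blocks, \<open>B\<close> lies below \<open>diag_mat2 C1 C2\<close>, this
  lies below the triangular matrix with corner \<open>E\<close>, and that one lies below
  \<open>A\<close>. The first and the last comparison come from surjections, the middle one is a
  generator of the matrix preorder together with an exchange of blocks.\<close>

lemma coker_below_imp_dual:
  assumes "coker_below A B"
  shows "W.dual A B"
  using assms
proof (rule coker_below_induct)
  fix A B C1 C2 :: "'a mat" and \<pi> \<pi>1 \<pi>2 \<sigma> f g and M N1 N2 :: "('a, 'a vec set) module"
  assume A: "presents A \<pi> M" and C1: "presents C1 \<pi>1 N1" and C2: "presents C2 \<pi>2 N2"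
    and B: "presents B \<sigma> (lmod_sum N1 N2)" and ex: "right_exact N1 f M g N2"
  obtain n1 m1 n2 m2 where c: "C1 \<in> carrier_mat n1 m1" "C2 \<in> carrier_mat n2 m2" by blast
  let ?a = "dim_col A" and ?b = "dim_col B" and ?q = "m2 + m1"
  obtain E where E: "E \<in> carrier_mat n2 m1"
    and K: "mat_below (diag_mat2 (four_block_mat C2 E (0\<^sub>m n1 m2) C1) (1\<^sub>m ?a)) (diag_mat2 A (1\<^sub>m ?q))"
    using right_exact_presentation[OF A C1 c(1) C2 c(2) ex] .
  \<comment> \<open>\<open>B\<close> and \<open>diag_mat2 C1 C2\<close> present the same module, so
    the generating map for \<open>B\<close> serves as a surjection that kills the relations in
    \<open>B\<close>.\<close>
  have BC: "mat_below (diag_mat2 B (1\<^sub>m (dim_col (diag_mat2 C1 C2)))) (diag_mat2 (diag_mat2 C1 C2) (1\<^sub>m ?b))"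
    using presentsD[OF B]
    by (intro mat_below_surj_hom[OF presents_sum[OF C1 C2], of _ _ _ \<sigma>]) (auto intro: presents_row[OF B])
  have q: "dim_col (diag_mat2 C1 C2) = ?q" using c by simp
  have CK: "mat_below (diag_mat2 C1 C2) (four_block_mat C2 E (0\<^sub>m n1 m2) C1)"
    using mat_below_diag_comm mat_below_triangular[OF c(2,1) E] mat_below_trans by blast
  note [trans] = mat_below_trans
  have "mat_below (diag_mat2 B (1\<^sub>m (?q + ?a))) (diag_mat2 (diag_mat2 C1 C2) (1\<^sub>m (?b + ?a)))"
    using mat_below_diag_right[OF BC, of "1\<^sub>m ?a"] unfolding q diag_mat2_assoc[symmetric] diag_mat2_one .
  also have "mat_below \<dots> (diag_mat2 (four_block_mat C2 E (0\<^sub>m n1 m2) C1) (1\<^sub>m (?b + ?a)))"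
    using CK by (rule mat_below_diag_right)
  also have "mat_below \<dots> (diag_mat2 A (1\<^sub>m (?q + ?b)))"
    using mat_below_diag_right[OF K, of "1\<^sub>m ?b"]
    unfolding diag_mat2_assoc[symmetric] diag_mat2_one by (simp add: add.commute)
  \<comment> \<open>The number \<open>?q\<close> of generators in the intermediate presentation
    occurs on both sides and becomes the common summand.\<close>
  finally show "W.dual A B"
    by (intro W.dualI[of _ _ ?q]) (simp add: add.commute add.left_commute)
qed (rule W.dual_trans)

section \<open>From matrices to modules\<close>

lemma presents_factor:
  fixes A B :: "'a::ring_1 mat"
  assumes A: "presents A \<pi> M" and h: "h \<in> lmod_hom (module_vec TYPE('a) (dim_col A)) N" and N: "left_module N"
    and rows: "\<And>y. y \<in> carrier_vec (dim_row A) \<Longrightarrow> h (vec_mult_mat y A) = \<zero>\<^bsub>N\<^esub>"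
  obtains k where "k \<in> lmod_hom M N" "\<And>x. x \<in> carrier_vec (dim_col A) \<Longrightarrow> k (\<pi> x) = h x"
    "k ` carrier M = h ` carrier_vec (dim_col A)"
proof -
  obtain k where k: "k \<in> lmod_hom M N" "\<And>x. x \<in> carrier_vec (dim_col A) \<Longrightarrow> k (\<pi> x) = h x"
    using presentsD[OF A] rows
    by (rule_tac lmod_hom_factor[OF left_module_vec _ N presentsD(2)[OF A] _ h]) (auto simp: module_vec_simps)
  have "k ` \<pi> ` carrier_vec (dim_col A) = h ` carrier_vec (dim_col A)"
    unfolding image_image using k(2) by (intro image_cong refl)
  then show ?thesis using k that presentsD(3)[OF A] by simp
qed

text \<open>Rows of \<open>C * A\<close> are combinations of rows of \<open>A\<close>, so fewer
  relations are imposed and the cokernel of \<open>C * A\<close> maps onto that of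
  \<open>A\<close>.\<close>

lemma coker_below_mult_left:
  assumes "C \<in> carrier_mat l n" "A \<in> carrier_mat n m"
  shows "coker_below A (C * A)"
proof -
  obtain \<pi> where A: "presents A \<pi> (cokernel A)" using presents_cokernel by blast
  obtain \<rho> where CA: "presents (C * A) \<rho> (cokernel (C * A))" using presents_cokernel by blast
  have m: "dim_col (C * A) = dim_col A" "dim_row (C * A) = l" using assms by auto
  obtain k where "k \<in> lmod_hom (cokernel (C * A)) (cokernel A)"
    "k ` carrier (cokernel (C * A)) = \<pi> ` carrier_vec (dim_col (C * A))"
  proof (rule presents_factor[OF CA, of \<pi> "cokernel A"])
    fix y :: "'a vec" assume y: "y \<in> carrier_vec (dim_row (C * A))"
    then have "vec_mult_mat y (C * A) = vec_mult_mat (vec_mult_mat y C) A"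
      using assms by (intro vec_mult_mat_mult[of _ l _ n _ m]) (auto simp: m)
    then show "\<pi> (vec_mult_mat y (C * A)) = \<zero>\<^bsub>cokernel A\<^esub>"
      using presents_row[OF A assms(2)] vec_mult_mat_carrier[OF assms(1)] by simp
  qed (use presentsD[OF A] m in auto)
  then show ?thesis
    using coker_below_surj[OF A CA] presentsD(3)[OF A] m by simp
qed

text \<open>Uses \<open>R\<^sup>k \<rightarrow> coker B \<oplus> R\<^sup>m \<rightarrow> coker (B D) \<rightarrow> 0\<close> with the maps \<open>x \<mapsto> (x, -x D)\<close> and \<open>(x, y) \<mapsto> x D + y\<close>.\<close>

lemma coker_below_mult_right:
  fixes B D :: "'a::ring_1 mat"
  assumes B: "B \<in> carrier_mat n k" and D: "D \<in> carrier_mat k m"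
  shows "coker_below (diag_mat2 B (0\<^sub>m 0 m)) (diag_mat2 (B * D) (0\<^sub>m 0 k))"
proof -
  define N where "N = cokernel B"
  define Q where "Q = cokernel (B * D)"
  let ?F = "module_vec TYPE('a) m"
  have BD: "B * D \<in> carrier_mat n m" using B D by simp
  obtain \<pi> where pB: "presents B \<pi> N" using presents_cokernel unfolding N_def by blast
  obtain \<rho> where pBD: "presents (B * D) \<rho> Q" using presents_cokernel unfolding Q_def by blast
  note B' = pB[unfolded presents_iff[OF B]] and BD' = pBD[unfolded presents_iff[OF BD]]
  have d: "dim_row B = n" "dim_col B = k" using B by auto
  interpret Q: left_module Q using BD' by blast
  have \<pi>: "\<pi> \<in> lmod_hom (module_vec TYPE('a) k) N" using B' by blast
  have \<rho>: "\<rho> \<in> lmod_hom ?F Q" using BD' by blast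
  have \<rho>D: "\<rho> \<circ> (\<lambda>x. vec_mult_mat x D) \<in> lmod_hom (module_vec TYPE('a) k) Q"
    by (rule lmod_hom_comp[OF vec_mult_mat_hom[OF D] \<rho>])
  have \<rho>c: "\<rho> y \<in> carrier Q" if "y \<in> carrier_vec m" for y using BD' that by blast
  obtain h where h: "h \<in> lmod_hom N Q" "\<And>x. x \<in> carrier_vec k \<Longrightarrow> h (\<pi> x) = \<rho> (vec_mult_mat x D)"
  proof (rule presents_factor[OF pB, unfolded d, OF \<rho>D])
    show "left_module Q" using BD' by blast
    fix y :: "'a vec" assume y: "y \<in> carrier_vec n"
    then show "(\<rho> \<circ> (\<lambda>x. vec_mult_mat x D)) (vec_mult_mat y B) = \<zero>\<^bsub>Q\<^esub>"
      using presents_row[OF pBD BD y] by (simp add: vec_mult_mat_mult[OF y B D])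
  qed (auto simp: d)
  define f where "f x = (\<pi> x, - vec_mult_mat x D)" for x
  define g where "g z = h (fst z) \<oplus>\<^bsub>Q\<^esub> \<rho> (snd z)" for z
  have mD: "- D \<in> carrier_mat k m" using D by simp
  have f_eq: "f x = (\<pi> x, vec_mult_mat x (- D))" if "x \<in> carrier_vec k" for x
    using that D by (simp add: f_def vec_mult_mat_uminus_right)
  have f: "f \<in> lmod_hom (module_vec TYPE('a) k) (lmod_sum N ?F)"
  proof (rule lmod_homI)
    fix x y a assume x: "x \<in> carrier (module_vec TYPE('a) k)"
    then have x': "x \<in> carrier_vec k" by (simp add: module_vec_simps)
    show "f x \<in> carrier (lmod_sum N ?F)"
      using B' x' mD by (auto simp: f_eq lmod_sum_def module_vec_simps)
    show "f (a \<odot>\<^bsub>module_vec TYPE('a) k\<^esub> x) = a \<odot>\<^bsub>lmod_sum N ?F\<^esub> f x"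
      using lmod_hom_smult[OF \<pi>, of x a] B' x x' mD
      by (simp add: f_eq lmod_sum_def module_vec_simps vec_mult_mat_smult[of _ k _ m])
    assume y: "y \<in> carrier (module_vec TYPE('a) k)"
    then have y': "y \<in> carrier_vec k" by (simp add: module_vec_simps)
    show "f (x \<oplus>\<^bsub>module_vec TYPE('a) k\<^esub> y) = f x \<oplus>\<^bsub>lmod_sum N ?F\<^esub> f y"
      using lmod_hom_add[OF \<pi>, of x y] B' x x' y y' mD
      by (simp add: f_eq lmod_sum_def module_vec_simps vec_mult_mat_add[of _ k _ _ m])
  qed
  have g: "g \<in> lmod_hom (lmod_sum N ?F) Q"
  proof (rule lmod_homI)
    fix z w a assume "z \<in> carrier (lmod_sum N ?F)"
    then have z: "fst z \<in> carrier N" "snd z \<in> carrier ?F" by (auto simp: lmod_sum_def)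
    note zc = lmod_hom_closed[OF h(1) z(1)] lmod_hom_closed[OF \<rho> z(2)]
    show "g z \<in> carrier Q" using zc by (simp add: g_def)
    show "g (a \<odot>\<^bsub>lmod_sum N ?F\<^esub> z) = a \<odot>\<^bsub>Q\<^esub> g z"
      using z zc by (simp add: g_def lmod_sum_def case_prod_unfold lmod_hom_smult[OF h(1)] lmod_hom_smult[OF \<rho>] Q.smult_r_distr)
    assume "w \<in> carrier (lmod_sum N ?F)"
    then have w: "fst w \<in> carrier N" "snd w \<in> carrier ?F" by (auto simp: lmod_sum_def)
    note wc = lmod_hom_closed[OF h(1) w(1)] lmod_hom_closed[OF \<rho> w(2)]
    show "g (z \<oplus>\<^bsub>lmod_sum N ?F\<^esub> w) = g z \<oplus>\<^bsub>Q\<^esub> g w"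
      using z w zc wc by (simp add: g_def lmod_sum_def case_prod_unfold lmod_hom_add[OF h(1)] lmod_hom_add[OF \<rho>] Q.a_ac)
  qed
  have g_eq: "g (\<pi> x, y) = \<rho> (vec_mult_mat x D + y)" if "x \<in> carrier_vec k" "y \<in> carrier_vec m" for x y
    using that lmod_hom_add[OF \<rho>, of "vec_mult_mat x D" y] vec_mult_mat_carrier[OF D, of x]
    by (simp add: g_def h(2) module_vec_simps)
  have "g ` carrier (lmod_sum N ?F) = carrier Q"
  proof (intro equalityI subsetI)
    fix u assume "u \<in> carrier Q"
    then obtain y where y: "y \<in> carrier_vec m" "u = \<rho> y" using BD' by (metis imageE)
    have "u = g (\<pi> (0\<^sub>v k), y)"
      using y by (simp add: g_eq vec_mult_mat_zero_left[OF D])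
    moreover have "\<pi> (0\<^sub>v k) \<in> carrier N" using B' by (metis imageI zero_carrier_vec)
    ultimately show "u \<in> g ` carrier (lmod_sum N ?F)"
      using y by (auto simp: lmod_sum_def module_vec_simps)
  qed (use lmod_hom_closed[OF g] in blast)
  moreover have "g z = \<zero>\<^bsub>Q\<^esub> \<longleftrightarrow> z \<in> f ` carrier_vec k" if z_in: "z \<in> carrier (lmod_sum N ?F)" for z
  proof
    assume g0: "g z = \<zero>\<^bsub>Q\<^esub>"
    obtain x y where z: "z = (\<pi> x, y)" "x \<in> carrier_vec k" "y \<in> carrier_vec m"
    proof -
      have "fst z \<in> \<pi> ` carrier_vec k" "snd z \<in> carrier_vec m"
        using z_in B' by (auto simp: lmod_sum_def module_vec_simps)
      then show ?thesis using that by (metis imageE prod.collapse)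
    qed
    have xD: "vec_mult_mat x D \<in> carrier_vec m" using D by blast
    then have "vec_mult_mat x D + y \<in> carrier_vec m" using z by simp
    then obtain w where w: "w \<in> carrier_vec n" "vec_mult_mat x D + y = vec_mult_mat w (B * D)"
      using g0 BD' z by (auto simp: g_eq)
    \<comment> \<open>The kernel condition reads \<open>x D + y = w B D\<close>. Replacing
      \<open>x\<close> by \<open>x - w B\<close> does not change its class under
      \<open>\<pi>\<close> and makes \<open>y\<close> equal to \<open>- x' D\<close>.\<close>
    define x' where "x' = (- 1) \<cdot>\<^sub>v vec_mult_mat w B + x"
    have wB: "vec_mult_mat w B \<in> carrier_vec k" using B by blast
    have wBD: "vec_mult_mat (vec_mult_mat w B) D \<in> carrier_vec m" using D by blast
    have x': "x' \<in> carrier_vec k" using wB z by (simp add: x'_def)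
    have "x' = vec_mult_mat ((- 1) \<cdot>\<^sub>v w) B + x"
      using w B by (simp add: x'_def vec_mult_mat_smult)
    then have "\<pi> x' = \<pi> x"
      unfolding presents_eq_iff[OF pB B x' z(2)] using w by (intro bexI[of _ "(- 1) \<cdot>\<^sub>v w"]) auto
    moreover have "- vec_mult_mat x' D = y"
    proof -
      have "vec_mult_mat x' D = (- 1) \<cdot>\<^sub>v vec_mult_mat (vec_mult_mat w B) D + vec_mult_mat x D"
        using wB z D by (simp add: x'_def vec_mult_mat_add[of _ k _ _ m] vec_mult_mat_smult[of _ k _ m])
      also have "vec_mult_mat (vec_mult_mat w B) D = vec_mult_mat x D + y"
        using w vec_mult_mat_mult[OF w(1) B D] by simp
      finally have eq: "vec_mult_mat x' D = (- 1) \<cdot>\<^sub>v (vec_mult_mat x D + y) + vec_mult_mat x D" .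
      have "- ((- 1) \<cdot>\<^sub>v (p + y) + p) = y" if "p \<in> carrier_vec m" for p
        using that z(3) by (intro eq_vecI) auto
      then show ?thesis unfolding eq using xD .
    qed
    ultimately have "z = f x'" by (simp add: z f_def)
    then show "z \<in> f ` carrier_vec k" using x' by blast
  next
    assume "z \<in> f ` carrier_vec k"
    then obtain x where x: "x \<in> carrier_vec k" "z = f x" by blast
    have xD: "vec_mult_mat x D \<in> carrier_vec m" using D by blast
    have "vec_mult_mat x D + - vec_mult_mat x D = 0\<^sub>v m" using xD by (intro eq_vecI) auto
    then show "g z = \<zero>\<^bsub>Q\<^esub>"
      using x xD lmod_hom_zero[OF \<rho> left_module_vec Q.left_module_axioms] by (simp add: f_def g_eq module_vec_simps)
  qed
  ultimately have "right_exact (module_vec TYPE('a) k) f (lmod_sum N ?F) g Q"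
    using f g by (simp add: right_exact_iff module_vec_simps)
  then have "coker_below (diag_mat2 B (0\<^sub>m 0 m)) (diag_mat2 (0\<^sub>m 0 k) (B * D))"
    by (rule coker_belowI[OF presents_sum[OF pB presents_vec] presents_vec pBD])
  then show ?thesis using coker_below_diag_comm coker_below_trans by blast
qed

text \<open>Uses \<open>coker D \<rightarrow> coker B \<rightarrow> coker C \<rightarrow> 0\<close>, where \<open>B\<close> is the triangular block matrix.\<close>

lemma coker_below_triangular:
  fixes C D E :: "'a::ring_1 mat"
  assumes C: "C \<in> carrier_mat n m" and D: "D \<in> carrier_mat n' m'" and E: "E \<in> carrier_mat n m'"
  shows "coker_below (four_block_mat C E (0\<^sub>m n' m) D) (diag_mat2 C D)"
proof -
  define B where "B = four_block_mat C E (0\<^sub>m n' m) D"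
  have B: "B \<in> carrier_mat (n + n') (m + m')" using C D by (simp add: B_def)
  have Bmult: "vec_mult_mat (z @\<^sub>v w) B = vec_mult_mat z C @\<^sub>v (vec_mult_mat z E + vec_mult_mat w D)"
    if "z \<in> carrier_vec n" "w \<in> carrier_vec n'" for z w
    unfolding B_def using that C D E vec_mult_mat_carrier[OF C, of z]
    by (subst vec_mult_mat_append[of _ n _ n' _ m _ m']) (auto simp: vec_mult_mat_zero_right)
  obtain \<gamma> where pC: "presents C \<gamma> (cokernel C)" using presents_cokernel by blast
  obtain \<delta> where pD: "presents D \<delta> (cokernel D)" using presents_cokernel by blast
  obtain \<pi> where pB: "presents B \<pi> (cokernel B)" using presents_cokernel by blast
  note C' = pC[unfolded presents_iff[OF C]] and D' = pD[unfolded presents_iff[OF D]]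
    and B' = pB[unfolded presents_iff[OF B]]
  have dC: "dim_row C = n" "dim_col C = m" and dD: "dim_row D = n'" "dim_col D = m'"
    and dB: "dim_row B = n + n'" "dim_col B = m + m'"
    using B C D by auto
  have \<pi>: "\<pi> \<in> lmod_hom (module_vec TYPE('a) (m + m')) (cokernel B)" using B' by blast
  have \<gamma>: "\<gamma> \<in> lmod_hom (module_vec TYPE('a) m) (cokernel C)" using C' by blast
  obtain f where f: "f \<in> lmod_hom (cokernel D) (cokernel B)"
    "\<And>y. y \<in> carrier_vec m' \<Longrightarrow> f (\<delta> y) = (\<pi> \<circ> (\<lambda>y. 0\<^sub>v m @\<^sub>v y)) y"
    "f ` carrier (cokernel D) = (\<pi> \<circ> (\<lambda>y. 0\<^sub>v m @\<^sub>v y)) ` carrier_vec m'"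
  proof (rule presents_factor[OF pD, unfolded dD, OF lmod_hom_comp[OF vec_append_homs(2) \<pi>]])
    show "left_module (cokernel B)" using B' by blast
    fix y :: "'a vec" assume y: "y \<in> carrier_vec n'"
    have "vec_mult_mat (0\<^sub>v n @\<^sub>v y) B = 0\<^sub>v m @\<^sub>v vec_mult_mat y D"
      using y vec_mult_mat_carrier[OF D, of y]
      by (simp add: Bmult vec_mult_mat_zero_left[OF C] vec_mult_mat_zero_left[OF E])
    then show "(\<pi> \<circ> (\<lambda>y. 0\<^sub>v m @\<^sub>v y)) (vec_mult_mat y D) = \<zero>\<^bsub>cokernel B\<^esub>"
      using presents_row[OF pB B, of "0\<^sub>v n @\<^sub>v y"] y by simp
  qed (auto simp: dD)
  obtain g where g: "g \<in> lmod_hom (cokernel B) (cokernel C)"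
    "\<And>x. x \<in> carrier_vec (m + m') \<Longrightarrow> g (\<pi> x) = (\<gamma> \<circ> (\<lambda>v. vec_first v m)) x"
    "g ` carrier (cokernel B) = (\<gamma> \<circ> (\<lambda>v. vec_first v m)) ` carrier_vec (m + m')"
  proof (rule presents_factor[OF pB, unfolded dB, OF lmod_hom_comp[OF vec_append_homs(1) \<gamma>]])
    show "left_module (cokernel C)" using C' by blast
    fix v :: "'a vec" assume "v \<in> carrier_vec (n + n')"
    then obtain z w where v: "v = z @\<^sub>v w" "z \<in> carrier_vec n" "w \<in> carrier_vec n'" by (rule vec_append_cases)
    show "(\<gamma> \<circ> (\<lambda>v. vec_first v m)) (vec_mult_mat v B) = \<zero>\<^bsub>cokernel C\<^esub>"
      using v presents_row[OF pC C v(2)] vec_mult_mat_carrier[OF C, of z] by (simp add: Bmult vec_first_append)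
  qed (auto simp: dB)
  have g_append: "g (\<pi> (x @\<^sub>v y)) = \<gamma> x" if "x \<in> carrier_vec m" "y \<in> carrier_vec m'" for x y
    using that by (simp add: g(2) vec_first_append)
  have "(\<lambda>v. vec_first v m) ` carrier_vec (m + m') = (carrier_vec m :: 'a vec set)"
  proof (intro equalityI subsetI)
    fix x :: "'a vec" assume "x \<in> carrier_vec m"
    then show "x \<in> (\<lambda>v. vec_first v m) ` carrier_vec (m + m')"
      by (intro image_eqI[of _ _ "x @\<^sub>v 0\<^sub>v m'"]) (auto simp: vec_first_append)
  qed auto
  then have "g ` carrier (cokernel B) = carrier (cokernel C)"
    unfolding g(3) image_comp[symmetric] using C' by simp
  moreover have "g u = \<zero>\<^bsub>cokernel C\<^esub> \<longleftrightarrow> u \<in> f ` carrier (cokernel D)" if u_in: "u \<in> carrier (cokernel B)" for u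
  proof
    assume g0: "g u = \<zero>\<^bsub>cokernel C\<^esub>"
    obtain v where "v \<in> carrier_vec (m + m')" "u = \<pi> v" using u_in B' by (metis imageE)
    then obtain x y where u: "u = \<pi> (x @\<^sub>v y)" "x \<in> carrier_vec m" "y \<in> carrier_vec m'"
      by (metis vec_append_cases)
    then obtain z where z: "z \<in> carrier_vec n" "x = vec_mult_mat z C"
      using g0 C' by (auto simp: g_append)
    \<comment> \<open>Subtracting the relation of the triangular matrix with coefficients
      \<open>z\<close> clears the first block and changes \<open>y\<close> by
      \<open>z E\<close>.\<close>
    define y' where "y' = y - vec_mult_mat z E"
    have zE: "vec_mult_mat z E \<in> carrier_vec m'" using E by blast
    have y': "y' \<in> carrier_vec m'" using u zE by (simp add: y'_def)
    have xy: "x @\<^sub>v y = vec_mult_mat (z @\<^sub>v 0\<^sub>v n') B + (0\<^sub>v m @\<^sub>v y')"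
    proof -
      have "vec_mult_mat (z @\<^sub>v 0\<^sub>v n') B = x @\<^sub>v vec_mult_mat z E"
        using z zE by (simp add: Bmult vec_mult_mat_zero_left[OF D])
      moreover have "vec_mult_mat z E + y' = y"
        using vec_diff_eq_iff[OF u(3) zE y'] comm_add_vec[OF zE y'] by (simp add: y'_def[symmetric])
      ultimately show ?thesis
        using append_vec_add[of x m "0\<^sub>v m" "vec_mult_mat z E" m' y'] u zE y' by simp
    qed
    then have "u = \<pi> (0\<^sub>v m @\<^sub>v y')"
      unfolding u(1) using presents_eq_iff[OF pB B, of "x @\<^sub>v y" "0\<^sub>v m @\<^sub>v y'"] u(2,3) z(1) y' xy
      by (metis append_carrier_vec zero_carrier_vec)
    then show "u \<in> f ` carrier (cokernel D)" unfolding f(3) using y' by auto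
  next
    assume "u \<in> f ` carrier (cokernel D)"
    then obtain y where y: "y \<in> carrier_vec m'" "u = \<pi> (0\<^sub>v m @\<^sub>v y)" unfolding f(3) by auto
    then show "g u = \<zero>\<^bsub>cokernel C\<^esub>"
      using g_append[of "0\<^sub>v m" y] lmod_hom_zero[OF \<gamma> left_module_vec] C' by (simp add: module_vec_simps)
  qed
  ultimately have "right_exact (cokernel D) f (cokernel B) g (cokernel C)"
    using f(1) g(1) by (simp add: right_exact_iff)
  then have "coker_below B (diag_mat2 D C)"
    by (rule coker_belowI[OF pB pD pC])
  then show ?thesis unfolding B_def using coker_below_diag_comm coker_below_trans by blast
qed

text \<open>Left factors and the splitting of a triangular matrix preserve the number of columns, so
  a comparison of cokernels suffices there. A right factor changes this number, and the free
  summands in \<open>coker_below_mult_right\<close> are exactly the unit multiples in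
  \<open>dual\<close>. Hence \<open>k = 0\<close> works in every case.\<close>

lemma mat_below_imp_dual:
  assumes "mat_below A B"
  shows "V.dual A B"
  using assms unfolding mat_below_def
proof (induction rule: rtranclp_induct)
  case base
  show ?case by (rule V.dual_refl)
next
  case (step A' B)
  have "V.dual A' B"
    using step.hyps(2) unfolding mat_below1_def
  proof (elim disjE exE conjE)
    fix C D assume d: "dim_col C = dim_row B" "dim_row D = dim_col B" and A': "A' = C * B * D"
    let ?n = "dim_row B" and ?k = "dim_col B" and ?m = "dim_col D"
    have c: "C \<in> carrier_mat (dim_row C) ?n" "B \<in> carrier_mat ?n ?k" "D \<in> carrier_mat ?k ?m"
      using d by auto
    \<comment> \<open>The two factors are removed one at a time, since they act on cokernels by
      different mechanisms.\<close>
    have eq: "A' = C * (B * D)"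
      unfolding A' by (rule assoc_mult_mat[OF c])
    have "V.dual (C * (B * D)) (B * D)"
      using coker_below_diag_right[OF coker_below_mult_left[OF c(1) mult_carrier_mat[OF c(2,3)]]]
      by (intro V.dualI[of _ _ 0]) simp
    moreover have "V.dual (B * D) B"
      using coker_below_mult_right[OF c(2,3)] by (intro V.dualI[of _ _ 0]) simp
    ultimately show ?thesis unfolding eq by (rule V.dual_trans)
  next
    fix C D E assume d: "dim_row E = dim_row C" "dim_col E = dim_col D"
      and B: "B = four_block_mat C E (0\<^sub>m (dim_row D) (dim_col C)) D" and A': "A' = diag_mat2 C D"
    have "E \<in> carrier_mat (dim_row C) (dim_col D)" using d by auto
    then have "coker_below B A'"
      unfolding A' B by (intro coker_below_triangular) auto
    then have "coker_below (diag_mat2 B X) (diag_mat2 A' X)" for X by (rule coker_below_diag_right)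
    then show ?thesis by (intro V.dualI[of _ _ 0]) (simp add: A' B)
  qed
  then show ?case using step.IH V.dual_trans by blast
qed

section \<open>The isomorphism\<close>

interpretation VW: mat_class_dual_pair
  coker_below "0\<^sub>m 0" "\<lambda>A. VM_class (cokernel A)" "VM TYPE('a::ring_1)" VM_le
  mat_below "1\<^sub>m" WM_class "WM TYPE('a)" WM_le
proof
  show "coker_below A B \<Longrightarrow> W.dual A B" for A B :: "'a mat" by (rule coker_below_imp_dual)
  show "mat_below A B \<Longrightarrow> V.dual A B" for A B :: "'a mat" by (rule mat_below_imp_dual)
  \<comment> \<open>The matrix that stands for the unit in \<open>VM\<close> has no rows and is
    neutral in \<open>WM\<close>.\<close>
  show "WM_class (0\<^sub>m 0 1) = \<one>\<^bsub>WM TYPE('a)\<^esub>"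
    by (auto simp: W.one_eq WM_class_eq_iff intro: mat_below_zero)
  \<comment> \<open>Conversely the identity matrix, the unit of \<open>WM\<close>, imposes every
    vector as a relation, so its cokernel is zero.\<close>
  have "coker_below (1\<^sub>m 1 :: 'a mat) (0\<^sub>m 0 0)"
  proof -
    obtain \<pi> where \<pi>: "presents (1\<^sub>m 1 :: 'a mat) \<pi> (cokernel (1\<^sub>m 1))" using presents_cokernel by blast
    interpret L: left_module "cokernel (1\<^sub>m 1 :: 'a mat)" using presentsD(1)[OF \<pi>] .
    have "\<pi> x = \<zero>\<^bsub>cokernel (1\<^sub>m 1)\<^esub>" if "x \<in> carrier_vec 1" for x
      using presents_row[OF \<pi> one_carrier_mat that] that by (simp add: vec_mult_mat_one)
    then have "carrier (cokernel (1\<^sub>m 1 :: 'a mat)) \<subseteq> {\<zero>\<^bsub>cokernel (1\<^sub>m 1)\<^esub>}"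
      unfolding presentsD(3)[OF \<pi>, symmetric] by auto
    then have "(\<lambda>_. \<zero>\<^bsub>cokernel (1\<^sub>m 1)\<^esub>) ` carrier (module_vec TYPE('a) 0) = carrier (cokernel (1\<^sub>m 1 :: 'a mat))"
      using L.zero_closed by (auto simp: module_vec_simps carrier_vec_0)
    then show ?thesis
      by (intro coker_below_surj[OF \<pi> presents_vec lmod_hom_const_zero] L.left_module_axioms)
  qed
  then show "VM_class (cokernel (1\<^sub>m 1)) = \<one>\<^bsub>VM TYPE('a)\<^esub>"
    unfolding V.one_eq V.cls_eq_iff using coker_below_empty by blast
qed

theorem theorem6p2:
  "\<exists>\<Phi>.
     po_abelian_group_unit_iso
       (GV TYPE('a::ring_1)) (GV_pos TYPE('a)) (GV_of (regular_lmod TYPE('a)))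
       (GW TYPE('a)) (GW_pos TYPE('a)) (GW_of (1\<^sub>m 1)) \<Phi> \<and>
     (\<forall>n m. \<forall>A \<in> carrier_mat n m.
        \<Phi> (GV_of (coker n m A)) =
          GW_of (1\<^sub>m 1) [^]\<^bsub>GW TYPE('a)\<^esub> m \<otimes>\<^bsub>GW TYPE('a)\<^esub> inv\<^bsub>GW TYPE('a)\<^esub> (GW_of A) \<and>
        inv_into (carrier (GV TYPE('a))) \<Phi> (GW_of A) =
          GV_of (regular_lmod TYPE('a)) [^]\<^bsub>GV TYPE('a)\<^esub> m
            \<otimes>\<^bsub>GV TYPE('a)\<^esub> inv\<^bsub>GV TYPE('a)\<^esub> (GV_of (coker n m A)))"
proof (intro exI conjI allI ballI)
  \<comment> \<open>The ring as a module over itself has one generator and no relations.\<close>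
  have regular: "VM_class (regular_lmod TYPE('a)) = VM_class (cokernel (0\<^sub>m 0 1 :: 'a mat))"
    by (rule VM_class_cokernel[OF presents_regular])
  show "po_abelian_group_unit_iso
       (GV TYPE('a)) (GV_pos TYPE('a)) (GV_of (regular_lmod TYPE('a)))
       (GW TYPE('a)) (GW_pos TYPE('a)) (GW_of (1\<^sub>m 1)) VW.F.dual_map"
    unfolding regular by (rule VW.dual_map_iso)
  fix n m and A :: "'a mat" assume "A \<in> carrier_mat n m"
  then have d: "dim_row A = n" "dim_col A = m" by auto
  \<comment> \<open>\<open>dual_map_of\<close> yields the formal difference of
    \<open>cls (U m)\<close> and \<open>cls A\<close>; as \<open>cls (U m)\<close> is a power of the
    class of \<open>U 1\<close>, it has the form required here.\<close>
  show "VW.F.dual_map (GV_of (coker n m A)) =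
      GW_of (1\<^sub>m 1) [^]\<^bsub>GW TYPE('a)\<^esub> m \<otimes>\<^bsub>GW TYPE('a)\<^esub> inv\<^bsub>GW TYPE('a)\<^esub> (GW_of A)"
    using VW.F.dual_map_of[of A] unfolding d
    by (simp only: W.groth_pow_diff[OF W.cls_closed W.cls_closed] W.cls_U[of m])
  show "inv_into (carrier (GV TYPE('a))) VW.F.dual_map (GW_of A) =
      GV_of (regular_lmod TYPE('a)) [^]\<^bsub>GV TYPE('a)\<^esub> m
        \<otimes>\<^bsub>GV TYPE('a)\<^esub> inv\<^bsub>GV TYPE('a)\<^esub> (GV_of (coker n m A))"
    using VW.inv_into_dual_map[of A] V.cls_U[where 'a = 'a, of m] V.groth_pow_diff[OF V.cls_closed V.cls_closed, of "0\<^sub>m 0 1" m A]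
    unfolding d regular by simp
qed

end
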